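(* For $j=1,2$ let $f^j$ (real-valued) and $g$ ($\mathbb R^{1\times l}$-valued) be random coefficients defined for $(t,y,z)\in[0,T]\times\mathbb R\times\mathbb R^d$, with $f^j(t,y,z)\in L^2(\mathcal G_t;\mathbb R)$ and $g(t,y,z)\in L^2(\mathcal G_t;\mathbb R^{1\times l})$, such that for some constants $c>0$ and $0<\alpha_1<1$ and all $t\in[0,T]$, $y,y'\in\mathbb R$, $z,z'\in\mathbb R^d$, $$|f^j(t,y,z)-f^j(t,y',z')|^2\le c(|y-y'|^2+|z-z'|^2),\qquad E\Big[\int_0^T|f^j(s,0,0)|^2ds\Big]<\infty,$$ $$|g(t,y,z)-g(t,y',z')|^2\le c|y-y'|^2+\alpha_1|z-z'|^2,\qquad E\Big[\int_0^T|g(s,y,z)|^2ds\Big]<\infty.$$ Let $\xi^j_T\in L^2(\mathcal G_T;\mathbb R)$ and let $(Y^j,Z^j)\in S^2_{\mathcal G}(0,T;\mathbb R)\times L^2_{\mathcal G}(0,T;\mathbb R^d)$ $(j=1,2)$ be the unique solutions of $$Y^j_t=\xi^j_T+\int_t^Tf^j(s,Y^j_s,Z^j_s)\,ds+\int_t^Tg(s,Y^j_s,Z^j_s)\,d\overleftarrow{B}_s-\int_t^TZ^j_s\,dW_s,\qquad t\in[0,T].$$ If $\xi^1_T\ge\xi^2_T$ a.s., and for any $(t,y,z)\in[0,T]\times\mathbb R\times\mathbb R^d$, $f^1(t,y,z)\ge f^2(t,y,z)$ a.s., then $Y^1_t\ge Y^2_t$ a.s., for all $t\in[0,T]$.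
   Context: Let $T>0$ and $K\ge 0$ be fixed constants. $W$ and $B$ are two mutually independent standard Brownian motions on $[0,T+K]$ with values in $\mathbb R^d$ and $\mathbb R^l$ respectively, defined on a probability space $(\Omega,\mathcal F,P)$; $\mathcal N$ is the class of $P$-null sets of $\mathcal F$. For a process $\varphi$, $\mathcal F^{\varphi}_{s,t}=\sigma\{\varphi_r-\varphi_s,\ s\le r\le t\}\vee\mathcal N$. Set $\mathcal G_s:=\mathcal F^W_{0,s}\vee\mathcal F^B_{s,T+K}$ for $s\in[0,T+K]$. The family $(\mathcal G_s)$ is not a filtration; "$\mathcal G_t$-progressively measurable" is understood as jointly measurable in $(\omega,t)$ with the value at time $t$ being $\mathcal G_t$-measurable. $L^2(\mathcal G_t;\mathbb R^m)$: square-integrable $\mathcal G_t$-measurable $\mathbb R^m$-valued random variables. $L^2_{\mathcal G}(a,b;\mathbb R^m)$: $\mathcal G_t$-progressively measurable $\mathbb R^m$-valued processes $\varphi$ on $[a,b]$ with $E\int_a^b|\varphi_t|^2dt<\infty$. $S^2_{\mathcal G}(a,b;\mathbb R^m)$: continuous $\mathcal G_t$-progressively measurable processes $\varphi$ on $[a,b]$ with $E[\sup_{a\le t\le b}|\varphi_t|^2]<\infty$. The integral with respect to $d\overleftarrow{B}$ is the backward Itô integral and the integral with respect to $dW$ is the standard forward Itô integral. *)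

theory Defs
  imports "HOL-Probability.Probability"
begin

text \<open>
  Processes are functions of time and then of the sample point, \<open>\<phi> :: real \<Rightarrow> 'w \<Rightarrow> 'a\<close>; a
  family of sub-sigma-algebras is a function \<open>H :: real \<Rightarrow> 'w measure\<close> of which only
  \<open>sets (H t)\<close> matters. Expectations are always taken with respect to \<open>M\<close>.
\<close>

text \<open>
  Standard Brownian motion on \<open>[0,S]\<close> with values in \<open>\<real>\<close>\<open>^'n\<close>: the increment over
  \<open>[s,t]\<close> has the centred normal law with covariance \<open>(t - s)\<close> times the identity, given by
  its density with respect to Lebesgue measure.
\<close>

definition brownian_motion ::
    "'w measure \<Rightarrow> real \<Rightarrow> (real \<Rightarrow> 'w \<Rightarrow> real ^ 'n) \<Rightarrow> bool" where
  "brownian_motion M S W \<longleftrightarrow>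
     (\<forall>t\<in>{0..S}. W t \<in> borel_measurable M) \<and>
     (AE \<omega> in M. W 0 \<omega> = 0) \<and>
     (AE \<omega> in M. continuous_on {0..S} (\<lambda>t. W t \<omega>)) \<and>
     (\<forall>n (\<tau> :: nat \<Rightarrow> real). mono_on {..n} \<tau> \<longrightarrow> \<tau> ` {..n} \<subseteq> {0..S} \<longrightarrow>
        prob_space.indep_vars M (\<lambda>_. borel)
          (\<lambda>i \<omega>. W (\<tau> (Suc i)) \<omega> - W (\<tau> i) \<omega>) {..<n}) \<and>
     (\<forall>s t. 0 \<le> s \<longrightarrow> s < t \<longrightarrow> t \<le> S \<longrightarrow>
        distributed M lborel (\<lambda>\<omega>. W t \<omega> - W s \<omega>)
          (\<lambda>x. ennreal (\<Prod>i\<in>UNIV. normal_density 0 (sqrt (t - s)) (x $ i))))"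

definition indep_processes ::
    "'w measure \<Rightarrow> real \<Rightarrow> (real \<Rightarrow> 'w \<Rightarrow> real ^ 'm) \<Rightarrow> (real \<Rightarrow> 'w \<Rightarrow> real ^ 'n) \<Rightarrow> bool" where
  "indep_processes M S W B \<longleftrightarrow>
     prob_space.indep_set M
       (sigma_sets (space M) {W t -` A \<inter> space M | t A. t \<in> {0..S} \<and> A \<in> sets borel})
       (sigma_sets (space M) {B t -` A \<inter> space M | t A. t \<in> {0..S} \<and> A \<in> sets borel})"

definition incr_sigma ::
    "'w measure \<Rightarrow> (real \<Rightarrow> 'w \<Rightarrow> 'a::euclidean_space) \<Rightarrow> real \<Rightarrow> real \<Rightarrow> 'w measure" where
  "incr_sigma M \<phi> s t =
     sigma (space M)
       ({(\<lambda>\<omega>. \<phi> r \<omega> - \<phi> s \<omega>) -` A \<inter> space M | r A. r \<in> {s..t} \<and> A \<in> sets borel}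
        \<union> null_sets M)"

definition join_sigma :: "'w measure \<Rightarrow> 'w measure \<Rightarrow> 'w measure \<Rightarrow> 'w measure" where
  "join_sigma M F F' = sigma (space M) (sets F \<union> sets F')"

text \<open>The (non-monotone) family \<open>\<G>\<close> on \<open>[0,S]\<close>; in the application \<open>S = T + K\<close>.\<close>

definition bd_sigma ::
    "'w measure \<Rightarrow> real \<Rightarrow> (real \<Rightarrow> 'w \<Rightarrow> real ^ 'd) \<Rightarrow> (real \<Rightarrow> 'w \<Rightarrow> real ^ 'l) \<Rightarrow> real \<Rightarrow> 'w measure"
  where
  "bd_sigma M S W B s = join_sigma M (incr_sigma M W 0 s) (incr_sigma M B s S)"

text \<open>
  An increasing and a decreasing family, both containing \<open>bd_sigma M S W B t\<close> at each time \<open>t\<close>.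
  By independence \<open>W\<close> is a Brownian motion with respect to the first, and \<open>B\<close> a backward
  Brownian motion with respect to the second; they are the (backward) filtrations of the Ito
  integrals.
\<close>

definition fwd_sigma ::
    "'w measure \<Rightarrow> real \<Rightarrow> (real \<Rightarrow> 'w \<Rightarrow> real ^ 'd) \<Rightarrow> (real \<Rightarrow> 'w \<Rightarrow> real ^ 'l) \<Rightarrow> real \<Rightarrow> 'w measure"
  where
  "fwd_sigma M S W B t = join_sigma M (incr_sigma M W 0 t) (incr_sigma M B 0 S)"

definition bwd_sigma ::
    "'w measure \<Rightarrow> real \<Rightarrow> (real \<Rightarrow> 'w \<Rightarrow> real ^ 'd) \<Rightarrow> (real \<Rightarrow> 'w \<Rightarrow> real ^ 'l) \<Rightarrow> real \<Rightarrow> 'w measure"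
  where
  "bwd_sigma M S W B t = join_sigma M (incr_sigma M W 0 S) (incr_sigma M B t S)"

definition L2_rv :: "'w measure \<Rightarrow> 'w measure \<Rightarrow> ('w \<Rightarrow> 'a::euclidean_space) \<Rightarrow> bool" where
  "L2_rv M F X \<longleftrightarrow>
     X \<in> borel_measurable F \<and> (\<integral>\<^sup>+ \<omega>. ennreal ((norm (X \<omega>))\<^sup>2) \<partial>M) < \<infinity>"

definition progressive ::
    "'w measure \<Rightarrow> (real \<Rightarrow> 'w measure) \<Rightarrow> real \<Rightarrow> real \<Rightarrow> (real \<Rightarrow> 'w \<Rightarrow> 'a::euclidean_space) \<Rightarrow> bool"
  where
  "progressive M H a b \<phi> \<longleftrightarrow>
     (\<lambda>(\<omega>, t). \<phi> t \<omega>) \<in> borel_measurable (M \<Otimes>\<^sub>M restrict_space borel {a..b}) \<and>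
     (\<forall>t\<in>{a..b}. \<phi> t \<in> borel_measurable (H t))"

definition mean_sq ::
    "'w measure \<Rightarrow> real \<Rightarrow> real \<Rightarrow> (real \<Rightarrow> 'w \<Rightarrow> 'a::euclidean_space) \<Rightarrow> ennreal" where
  "mean_sq M a b \<phi> =
     (\<integral>\<^sup>+ \<omega>. (\<integral>\<^sup>+ t\<in>{a..b}. ennreal ((norm (\<phi> t \<omega>))\<^sup>2) \<partial>lborel) \<partial>M)"

definition L2_process ::
    "'w measure \<Rightarrow> (real \<Rightarrow> 'w measure) \<Rightarrow> real \<Rightarrow> real \<Rightarrow> (real \<Rightarrow> 'w \<Rightarrow> 'a::euclidean_space) \<Rightarrow> bool"
  where
  "L2_process M H a b \<phi> \<longleftrightarrow> progressive M H a b \<phi> \<and> mean_sq M a b \<phi> < \<infinity>"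

definition S2_process ::
    "'w measure \<Rightarrow> (real \<Rightarrow> 'w measure) \<Rightarrow> real \<Rightarrow> real \<Rightarrow> (real \<Rightarrow> 'w \<Rightarrow> 'a::euclidean_space) \<Rightarrow> bool"
  where
  "S2_process M H a b \<phi> \<longleftrightarrow>
     progressive M H a b \<phi> \<and>
     (AE \<omega> in M. continuous_on {a..b} (\<lambda>t. \<phi> t \<omega>)) \<and>
     (\<integral>\<^sup>+ \<omega>. (SUP t\<in>{a..b}. ennreal ((norm (\<phi> t \<omega>))\<^sup>2)) \<partial>M) < \<infinity>"

definition partition_points :: "real \<Rightarrow> real \<Rightarrow> nat \<Rightarrow> (nat \<Rightarrow> real) \<Rightarrow> bool" where
  "partition_points a b n \<tau> \<longleftrightarrow> mono_on {..n} \<tau> \<and> \<tau> 0 = a \<and> \<tau> n = b"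

text \<open>
  \<open>X\<close> is (a version of) the Ito integral of the \<open>H\<close>-adapted process \<open>\<phi>\<close> over \<open>[a,b]\<close>: the
  \<open>L\<^sup>2\<close> limit of the elementary integrals of simple processes, with bounded coefficients that
  are measurable at the left end of their interval, converging to \<open>\<phi>\<close> in mean square.
\<close>

definition has_ito_integral ::
    "'w measure \<Rightarrow> (real \<Rightarrow> 'w measure) \<Rightarrow> (real \<Rightarrow> 'w \<Rightarrow> real ^ 'n) \<Rightarrow> real \<Rightarrow> real \<Rightarrow>
     (real \<Rightarrow> 'w \<Rightarrow> real ^ 'n) \<Rightarrow> ('w \<Rightarrow> real) \<Rightarrow> bool" where
  "has_ito_integral M H W a b \<phi> X \<longleftrightarrow>
     L2_process M H a b \<phi> \<and> X \<in> borel_measurable M \<and>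
     (\<exists>(N :: nat \<Rightarrow> nat) (\<tau> :: nat \<Rightarrow> nat \<Rightarrow> real) (\<eta> :: nat \<Rightarrow> nat \<Rightarrow> 'w \<Rightarrow> real ^ 'n).
        (\<forall>k. partition_points a b (N k) (\<tau> k) \<and>
             (\<forall>i<N k. \<eta> k i \<in> borel_measurable (H (\<tau> k i)) \<and> bounded (\<eta> k i ` space M))) \<and>
        (\<lambda>k. mean_sq M a b (\<lambda>t \<omega>. \<phi> t \<omega> -
            (\<Sum>i<N k. indicator {\<tau> k i<..\<tau> k (Suc i)} t *\<^sub>R \<eta> k i \<omega>))) \<longlonglongrightarrow> 0 \<and>
        (\<lambda>k. \<integral>\<^sup>+ \<omega>. ennreal ((X \<omega> -
            (\<Sum>i<N k. \<eta> k i \<omega> \<bullet> (W (\<tau> k (Suc i)) \<omega> - W (\<tau> k i) \<omega>)))\<^sup>2) \<partial>M) \<longlonglongrightarrow> 0)"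

text \<open>
  Backward analogue for a decreasing family \<open>H\<close>: the coefficients are measurable at the right
  end of their interval, and the increments of \<open>B\<close> keep their forward orientation.
\<close>

definition has_backward_ito_integral ::
    "'w measure \<Rightarrow> (real \<Rightarrow> 'w measure) \<Rightarrow> (real \<Rightarrow> 'w \<Rightarrow> real ^ 'n) \<Rightarrow> real \<Rightarrow> real \<Rightarrow>
     (real \<Rightarrow> 'w \<Rightarrow> real ^ 'n) \<Rightarrow> ('w \<Rightarrow> real) \<Rightarrow> bool" where
  "has_backward_ito_integral M H B a b \<phi> X \<longleftrightarrow>
     L2_process M H a b \<phi> \<and> X \<in> borel_measurable M \<and>
     (\<exists>(N :: nat \<Rightarrow> nat) (\<tau> :: nat \<Rightarrow> nat \<Rightarrow> real) (\<eta> :: nat \<Rightarrow> nat \<Rightarrow> 'w \<Rightarrow> real ^ 'n).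
        (\<forall>k. partition_points a b (N k) (\<tau> k) \<and>
             (\<forall>i<N k. \<eta> k i \<in> borel_measurable (H (\<tau> k (Suc i))) \<and> bounded (\<eta> k i ` space M))) \<and>
        (\<lambda>k. mean_sq M a b (\<lambda>t \<omega>. \<phi> t \<omega> -
            (\<Sum>i<N k. indicator {\<tau> k i..<\<tau> k (Suc i)} t *\<^sub>R \<eta> k i \<omega>))) \<longlonglongrightarrow> 0 \<and>
        (\<lambda>k. \<integral>\<^sup>+ \<omega>. ennreal ((X \<omega> -
            (\<Sum>i<N k. \<eta> k i \<omega> \<bullet> (B (\<tau> k (Suc i)) \<omega> - B (\<tau> k i) \<omega>)))\<^sup>2) \<partial>M) \<longlonglongrightarrow> 0)"

text \<open>
  The coefficients \<open>f t y z\<close> and \<open>g t y z\<close> are random variables; row vectors in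
  \<open>\<real>\<close>\<open>^(1 \<times> l)\<close> are identified with \<open>real ^ 'l\<close>, so that \<open>g dB\<close> and \<open>Z dW\<close> are inner
  products. The second and third lines of conditions say that the integrands occurring in the
  equation are measurable and integrable. They are automatic for coefficients that are Lipschitz
  for every sample point, but not if this is only required almost surely.
\<close>

definition bdsde_solution ::
    "'w measure \<Rightarrow> real \<Rightarrow> real \<Rightarrow> (real \<Rightarrow> 'w \<Rightarrow> real ^ 'd) \<Rightarrow> (real \<Rightarrow> 'w \<Rightarrow> real ^ 'l) \<Rightarrow>
     (real \<Rightarrow> real \<Rightarrow> real ^ 'd \<Rightarrow> 'w \<Rightarrow> real) \<Rightarrow>
     (real \<Rightarrow> real \<Rightarrow> real ^ 'd \<Rightarrow> 'w \<Rightarrow> real ^ 'l) \<Rightarrow>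
     ('w \<Rightarrow> real) \<Rightarrow> (real \<Rightarrow> 'w \<Rightarrow> real) \<Rightarrow> (real \<Rightarrow> 'w \<Rightarrow> real ^ 'd) \<Rightarrow> bool" where
  "bdsde_solution M T K W B f g \<xi> Y Z \<longleftrightarrow>
     (let \<G> = bd_sigma M (T + K) W B;
          \<F> = (\<lambda>s \<omega>. f s (Y s \<omega>) (Z s \<omega>) \<omega>);
          \<Gamma> = (\<lambda>s \<omega>. g s (Y s \<omega>) (Z s \<omega>) \<omega>)
      in S2_process M \<G> 0 T Y \<and> L2_process M \<G> 0 T Z \<and>
         progressive M \<G> 0 T \<F> \<and> (AE \<omega> in M. set_integrable lborel {0..T} (\<lambda>s. \<F> s \<omega>)) \<and>
         L2_process M \<G> 0 T \<Gamma> \<and>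
         (\<forall>t\<in>{0..T}. \<exists>I J.
            has_backward_ito_integral M (bwd_sigma M (T + K) W B) B t T \<Gamma> I \<and>
            has_ito_integral M (fwd_sigma M (T + K) W B) W t T Z J \<and>
            (AE \<omega> in M. Y t \<omega> = \<xi> \<omega> + (LINT s:{t..T}|lborel. \<F> s \<omega>) + I \<omega> - J \<omega>)))"

end

theory Submission
  imports Defs
begin

text \<open>
  Let \<open>y\<close>, \<open>z\<close>, \<open>\<Gamma>\<close>, \<open>F\<close> be the differences (second solution minus first) of the solutions, their
  gradients, the diffusion coefficients and the generators along the solutions. For a test
  function \<open>\<psi>\<close> that vanishes exactly on \<open>(- \<infinity>, 0]\<close> one shows that \<open>E \<psi>(y\<^sub>t)\<close> is at most
  \<open>E \<psi>(y\<^sub>T)\<close> plus the integral over \<open>[t, T]\<close> of the expectation of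
  \<open>\<psi>'(y) F + \<psi>''(y) (|\<Gamma>|\<^sup>2 - |z|\<^sup>2) / 2\<close>; the Lipschitz conditions, \<open>\<alpha>\<^sub>1 < 1\<close> and
  \<open>(\<psi>')\<^sup>2 \<le> 2 \<psi> \<psi>''\<close> bound the integrand by a multiple of \<open>\<psi>(y)\<close>, and Gronwall's lemma gives
  \<open>E \<psi>(y\<^sub>t) = 0\<close>.

  The inequality replaces the Ito formula for mixed forward and backward integrals. It comes from a
  Taylor expansion over the intervals of a partition in which every backward increment is paired
  with the right end point and every forward increment with the left one, so that the first order
  terms have mean zero and the second order terms are given exactly by the Ito isometry. Only the
  Taylor remainders are estimated, by comparing the integrands with simple processes and using
  fourth moments of Brownian increments.
\<close>

section \<open>Square-integrable functions\<close>

text \<open>The obstacle is the product of a backward and a forward increment over the same cell: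
  neither factor is measurable with respect to the filtration of the other where conditioning would
  start, so its expectation is out of reach. The value of \<open>y\<close> at a time, however, is
  known to both filtrations, and this permits two one-sided expansions instead of one. A second
  obstacle is integrability. The integrands are only square integrable, so the stochastic increments
  need not have third or fourth moments. The Taylor remainder is therefore kept as the minimum of a
  quadratic and a cubic bound: the cubic one is spent on an elementary approximation with bounded
  coefficients, the quadratic one on the approximation error. By the isometry that error sums to a
  squared distance in mean square, whatever the mesh. Hence the order of limits: the approximants
  are fixed, the mesh tends to zero, and only then does the approximation improve. Between the
  finitely many jump times of the approximants all cells share one bounded coefficient, which keeps
  the moment bounds uniform in the mesh.\<close>

definition sq_int :: "'a measure \<Rightarrow> ('a \<Rightarrow> 'b::euclidean_space) \<Rightarrow> bool" where
  "sq_int N f \<longleftrightarrow> f \<in> borel_measurable N \<and> integrable N (\<lambda>x. (norm (f x))\<^sup>2)"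

lemma sq_int_measurable: "sq_int N f \<Longrightarrow> f \<in> borel_measurable N"
  and sq_int_integrable: "sq_int N f \<Longrightarrow> integrable N (\<lambda>x. (norm (f x))\<^sup>2)"
  by (auto simp: sq_int_def)

lemma sq_int_iff_nn:
  fixes f :: "'a \<Rightarrow> 'b::euclidean_space"
  assumes "f \<in> borel_measurable N"
  shows "sq_int N f \<longleftrightarrow> (\<integral>\<^sup>+x. ennreal ((norm (f x))\<^sup>2) \<partial>N) < \<infinity>"
  using assms by (auto simp: sq_int_def integrable_iff_bounded)

lemma power2_norm_add_le: "(norm (a + b :: 'b::real_normed_vector))\<^sup>2 \<le> 2 * (norm a)\<^sup>2 + 2 * (norm b)\<^sup>2"
proof -
  have "(norm (a + b))\<^sup>2 \<le> (norm a + norm b)\<^sup>2"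
    by (intro power_mono norm_triangle_ineq) auto
  also have "\<dots> \<le> 2 * (norm a)\<^sup>2 + 2 * (norm b)\<^sup>2"
    using sum_squares_bound[of "norm a" "norm b"] by (simp add: power2_sum)
  finally show ?thesis .
qed

lemma sq_int_bound:
  fixes f :: "'a \<Rightarrow> 'b::euclidean_space"
  assumes "f \<in> borel_measurable N" "integrable N g" "AE x in N. (norm (f x))\<^sup>2 \<le> g x"
  shows "sq_int N f"
  unfolding sq_int_def
proof
  have m: "(\<lambda>x. (norm (f x))\<^sup>2) \<in> borel_measurable N"
    using assms(1) by measurable
  show "integrable N (\<lambda>x. (norm (f x))\<^sup>2)"
    by (rule Bochner_Integration.integrable_bound[OF assms(2) m]) (use assms(3) in auto)
qed fact

lemma sq_int_add:
  fixes f g :: "'a \<Rightarrow> 'b::euclidean_space"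
  assumes "sq_int N f" "sq_int N g"
  shows "sq_int N (\<lambda>x. f x + g x)"
proof (rule sq_int_bound)
  show "integrable N (\<lambda>x. 2 * (norm (f x))\<^sup>2 + 2 * (norm (g x))\<^sup>2)"
    using assms by (auto simp: sq_int_def)
qed (use assms in \<open>auto simp: sq_int_def power2_norm_add_le\<close>)

lemma sq_int_scaleR_bounded:
  fixes f :: "'a \<Rightarrow> 'b::euclidean_space" and \<phi> :: "'a \<Rightarrow> real"
  assumes "sq_int N f" "\<phi> \<in> borel_measurable N" "AE x in N. \<bar>\<phi> x\<bar> \<le> C"
  shows "sq_int N (\<lambda>x. \<phi> x *\<^sub>R f x)"
proof (rule sq_int_bound)
  show "integrable N (\<lambda>x. C\<^sup>2 * (norm (f x))\<^sup>2)"
    using assms by (auto simp: sq_int_def)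
  show "AE x in N. (norm (\<phi> x *\<^sub>R f x))\<^sup>2 \<le> C\<^sup>2 * (norm (f x))\<^sup>2"
    using assms(3)
  proof eventually_elim
    case (elim x)
    then have "\<bar>\<phi> x\<bar>\<^sup>2 \<le> C\<^sup>2" by (intro power_mono) auto
    then show ?case
      by (simp add: power_mult_distrib mult_right_mono)
  qed
qed (use assms in \<open>auto simp: sq_int_def\<close>)

lemma sq_int_scaleR:
  fixes f :: "'a \<Rightarrow> 'b::euclidean_space"
  shows "sq_int N f \<Longrightarrow> sq_int N (\<lambda>x. c *\<^sub>R f x)"
  by (rule sq_int_scaleR_bounded[where C="\<bar>c\<bar>"]) auto

lemma sq_int_mult_bounded:
  fixes f :: "'a \<Rightarrow> real"
  assumes "sq_int N f" "\<phi> \<in> borel_measurable N" "AE x in N. \<bar>\<phi> x\<bar> \<le> C"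
  shows "sq_int N (\<lambda>x. \<phi> x * f x)"
  using sq_int_scaleR_bounded[OF assms] by simp

lemma sq_int_diff:
  fixes f g :: "'a \<Rightarrow> 'b::euclidean_space"
  assumes "sq_int N f" "sq_int N g"
  shows "sq_int N (\<lambda>x. f x - g x)"
  using sq_int_add[OF assms(1) sq_int_scaleR[OF assms(2), of "-1"]] by simp

lemma sq_int_integrable_inner:
  fixes f g :: "'a \<Rightarrow> 'b::euclidean_space"
  assumes "sq_int N f" "sq_int N g"
  shows "integrable N (\<lambda>x. f x \<bullet> g x)"
proof (rule Bochner_Integration.integrable_bound)
  show "integrable N (\<lambda>x. (norm (f x))\<^sup>2 + (norm (g x))\<^sup>2)"
    using assms by (auto simp: sq_int_def)
  show "(\<lambda>x. f x \<bullet> g x) \<in> borel_measurable N"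
    using assms by (auto simp: sq_int_def)
  show "AE x in N. norm (f x \<bullet> g x) \<le> norm ((norm (f x))\<^sup>2 + (norm (g x))\<^sup>2)"
  proof (rule AE_I2)
    fix x
    have "\<bar>f x \<bullet> g x\<bar> \<le> norm (f x) * norm (g x)" by (rule Cauchy_Schwarz_ineq2)
    moreover have "2 * (norm (f x) * norm (g x)) \<le> (norm (f x))\<^sup>2 + (norm (g x))\<^sup>2"
      using sum_squares_bound[of "norm (f x)" "norm (g x)"] by simp
    moreover have "0 \<le> norm (f x) * norm (g x)" by simp
    ultimately show "norm (f x \<bullet> g x) \<le> norm ((norm (f x))\<^sup>2 + (norm (g x))\<^sup>2)"
      by (simp only: real_norm_def)
  qed
qed

lemma sq_int_integrable_mult:
  fixes f g :: "'a \<Rightarrow> real"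
  shows "sq_int N f \<Longrightarrow> sq_int N g \<Longrightarrow> integrable N (\<lambda>x. f x * g x)"
  using sq_int_integrable_inner by fastforce

text \<open>Discriminant argument: the integral of
  \<open>(norm (f x + l *\<^sub>R g x))\<^sup>2\<close> is a nonnegative quadratic in
  \<open>l\<close>, evaluated at its minimum.\<close>

lemma integral_inner_Cauchy_Schwarz:
  fixes f g :: "'a \<Rightarrow> 'b::euclidean_space"
  assumes f: "sq_int N f" and g: "sq_int N g"
  shows "(\<integral>x. f x \<bullet> g x \<partial>N)\<^sup>2 \<le> (\<integral>x. (norm (f x))\<^sup>2 \<partial>N) * (\<integral>x. (norm (g x))\<^sup>2 \<partial>N)"
proof -
  let ?a = "\<integral>x. (norm (f x))\<^sup>2 \<partial>N" and ?b = "\<integral>x. f x \<bullet> g x \<partial>N" and ?c = "\<integral>x. (norm (g x))\<^sup>2 \<partial>N"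
  have q: "0 \<le> ?a + 2 * l * ?b + l\<^sup>2 * ?c" for l
  proof -
    have "0 \<le> (\<integral>x. (norm (f x + l *\<^sub>R g x))\<^sup>2 \<partial>N)" by simp
    also have "\<dots> = (\<integral>x. (norm (f x))\<^sup>2 + 2 * l * (f x \<bullet> g x) + l\<^sup>2 * (norm (g x))\<^sup>2 \<partial>N)"
      by (intro Bochner_Integration.integral_cong refl)
         (simp only: power2_norm_eq_inner inner_add_left inner_add_right inner_scaleR_left inner_scaleR_right,
          simp only: inner_commute power2_eq_square, simp add: algebra_simps inner_commute)
    also have "\<dots> = ?a + 2 * l * ?b + l\<^sup>2 * ?c"
      using f g sq_int_integrable_inner[OF f g] by (simp add: sq_int_def)
    finally show ?thesis .
  qed
  have a: "0 \<le> ?a" and c: "0 \<le> ?c" by simp_all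
  show ?thesis
  proof (cases "?c = 0")
    case True
    have "?b = 0"
    proof (rule ccontr)
      assume "?b \<noteq> 0"
      \<comment> \<open>Without its quadratic term the polynomial is affine in \<open>l\<close>, and
        this choice gives it the value -1.\<close>
      then show False using q[of "- (?a + 1) / (2 * ?b)"] True by (simp add: field_simps)
    qed
    then show ?thesis using True by simp
  next
    case False
    with c have "0 < ?c" by linarith
    then show ?thesis using q[of "- ?b / ?c"]
      by (simp add: field_simps power2_eq_square)
  qed
qed

section \<open>Convergence in mean square\<close>

definition l2_tendsto :: "'a measure \<Rightarrow> (nat \<Rightarrow> 'a \<Rightarrow> 'b::euclidean_space) \<Rightarrow> ('a \<Rightarrow> 'b) \<Rightarrow> bool" where
  "l2_tendsto N F f \<longleftrightarrow> (\<forall>k. sq_int N (F k)) \<and> sq_int N f \<and>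
     (\<lambda>k. \<integral>x. (norm (f x - F k x))\<^sup>2 \<partial>N) \<longlonglongrightarrow> 0"

text \<open>The Ito integrals are defined by limits of extended nonnegative integrals, with no
  integrability of \<open>X\<close> stated. Some distance in the sequence is finite, and
  \<open>f\<close> is then the sum of \<open>f - F k\<close> and \<open>F k\<close>, hence square
  integrable itself.\<close>

lemma l2_tendstoI_nn:
  fixes f :: "'a \<Rightarrow> 'b::euclidean_space"
  assumes F: "\<And>k. sq_int N (F k)" and f: "f \<in> borel_measurable N"
    and lim: "(\<lambda>k. \<integral>\<^sup>+x. ennreal ((norm (f x - F k x))\<^sup>2) \<partial>N) \<longlonglongrightarrow> 0"
  shows "l2_tendsto N F f"
proof -
  have Fm[measurable]: "F k \<in> borel_measurable N" for k using F by (simp add: sq_int_def)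
  note f[measurable]
  have "eventually (\<lambda>k. (\<integral>\<^sup>+x. ennreal ((norm (f x - F k x))\<^sup>2) \<partial>N) < \<infinity>) sequentially"
    using order_tendstoD(2)[OF lim, of \<infinity>] by simp
  then obtain k where "(\<integral>\<^sup>+x. ennreal ((norm (f x - F k x))\<^sup>2) \<partial>N) < \<infinity>"
    using eventually_happens'[OF sequentially_bot] by blast
  then have "sq_int N (\<lambda>x. f x - F k x)" by (subst sq_int_iff_nn) auto
  from sq_int_add[OF this F[of k]] have f2: "sq_int N f" by simp
  have "(\<integral>\<^sup>+x. ennreal ((norm (f x - F k x))\<^sup>2) \<partial>N) = ennreal (\<integral>x. (norm (f x - F k x))\<^sup>2 \<partial>N)" for k
    using sq_int_diff[OF f2 F[of k]] by (intro nn_integral_eq_integral) (auto simp: sq_int_def)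
  with lim have "(\<lambda>k. ennreal (\<integral>x. (norm (f x - F k x))\<^sup>2 \<partial>N)) \<longlonglongrightarrow> ennreal 0" by simp
  then have "(\<lambda>k. \<integral>x. (norm (f x - F k x))\<^sup>2 \<partial>N) \<longlonglongrightarrow> 0"
    by (subst (asm) tendsto_ennreal_iff) auto
  with F f2 show ?thesis by (auto simp: l2_tendsto_def)
qed

lemma l2_tendsto_cong_AE:
  fixes f :: "'a \<Rightarrow> 'b::euclidean_space"
  assumes "l2_tendsto N F f" "f' \<in> borel_measurable N" "AE x in N. f x = f' x"
  shows "l2_tendsto N F f'"
proof -
  have f: "f \<in> borel_measurable N" "\<And>k. F k \<in> borel_measurable N"
    using assms by (auto simp: l2_tendsto_def sq_int_def)
  have "sq_int N f'"
    by (rule sq_int_bound[where g="\<lambda>x. (norm (f x))\<^sup>2"])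
      (use assms in \<open>auto simp: l2_tendsto_def sq_int_def\<close>)
  moreover have "(\<integral>x. (norm (f x - F k x))\<^sup>2 \<partial>N) = (\<integral>x. (norm (f' x - F k x))\<^sup>2 \<partial>N)" for k
    using f assms(2,3) by (intro integral_cong_AE) auto
  ultimately show ?thesis using assms(1) by (simp add: l2_tendsto_def)
qed

lemma l2_tendsto_const: "sq_int N f \<Longrightarrow> l2_tendsto N (\<lambda>_. f) f"
  by (simp add: l2_tendsto_def)

lemma l2_tendsto_add:
  fixes f g :: "'a \<Rightarrow> 'b::euclidean_space"
  assumes f: "l2_tendsto N F f" and g: "l2_tendsto N G g"
  shows "l2_tendsto N (\<lambda>k x. F k x + G k x) (\<lambda>x. f x + g x)"
  unfolding l2_tendsto_def
proof (intro conjI allI)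
  have s: "\<And>k. sq_int N (F k)" "\<And>k. sq_int N (G k)" "sq_int N f" "sq_int N g"
    using f g by (auto simp: l2_tendsto_def)
  then show "sq_int N (\<lambda>x. F k x + G k x)" "sq_int N (\<lambda>x. f x + g x)" for k
    by (auto intro: sq_int_add)
  show "(\<lambda>k. \<integral>x. (norm (f x + g x - (F k x + G k x)))\<^sup>2 \<partial>N) \<longlonglongrightarrow> 0"
  proof (rule tendsto_sandwich[OF _ _ tendsto_const])
    show "(\<lambda>k. 2 * (\<integral>x. (norm (f x - F k x))\<^sup>2 \<partial>N) + 2 * (\<integral>x. (norm (g x - G k x))\<^sup>2 \<partial>N)) \<longlonglongrightarrow> 0"
      using f g by (auto simp: l2_tendsto_def intro!: tendsto_eq_intros)
    have i: "integrable N (\<lambda>x. (norm (f x - F k x))\<^sup>2)" "integrable N (\<lambda>x. (norm (g x - G k x))\<^sup>2)" for k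
      by (intro sq_int_integrable sq_int_diff s)+
    have "(\<integral>x. (norm (f x + g x - (F k x + G k x)))\<^sup>2 \<partial>N)
        \<le> (\<integral>x. 2 * (norm (f x - F k x))\<^sup>2 + 2 * (norm (g x - G k x))\<^sup>2 \<partial>N)" for k
    proof (rule integral_mono)
      show "integrable N (\<lambda>x. (norm (f x + g x - (F k x + G k x)))\<^sup>2)"
        using sq_int_diff[OF sq_int_add[OF s(3,4)] sq_int_add[OF s(1,2)], of k k] by (simp add: sq_int_def)
      show "(norm (f x + g x - (F k x + G k x)))\<^sup>2 \<le> 2 * (norm (f x - F k x))\<^sup>2 + 2 * (norm (g x - G k x))\<^sup>2" for x
        using power2_norm_add_le[of "f x - F k x" "g x - G k x"] by (simp add: algebra_simps)
    qed (use i in auto)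
    then show "eventually (\<lambda>k. (\<integral>x. (norm (f x + g x - (F k x + G k x)))\<^sup>2 \<partial>N)
        \<le> 2 * (\<integral>x. (norm (f x - F k x))\<^sup>2 \<partial>N) + 2 * (\<integral>x. (norm (g x - G k x))\<^sup>2 \<partial>N)) sequentially"
      using i by simp
  qed simp
qed

lemma l2_tendsto_scaleR_bounded:
  fixes f :: "'a \<Rightarrow> 'b::euclidean_space" and \<phi> :: "'a \<Rightarrow> real"
  assumes f: "l2_tendsto N F f" and \<phi>: "\<phi> \<in> borel_measurable N" "AE x in N. \<bar>\<phi> x\<bar> \<le> C"
  shows "l2_tendsto N (\<lambda>k x. \<phi> x *\<^sub>R F k x) (\<lambda>x. \<phi> x *\<^sub>R f x)"
  unfolding l2_tendsto_def
proof (intro conjI allI)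
  have s: "\<And>k. sq_int N (F k)" "sq_int N f"
    using f by (auto simp: l2_tendsto_def)
  then show "sq_int N (\<lambda>x. \<phi> x *\<^sub>R F k x)" "sq_int N (\<lambda>x. \<phi> x *\<^sub>R f x)" for k
    using \<phi> by (auto intro!: sq_int_scaleR_bounded)
  show "(\<lambda>k. \<integral>x. (norm (\<phi> x *\<^sub>R f x - \<phi> x *\<^sub>R F k x))\<^sup>2 \<partial>N) \<longlonglongrightarrow> 0"
  proof (rule tendsto_sandwich[OF _ _ tendsto_const])
    show "(\<lambda>k. C\<^sup>2 * (\<integral>x. (norm (f x - F k x))\<^sup>2 \<partial>N)) \<longlonglongrightarrow> 0"
      using f by (auto simp: l2_tendsto_def intro!: tendsto_eq_intros)
    have i: "sq_int N (\<lambda>x. f x - F k x)" for k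
      using sq_int_diff s by blast
    have "(\<integral>x. (norm (\<phi> x *\<^sub>R f x - \<phi> x *\<^sub>R F k x))\<^sup>2 \<partial>N) \<le> (\<integral>x. C\<^sup>2 * (norm (f x - F k x))\<^sup>2 \<partial>N)" for k
    proof (rule integral_mono_AE)
      show "integrable N (\<lambda>x. (norm (\<phi> x *\<^sub>R f x - \<phi> x *\<^sub>R F k x))\<^sup>2)"
        using sq_int_scaleR_bounded[OF i \<phi>] by (simp add: sq_int_def scaleR_diff_right)
      show "integrable N (\<lambda>x. C\<^sup>2 * (norm (f x - F k x))\<^sup>2)" using i by (simp add: sq_int_def)
      show "AE x in N. (norm (\<phi> x *\<^sub>R f x - \<phi> x *\<^sub>R F k x))\<^sup>2 \<le> C\<^sup>2 * (norm (f x - F k x))\<^sup>2"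
        using \<phi>(2)
      proof eventually_elim
        case (elim x)
        then have "\<bar>\<phi> x\<bar>\<^sup>2 \<le> C\<^sup>2" by (intro power_mono) auto
        then show ?case
          by (simp add: power_mult_distrib mult_right_mono flip: scaleR_diff_right)
      qed
    qed
    then show "eventually (\<lambda>k. (\<integral>x. (norm (\<phi> x *\<^sub>R f x - \<phi> x *\<^sub>R F k x))\<^sup>2 \<partial>N)
        \<le> C\<^sup>2 * (\<integral>x. (norm (f x - F k x))\<^sup>2 \<partial>N)) sequentially" by simp
  qed simp
qed

text \<open>Expand the product of \<open>f - (f - F k)\<close> and \<open>g - (g - G k)\<close>:
  each of the three error terms has a factor tending to zero in norm, and Cauchy-Schwarz disposes of
  it. This carries isometry and orthogonality from elementary integrals to their limits.\<close>

lemma l2_tendsto_inner: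
  fixes f g :: "'a \<Rightarrow> 'b::euclidean_space"
  assumes f: "l2_tendsto N F f" and g: "l2_tendsto N G g"
  shows "(\<lambda>k. \<integral>x. F k x \<bullet> G k x \<partial>N) \<longlonglongrightarrow> (\<integral>x. f x \<bullet> g x \<partial>N)"
proof -
  have s: "\<And>k. sq_int N (F k)" "\<And>k. sq_int N (G k)" "sq_int N f" "sq_int N g"
    using f g by (auto simp: l2_tendsto_def)
  note d = sq_int_diff[OF s(3) s(1)] sq_int_diff[OF s(4) s(2)]
  have ab: "(\<lambda>k. \<integral>x. u k x \<bullet> v k x \<partial>N) \<longlonglongrightarrow> 0"
    if u: "\<And>k. sq_int N (u k)" and v: "\<And>k. sq_int N (v k)"
      and l: "(\<lambda>k. (\<integral>x. (norm (u k x))\<^sup>2 \<partial>N) * (\<integral>x. (norm (v k x))\<^sup>2 \<partial>N)) \<longlonglongrightarrow> 0"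
    for u v :: "nat \<Rightarrow> 'a \<Rightarrow> 'b"
  proof -
    have "(\<lambda>k. (\<integral>x. u k x \<bullet> v k x \<partial>N)\<^sup>2) \<longlonglongrightarrow> 0"
      by (rule tendsto_sandwich[OF _ _ tendsto_const l])
        (use integral_inner_Cauchy_Schwarz[OF u v] in auto)
    then show ?thesis by simp
  qed
  have F0: "(\<lambda>k. \<integral>x. (norm (f x - F k x))\<^sup>2 \<partial>N) \<longlonglongrightarrow> 0" and G0: "(\<lambda>k. \<integral>x. (norm (g x - G k x))\<^sup>2 \<partial>N) \<longlonglongrightarrow> 0"
    using f g by (auto simp: l2_tendsto_def)
  have 1: "(\<lambda>k. \<integral>x. (f x - F k x) \<bullet> g x \<partial>N) \<longlonglongrightarrow> 0"
    by (rule ab[OF d(1) s(4)]) (use F0 in \<open>auto intro!: tendsto_eq_intros\<close>)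
  have 2: "(\<lambda>k. \<integral>x. f x \<bullet> (g x - G k x) \<partial>N) \<longlonglongrightarrow> 0"
    by (rule ab[OF s(3) d(2)]) (use G0 in \<open>auto intro!: tendsto_eq_intros\<close>)
  have 3: "(\<lambda>k. \<integral>x. (f x - F k x) \<bullet> (g x - G k x) \<partial>N) \<longlonglongrightarrow> 0"
    by (rule ab[OF d(1,2)]) (use F0 G0 in \<open>auto intro!: tendsto_eq_intros\<close>)
  have "(\<lambda>k. (\<integral>x. f x \<bullet> g x \<partial>N) - (\<integral>x. (f x - F k x) \<bullet> g x \<partial>N) - (\<integral>x. f x \<bullet> (g x - G k x) \<partial>N)
      + (\<integral>x. (f x - F k x) \<bullet> (g x - G k x) \<partial>N)) \<longlonglongrightarrow> (\<integral>x. f x \<bullet> g x \<partial>N) - 0 - 0 + 0"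
    by (intro tendsto_intros 1 2 3)
  moreover have "(\<integral>x. F k x \<bullet> G k x \<partial>N) = (\<integral>x. f x \<bullet> g x \<partial>N) - (\<integral>x. (f x - F k x) \<bullet> g x \<partial>N) 
      - (\<integral>x. f x \<bullet> (g x - G k x) \<partial>N) + (\<integral>x. (f x - F k x) \<bullet> (g x - G k x) \<partial>N)" for k
  proof -
    have "(\<integral>x. F k x \<bullet> G k x \<partial>N) = (\<integral>x. f x \<bullet> g x - (f x - F k x) \<bullet> g x
      - f x \<bullet> (g x - G k x) + (f x - F k x) \<bullet> (g x - G k x) \<partial>N)"
      by (intro Bochner_Integration.integral_cong refl) (simp add: inner_diff_left inner_diff_right)
    also have "\<dots> = (\<integral>x. f x \<bullet> g x \<partial>N) - (\<integral>x. (f x - F k x) \<bullet> g x \<partial>N) 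
      - (\<integral>x. f x \<bullet> (g x - G k x) \<partial>N) + (\<integral>x. (f x - F k x) \<bullet> (g x - G k x) \<partial>N)"
      using s(3,4) d by (simp add: sq_int_integrable_inner)
    finally show ?thesis .
  qed
  ultimately show ?thesis by simp
qed

section \<open>Moments of a Gaussian vector\<close>

text \<open>Fubini in coordinates. Lebesgue measure on a Euclidean space is the image of a product
  measure indexed by \<open>Basis\<close>; the component indices are transported to it along
  \<open>axis\<close>.\<close>

lemma lborel_vec_integral_prod:
  fixes h :: "'n::finite \<Rightarrow> real \<Rightarrow> real"
  assumes h: "\<And>i. integrable lborel (h i)"
  shows "integrable lborel (\<lambda>x :: real ^ 'n. \<Prod>i\<in>UNIV. h i (x $ i))"
    and "(\<integral>x. (\<Prod>i\<in>UNIV. h i ((x :: real ^ 'n) $ i)) \<partial>lborel) = (\<Prod>i\<in>UNIV. \<integral>x. h i x \<partial>lborel)"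
proof -
  interpret product_sigma_finite "\<lambda>b :: real ^ 'n. lborel :: real measure" ..
  let ?ax = "\<lambda>i :: 'n. axis i 1 :: real ^ 'n"
  have inj: "inj ?ax" by (auto simp: inj_def axis_eq_axis)
  have B: "(Basis :: (real ^ 'n) set) = range ?ax" by (auto simp: Basis_vec_def)
  let ?k = "\<lambda>b. h (inv ?ax b)"
  have k: "?k (?ax i) = h i" for i by (simp add: inv_f_f[OF inj])
  have eq: "(\<Prod>i\<in>UNIV. h i ((\<Sum>b\<in>Basis. f b *\<^sub>R b) $ i)) = (\<Prod>b\<in>Basis. ?k b (f b))" for f
  proof -
    have "(\<Sum>b\<in>Basis. f b *\<^sub>R b) $ i = f (?ax i)" for i
    proof -
      have "(\<Sum>b\<in>Basis. f b *\<^sub>R b) $ i = (\<Sum>b\<in>Basis. f b *\<^sub>R b) \<bullet> ?ax i"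
        by (simp add: cart_eq_inner_axis)
      also have "\<dots> = f (?ax i)" by (rule inner_sum_left_Basis) simp
      finally show ?thesis .
    qed
    then have "(\<Prod>i\<in>UNIV. h i ((\<Sum>b\<in>Basis. f b *\<^sub>R b) $ i)) = (\<Prod>i\<in>UNIV. ?k (?ax i) (f (?ax i)))"
      by (simp only: k)
    also have "\<dots> = (\<Prod>b\<in>Basis. ?k b (f b))"
      unfolding B by (subst prod.reindex[OF inj]) (simp add: o_def)
    finally show ?thesis .
  qed
  have [measurable]: "h i \<in> borel_measurable borel" for i using h[of i] by auto
  have m: "(\<lambda>f. \<Sum>b\<in>Basis. f b *\<^sub>R b) \<in> (\<Pi>\<^sub>M b\<in>(Basis :: (real ^ 'n) set). (lborel :: real measure)) \<rightarrow>\<^sub>M borel"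
    by measurable
  have m2: "(\<lambda>x :: real ^ 'n. \<Prod>i\<in>UNIV. h i (x $ i)) \<in> borel_measurable borel"
    by measurable
  have i1: "integrable (\<Pi>\<^sub>M b\<in>Basis. lborel) (\<lambda>f. \<Prod>b\<in>Basis. ?k b (f b))"
    by (rule product_integrable_prod) (use h in auto)
  show "integrable lborel (\<lambda>x :: real ^ 'n. \<Prod>i\<in>UNIV. h i (x $ i))"
    by (subst lborel_eq) (use i1 in \<open>simp only: integrable_distr_eq[OF m m2] eq\<close>)
  have "(\<integral>x. (\<Prod>i\<in>UNIV. h i ((x :: real ^ 'n) $ i)) \<partial>lborel) 
      = (\<integral>f. (\<Prod>b\<in>Basis. ?k b (f b)) \<partial>(\<Pi>\<^sub>M b\<in>(Basis :: (real ^ 'n) set). lborel))"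
    by (subst lborel_eq) (simp only: integral_distr[OF m m2] eq)
  also have "\<dots> = (\<Prod>b\<in>(Basis :: (real ^ 'n) set). \<integral>x. ?k b x \<partial>lborel)"
    by (rule product_integral_prod) (use h in auto)
  also have "\<dots> = (\<Prod>i\<in>UNIV. \<integral>x. h i x \<partial>lborel)"
    unfolding B by (subst prod.reindex[OF inj]) (simp add: o_def k)
  finally show "(\<integral>x. (\<Prod>i\<in>UNIV. h i ((x :: real ^ 'n) $ i)) \<partial>lborel) = (\<Prod>i\<in>UNIV. \<integral>x. h i x \<partial>lborel)" .
qed

context
  fixes M :: "'w measure" and G :: "'w \<Rightarrow> real ^ 'n" and \<sigma> :: real
  assumes \<sigma>: "0 < \<sigma>"
    and G: "distributed M lborel G (\<lambda>x. ennreal (\<Prod>i\<in>UNIV. normal_density 0 \<sigma> (x $ i)))"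
begin

text \<open>The density is a product over the components, so the moment factorises. All moments
  below are obtained by choosing the exponents \<open>e\<close>, zero for the components that do not
  occur.\<close>

lemma gauss_vec_monomial:
  fixes e :: "'n \<Rightarrow> nat"
  shows "integrable M (\<lambda>\<omega>. \<Prod>i\<in>UNIV. (G \<omega> $ i) ^ e i)"
    and "(\<integral>\<omega>. (\<Prod>i\<in>UNIV. (G \<omega> $ i) ^ e i) \<partial>M) = (\<Prod>i\<in>UNIV. \<integral>x. normal_density 0 \<sigma> x * x ^ e i \<partial>lborel)"
proof -
  let ?d = "\<lambda>x :: real ^ 'n. \<Prod>i\<in>UNIV. normal_density 0 \<sigma> (x $ i)"
  have n: "0 \<le> ?d x" for x by (intro prod_nonneg) auto
  have m: "(\<lambda>x :: real ^ 'n. \<Prod>i\<in>UNIV. (x $ i) ^ e i) \<in> borel_measurable lborel" by measurable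
  have i: "integrable lborel (\<lambda>x. normal_density 0 \<sigma> x * x ^ e i)" for i
    using integrable_normal_moment[OF \<sigma>, of 0 "e i"] by simp
  have eq: "?d x * (\<Prod>i\<in>UNIV. (x $ i) ^ e i) = (\<Prod>i\<in>UNIV. normal_density 0 \<sigma> (x $ i) * (x $ i) ^ e i)" for x
    by (simp add: prod.distrib)
  note L = lborel_vec_integral_prod[of "\<lambda>i x. normal_density 0 \<sigma> x * x ^ e i", OF i]
  show "integrable M (\<lambda>\<omega>. \<Prod>i\<in>UNIV. (G \<omega> $ i) ^ e i)"
    using distributed_integrable[OF G m] n L(1) by (simp add: eq)
  show "(\<integral>\<omega>. (\<Prod>i\<in>UNIV. (G \<omega> $ i) ^ e i) \<partial>M) = (\<Prod>i\<in>UNIV. \<integral>x. normal_density 0 \<sigma> x * x ^ e i \<partial>lborel)"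
    using distributed_integral[OF G m] n L(2) by (simp add: eq)
qed

lemma normal_moments:
  "(\<integral>x. normal_density 0 \<sigma> x * x \<partial>lborel) = 0"
  "(\<integral>x. normal_density 0 \<sigma> x * x\<^sup>2 \<partial>lborel) = \<sigma>\<^sup>2"
  "(\<integral>x. normal_density 0 \<sigma> x * x ^ 4 \<partial>lborel) = 3 * \<sigma> ^ 4"
  "(\<integral>x. normal_density 0 \<sigma> x \<partial>lborel) = 1"
  using integral_normal_moment_odd[OF \<sigma>, of 0 0] integral_normal_moment_even[OF \<sigma>, of 0 1]
    integral_normal_moment_even[OF \<sigma>, of 0 2] integral_normal_moment_even[OF \<sigma>, of 0 0]
  by (simp_all add: fact_numeral power_divide flip: power_mult)

lemma gauss_vec_moment1:
  "integrable M (\<lambda>\<omega>. G \<omega> $ k)" "(\<integral>\<omega>. G \<omega> $ k \<partial>M) = 0"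
proof -
  let ?e = "\<lambda>i. if i = k then 1 else 0 :: nat"
  have "(\<Prod>i\<in>UNIV. (G \<omega> $ i) ^ ?e i) = G \<omega> $ k" for \<omega>
    by (subst prod.remove[of _ k]) (auto intro!: prod.neutral)
  moreover have "(\<Prod>i\<in>UNIV. \<integral>x. normal_density 0 \<sigma> x * x ^ ?e i \<partial>lborel) = 0"
    using normal_moments by (intro prod_zero bexI[of _ k]) auto
  ultimately show "integrable M (\<lambda>\<omega>. G \<omega> $ k)" "(\<integral>\<omega>. G \<omega> $ k \<partial>M) = 0"
    using gauss_vec_monomial[of ?e] by simp_all
qed

lemma gauss_vec_moment_single:
  "integrable M (\<lambda>\<omega>. (G \<omega> $ k) ^ m)"
  "(\<integral>\<omega>. (G \<omega> $ k) ^ m \<partial>M) = (\<integral>x. normal_density 0 \<sigma> x * x ^ m \<partial>lborel)"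
proof -
  let ?e = "\<lambda>i. if i = k then m else 0 :: nat"
  have "(\<Prod>i\<in>UNIV. (G \<omega> $ i) ^ ?e i) = (G \<omega> $ k) ^ m" for \<omega>
    by (subst prod.remove[of _ k]) (auto intro!: prod.neutral)
  moreover have "(\<Prod>i\<in>UNIV. \<integral>x. normal_density 0 \<sigma> x * x ^ ?e i \<partial>lborel) = (\<integral>x. normal_density 0 \<sigma> x * x ^ m \<partial>lborel)"
    using normal_moments by (subst prod.remove[of _ k]) auto
  ultimately show "integrable M (\<lambda>\<omega>. (G \<omega> $ k) ^ m)"
      "(\<integral>\<omega>. (G \<omega> $ k) ^ m \<partial>M) = (\<integral>x. normal_density 0 \<sigma> x * x ^ m \<partial>lborel)"
    using gauss_vec_monomial[of ?e] by simp_all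
qed

lemma gauss_vec_moment2:
  "integrable M (\<lambda>\<omega>. G \<omega> $ k * G \<omega> $ l)"
  "(\<integral>\<omega>. G \<omega> $ k * G \<omega> $ l \<partial>M) = (if k = l then \<sigma>\<^sup>2 else 0)"
proof -
  have "integrable M (\<lambda>\<omega>. G \<omega> $ k * G \<omega> $ l) \<and> (\<integral>\<omega>. G \<omega> $ k * G \<omega> $ l \<partial>M) = (if k = l then \<sigma>\<^sup>2 else 0)"
  proof (cases "k = l")
    case True
    then show ?thesis using gauss_vec_moment_single[of k 2] normal_moments by (simp add: power2_eq_square)
  next
    case False
    let ?e = "\<lambda>i. if i = k \<or> i = l then 1 else 0 :: nat"
    have "(\<Prod>i\<in>UNIV. (G \<omega> $ i) ^ ?e i) = (\<Prod>i\<in>{k, l}. G \<omega> $ i)" for \<omega>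
      by (rule prod.mono_neutral_cong_right) auto
    then have "(\<Prod>i\<in>UNIV. (G \<omega> $ i) ^ ?e i) = G \<omega> $ k * G \<omega> $ l" for \<omega>
      using False by simp
    moreover have "(\<Prod>i\<in>UNIV. \<integral>x. normal_density 0 \<sigma> x * x ^ ?e i \<partial>lborel) = 0"
      using normal_moments by (intro prod_zero bexI[of _ k]) auto
    ultimately show ?thesis
      using gauss_vec_monomial[of ?e] False by simp
  qed
  then show "integrable M (\<lambda>\<omega>. G \<omega> $ k * G \<omega> $ l)"
    "(\<integral>\<omega>. G \<omega> $ k * G \<omega> $ l \<partial>M) = (if k = l then \<sigma>\<^sup>2 else 0)" by auto
qed

lemma gauss_vec_norm2:
  "integrable M (\<lambda>\<omega>. (norm (G \<omega>))\<^sup>2)"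
  "(\<integral>\<omega>. (norm (G \<omega>))\<^sup>2 \<partial>M) = CARD('n) * \<sigma>\<^sup>2"
proof -
  have eq: "(norm (G \<omega>))\<^sup>2 = (\<Sum>i\<in>UNIV. G \<omega> $ i * G \<omega> $ i)" for \<omega>
    by (simp add: power2_norm_eq_inner inner_vec_def)
  show "integrable M (\<lambda>\<omega>. (norm (G \<omega>))\<^sup>2)" "(\<integral>\<omega>. (norm (G \<omega>))\<^sup>2 \<partial>M) = CARD('n) * \<sigma>\<^sup>2"
    unfolding eq by (simp_all add: gauss_vec_moment2)
qed

text \<open>Cauchy-Schwarz bounds the square of a sum of \<open>CARD('n)\<close> squares by
  \<open>CARD('n)\<close> times the sum of fourth powers; each of these has mean
  \<open>3 * \<sigma> ^ 4\<close>. An upper bound of the right order in \<open>\<sigma>\<close>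
  suffices for the Taylor remainder.\<close>

lemma gauss_vec_norm4:
  "integrable M (\<lambda>\<omega>. (norm (G \<omega>)) ^ 4)"
  "(\<integral>\<omega>. (norm (G \<omega>)) ^ 4 \<partial>M) \<le> 3 * (CARD('n))\<^sup>2 * \<sigma> ^ 4"
proof -
  have le: "(norm (G \<omega>)) ^ 4 \<le> CARD('n) * (\<Sum>i\<in>UNIV. (G \<omega> $ i) ^ 4)" for \<omega>
  proof -
    have "(norm (G \<omega>)) ^ 4 = ((norm (G \<omega>))\<^sup>2)\<^sup>2" by simp
    also have "\<dots> = (\<Sum>i\<in>UNIV. 1 * (G \<omega> $ i)\<^sup>2)\<^sup>2"
      by (simp only: power2_norm_eq_inner inner_vec_def) (simp add: power2_eq_square)
    also have "\<dots> \<le> (\<Sum>i\<in>(UNIV :: 'n set). 1\<^sup>2) * (\<Sum>i\<in>UNIV. ((G \<omega> $ i)\<^sup>2)\<^sup>2)"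
      by (rule Cauchy_Schwarz_ineq_sum)
    also have "\<dots> = CARD('n) * (\<Sum>i\<in>UNIV. (G \<omega> $ i) ^ 4)" by simp
    finally show ?thesis .
  qed
  have i: "integrable M (\<lambda>\<omega>. CARD('n) * (\<Sum>i\<in>UNIV. (G \<omega> $ i) ^ 4))"
    using gauss_vec_moment_single by simp
  have [measurable]: "G \<in> borel_measurable M"
    using distributed_measurable[OF G] by simp
  show I: "integrable M (\<lambda>\<omega>. (norm (G \<omega>)) ^ 4)"
    by (rule Bochner_Integration.integrable_bound[OF i]) (use le in \<open>auto intro!: order_trans[OF le]\<close>)
  have "(\<integral>\<omega>. (norm (G \<omega>)) ^ 4 \<partial>M) \<le> (\<integral>\<omega>. CARD('n) * (\<Sum>i\<in>UNIV. (G \<omega> $ i) ^ 4) \<partial>M)"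
    by (intro integral_mono I i le)
  also have "\<dots> = 3 * (CARD('n))\<^sup>2 * \<sigma> ^ 4"
    using gauss_vec_moment_single normal_moments by (simp add: power2_eq_square)
  finally show "(\<integral>\<omega>. (norm (G \<omega>)) ^ 4 \<partial>M) \<le> 3 * (CARD('n))\<^sup>2 * \<sigma> ^ 4" .
qed

end

section \<open>The isometry for elementary integrals\<close>

text \<open>
  The sign \<open>sg\<close> lets one theory serve both integrals: with \<open>sg = - 1\<close>, \<open>H s = K (- s)\<close> and
  \<open>W s = - B (- s)\<close>, integrands stay in the original time \<open>t = sg * s\<close> while \<open>W\<close> runs forward
  in the reversed time \<open>s\<close>.
\<close>

locale bm_filtration = prob_space M for M :: "'w measure" +
  fixes H :: "real \<Rightarrow> 'w measure" and W :: "real \<Rightarrow> 'w \<Rightarrow> real ^ 'n" and lo hi sg :: real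
  assumes sub: "\<And>r. r \<in> {lo..hi} \<Longrightarrow> subalgebra M (H r)"
    and mono: "\<And>r s. lo \<le> r \<Longrightarrow> r \<le> s \<Longrightarrow> s \<le> hi \<Longrightarrow> sets (H r) \<subseteq> sets (H s)"
    and adapted: "\<And>r s. lo \<le> r \<Longrightarrow> r \<le> s \<Longrightarrow> s \<le> hi \<Longrightarrow> (\<lambda>\<omega>. W s \<omega> - W r \<omega>) \<in> borel_measurable (H s)"
    and indep: "\<And>r s. lo \<le> r \<Longrightarrow> r < s \<Longrightarrow> s \<le> hi \<Longrightarrow>
      indep_set (sets (H r)) {(\<lambda>\<omega>. W s \<omega> - W r \<omega>) -` A \<inter> space M | A. A \<in> sets borel}"
    and gauss: "\<And>r s. lo \<le> r \<Longrightarrow> r < s \<Longrightarrow> s \<le> hi \<Longrightarrow> distributed M lborel (\<lambda>\<omega>. W s \<omega> - W r \<omega>)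
      (\<lambda>x. ennreal (\<Prod>i\<in>UNIV. normal_density 0 (sqrt (s - r)) (x $ i)))"
    and sg: "sg = 1 \<or> sg = - 1"
begin

lemma measurable_vec_nth [measurable (raw)]:
  "f \<in> borel_measurable N \<Longrightarrow> (\<lambda>x. (f x :: real ^ 'k) $ i) \<in> borel_measurable N"
  by (simp add: cart_eq_inner_axis)

abbreviation "MT \<equiv> M \<Otimes>\<^sub>M (lborel :: real measure)"

definition incr :: "real \<Rightarrow> real \<Rightarrow> 'w \<Rightarrow> real ^ 'n" where
  "incr r s \<omega> = W s \<omega> - W r \<omega>"

definition bdd_rv :: "real \<Rightarrow> ('w \<Rightarrow> 'b::euclidean_space) \<Rightarrow> bool" where
  "bdd_rv r \<eta> \<longleftrightarrow> \<eta> \<in> borel_measurable (H r) \<and> bounded (\<eta> ` space M)"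

lemma H_mono: "lo \<le> r \<Longrightarrow> r \<le> s \<Longrightarrow> s \<le> hi \<Longrightarrow> f \<in> borel_measurable (H r) \<Longrightarrow> f \<in> borel_measurable (H s)"
  using sub[of r] sub[of s] mono[of r s]
  by (intro measurable_from_subalg[of "H s" "H r"]) (auto simp: subalgebra_def)

lemma H_measurable: "lo \<le> r \<Longrightarrow> r \<le> hi \<Longrightarrow> f \<in> borel_measurable (H r) \<Longrightarrow> f \<in> borel_measurable M"
  by (rule measurable_from_subalg[OF sub]) auto

lemma incr_H: "lo \<le> r \<Longrightarrow> r \<le> s \<Longrightarrow> s \<le> hi \<Longrightarrow> incr r s \<in> borel_measurable (H s)"
  using adapted by (simp add: incr_def[abs_def])

lemma bdd_rv_mono: "lo \<le> r \<Longrightarrow> r \<le> s \<Longrightarrow> s \<le> hi \<Longrightarrow> bdd_rv r f \<Longrightarrow> bdd_rv s f"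
  using H_mono by (auto simp: bdd_rv_def)

lemma bdd_rv_bound:
  assumes "bdd_rv r f" shows "\<exists>C\<ge>0. \<forall>\<omega>\<in>space M. norm (f \<omega>) \<le> C"
proof -
  obtain C where "0 < C" "\<forall>\<omega>\<in>space M. norm (f \<omega>) \<le> C"
    using assms by (auto simp: bdd_rv_def bounded_pos)
  then show ?thesis by (intro exI[of _ C]) auto
qed

lemma bdd_rv_measurable_H: "bdd_rv r f \<Longrightarrow> f \<in> borel_measurable (H r)"
  by (simp only: bdd_rv_def)

lemma bdd_rv_measurable: "lo \<le> r \<Longrightarrow> r \<le> hi \<Longrightarrow> bdd_rv r f \<Longrightarrow> f \<in> borel_measurable M"
  by (rule H_measurable[OF _ _ bdd_rv_measurable_H])

lemma incr_measurable: "lo \<le> r \<Longrightarrow> r \<le> s \<Longrightarrow> s \<le> hi \<Longrightarrow> incr r s \<in> borel_measurable M"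
  by (rule H_measurable[OF order_trans _ incr_H])

lemma bdd_rv_sq_int:
  assumes "lo \<le> r" "r \<le> hi" "bdd_rv r f" shows "sq_int M f"
proof -
  obtain C where "\<forall>\<omega>\<in>space M. norm (f \<omega>) \<le> C" using bdd_rv_bound[OF assms(3)] by auto
  then have C: "(norm (f \<omega>))\<^sup>2 \<le> C\<^sup>2" if "\<omega> \<in> space M" for \<omega>
    using that by (intro power_mono) auto
  have "f \<in> borel_measurable M"
    by (rule bdd_rv_measurable[OF assms])
  then show ?thesis
    by (rule sq_int_bound[where g="\<lambda>_. C\<^sup>2"]) (auto intro: C)
qed

lemma sq_int_integrable_prob: "sq_int M (f :: 'w \<Rightarrow> real) \<Longrightarrow> integrable M f"
  using sq_int_integrable_mult[of M f "\<lambda>_. 1"] by (simp add: sq_int_def)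

text \<open>Passes from independence of families of sets to independence of random variables. It is
  applied with \<open>g\<close> a component or a product of two components of the increment.\<close>

lemma indep_H:
  fixes X :: "'w \<Rightarrow> real" and g :: "real ^ 'n \<Rightarrow> real"
  assumes rs: "lo \<le> r" "r < s" "s \<le> hi" and X: "X \<in> borel_measurable (H r)" and g: "g \<in> borel_measurable borel"
  shows "indep_var borel X borel (\<lambda>\<omega>. g (incr r s \<omega>))"
proof -
  let ?B = "{incr r s -` A \<inter> space M | A. A \<in> sets borel}"
  have i: "indep_set (sets (H r)) ?B"
    using indep[OF rs] by (simp add: incr_def[abs_def])
  have sp: "space (H r) = space M" using sub[of r] rs by (auto simp: subalgebra_def)
  have r: "r \<le> hi" "r \<le> s" using rs by simp_all
  have Xm: "X \<in> borel_measurable M" by (rule H_measurable[OF rs(1) r(1) X])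
  have Im[measurable]: "incr r s \<in> borel_measurable M" by (rule incr_measurable[OF rs(1) r(2) rs(3)])
  have gm: "(\<lambda>\<omega>. g (incr r s \<omega>)) \<in> borel_measurable M" using g by measurable
  have 1: "sigma_sets (space M) {X -` A \<inter> space M | A. A \<in> sets borel} \<subseteq> sets (H r)"
  proof -
    have "{X -` A \<inter> space M | A. A \<in> sets borel} \<subseteq> sets (H r)"
      using measurable_sets[OF X] sp by auto
    then show ?thesis using sets.sigma_sets_subset[of _ "H r"] sp by auto
  qed
  have 2: "sigma_sets (space M) {(\<lambda>\<omega>. g (incr r s \<omega>)) -` A \<inter> space M | A. A \<in> sets borel} \<subseteq> ?B"
  proof -
    \<comment> \<open>The preimages under the increment already form a sigma-algebra, so passing to
      generated sigma-algebras does not leave \<open>?B\<close>.\<close>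
    let ?V = "vimage_algebra (space M) (incr r s) borel"
    have V: "sets ?V = ?B" by (rule sets_vimage_algebra2) auto
    have "(\<lambda>\<omega>. g (incr r s \<omega>)) -` A \<inter> space M \<in> ?B" if "A \<in> sets borel" for A
    proof -
      have "g -` A \<in> sets borel" using measurable_sets[OF g that] by simp
      then show ?thesis by (intro CollectI exI[of _ "g -` A"]) auto
    qed
    then have "{(\<lambda>\<omega>. g (incr r s \<omega>)) -` A \<inter> space M | A. A \<in> sets borel} \<subseteq> sets ?V" unfolding V by blast
    then have "sigma_sets (space M) {(\<lambda>\<omega>. g (incr r s \<omega>)) -` A \<inter> space M | A. A \<in> sets borel} \<subseteq> sets ?V"
      using sets.sigma_sets_subset[of _ ?V] by simp
    then show ?thesis unfolding V .
  qed
  have "indep_set (sigma_sets (space M) {X -` A \<inter> space M | A. A \<in> sets borel})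
     (sigma_sets (space M) {(\<lambda>\<omega>. g (incr r s \<omega>)) -` A \<inter> space M | A. A \<in> sets borel})"
    using i unfolding indep_set_def
    by (rule indep_sets_mono_sets) (use 1 2 in \<open>auto split: bool.split\<close>)
  then show ?thesis unfolding indep_var_eq using Xm gm by simp
qed

lemma incr_triv [simp]: "incr r r \<omega> = 0" by (simp add: incr_def)

lemma incr_add: "incr r s \<omega> = incr r q \<omega> + incr q s \<omega>" by (simp add: incr_def)

text \<open>Independence factors the expectation, and the increment is centred. The case
  \<open>r = s\<close> is treated apart because the Gaussian law is given for
  \<open>r < s\<close>.\<close>

lemma expect_mult_incr:
  assumes rs: "lo \<le> r" "r \<le> s" "s \<le> hi" and X: "X \<in> borel_measurable (H r)" "integrable M X"
  shows "integrable M (\<lambda>\<omega>. X \<omega> * incr r s \<omega> $ k)" "(\<integral>\<omega>. X \<omega> * incr r s \<omega> $ k \<partial>M) = 0"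
proof -
  have "integrable M (\<lambda>\<omega>. X \<omega> * incr r s \<omega> $ k) \<and> (\<integral>\<omega>. X \<omega> * incr r s \<omega> $ k \<partial>M) = 0"
  proof (cases "r = s")
    case False
    then have rs': "r < s" using rs by simp
    note g = gauss_vec_moment1[OF _ gauss[OF rs(1) rs' rs(3)], of k, folded incr_def]
    note i = indep_H[OF rs(1) rs' rs(3) X(1), of "\<lambda>x. x $ k"]
    show ?thesis using indep_var_lebesgue_integral[OF i X(2)] indep_var_integrable[OF i X(2)] g rs' by simp
  qed simp
  then show "integrable M (\<lambda>\<omega>. X \<omega> * incr r s \<omega> $ k)" "(\<integral>\<omega>. X \<omega> * incr r s \<omega> $ k \<partial>M) = 0" by auto
qed

lemma expect_mult_incr2:
  assumes rs: "lo \<le> r" "r \<le> s" "s \<le> hi" and X: "X \<in> borel_measurable (H r)" "integrable M X"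
  shows "integrable M (\<lambda>\<omega>. X \<omega> * (incr r s \<omega> $ k * incr r s \<omega> $ l))"
    "(\<integral>\<omega>. X \<omega> * (incr r s \<omega> $ k * incr r s \<omega> $ l) \<partial>M) = (if k = l then (s - r) * (\<integral>\<omega>. X \<omega> \<partial>M) else 0)"
proof -
  have "integrable M (\<lambda>\<omega>. X \<omega> * (incr r s \<omega> $ k * incr r s \<omega> $ l)) \<and>
    (\<integral>\<omega>. X \<omega> * (incr r s \<omega> $ k * incr r s \<omega> $ l) \<partial>M) = (if k = l then (s - r) * (\<integral>\<omega>. X \<omega> \<partial>M) else 0)"
  proof (cases "r = s")
    case False
    then have rs': "r < s" using rs by simp
    note g = gauss_vec_moment2[OF _ gauss[OF rs(1) rs' rs(3)], of k l, folded incr_def]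
    note i = indep_H[OF rs(1) rs' rs(3) X(1), of "\<lambda>x. x $ k * x $ l"]
    show ?thesis using indep_var_lebesgue_integral[OF i X(2)] indep_var_integrable[OF i X(2)] g rs' by simp
  qed simp
  then show "integrable M (\<lambda>\<omega>. X \<omega> * (incr r s \<omega> $ k * incr r s \<omega> $ l))"
    "(\<integral>\<omega>. X \<omega> * (incr r s \<omega> $ k * incr r s \<omega> $ l) \<partial>M) = (if k = l then (s - r) * (\<integral>\<omega>. X \<omega> \<partial>M) else 0)" by auto
qed

lemma incr_norm2:
  fixes r s :: real
  assumes "lo \<le> r" "r \<le> s" "s \<le> hi"
  shows "integrable M (\<lambda>\<omega>. (norm (incr r s \<omega>))\<^sup>2)" "(\<integral>\<omega>. (norm (incr r s \<omega>))\<^sup>2 \<partial>M) = CARD('n) * (s - r)"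
  using gauss_vec_norm2[OF _ gauss[OF assms(1) _ assms(3)], folded incr_def] assms
  by (cases "r = s"; simp)+

lemma incr_norm4:
  fixes r s :: real
  assumes "lo \<le> r" "r \<le> s" "s \<le> hi"
  shows "integrable M (\<lambda>\<omega>. (norm (incr r s \<omega>)) ^ 4)" "(\<integral>\<omega>. (norm (incr r s \<omega>)) ^ 4 \<partial>M) \<le> 3 * (CARD('n))\<^sup>2 * (s - r)\<^sup>2"
proof -
  have "sqrt (s - r) ^ 4 = (s - r)\<^sup>2" using assms power_mult[of "sqrt (s - r)" 2 2] by simp
  then show "integrable M (\<lambda>\<omega>. (norm (incr r s \<omega>)) ^ 4)" "(\<integral>\<omega>. (norm (incr r s \<omega>)) ^ 4 \<partial>M) \<le> 3 * (CARD('n))\<^sup>2 * (s - r)\<^sup>2"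
    using gauss_vec_norm4[OF _ gauss[OF assms(1) _ assms(3)], folded incr_def] assms
    by (cases "r = s"; simp)+
qed

lemma sq_int_bdd_incr:
  assumes rs: "lo \<le> r" "r \<le> s" "s \<le> hi" and \<eta>: "bdd_rv r \<eta>"
  shows "sq_int M (\<lambda>\<omega>. \<eta> \<omega> \<bullet> incr r s \<omega>)"
proof -
  obtain C where C: "C \<ge> 0" "\<And>\<omega>. \<omega> \<in> space M \<Longrightarrow> norm (\<eta> \<omega>) \<le> C" using bdd_rv_bound[OF \<eta>] by auto
  have [measurable]: "\<eta> \<in> borel_measurable M" "incr r s \<in> borel_measurable M"
    using bdd_rv_measurable[OF rs(1) order_trans[OF rs(2,3)] \<eta>] incr_measurable[OF rs] .
  show ?thesis
  proof (rule sq_int_bound)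
    show "integrable M (\<lambda>\<omega>. C\<^sup>2 * (norm (incr r s \<omega>))\<^sup>2)" using incr_norm2[OF rs] by simp
    show "AE \<omega> in M. (norm (\<eta> \<omega> \<bullet> incr r s \<omega>))\<^sup>2 \<le> C\<^sup>2 * (norm (incr r s \<omega>))\<^sup>2"
    proof (rule AE_I2)
      fix \<omega> assume "\<omega> \<in> space M"
      have "\<bar>\<eta> \<omega> \<bullet> incr r s \<omega>\<bar> \<le> norm (\<eta> \<omega>) * norm (incr r s \<omega>)" by (rule Cauchy_Schwarz_ineq2)
      also have "\<dots> \<le> C * norm (incr r s \<omega>)" using C(2)[OF \<open>\<omega> \<in> space M\<close>] by (intro mult_right_mono) auto
      finally have "\<bar>\<eta> \<omega> \<bullet> incr r s \<omega>\<bar>\<^sup>2 \<le> (C * norm (incr r s \<omega>))\<^sup>2" by (intro power_mono) auto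
      then show "(norm (\<eta> \<omega> \<bullet> incr r s \<omega>))\<^sup>2 \<le> C\<^sup>2 * (norm (incr r s \<omega>))\<^sup>2" by (simp add: power_mult_distrib)
    qed
  qed measurable
qed

lemma integrable_mult_bdd:
  fixes X \<phi> :: "'w \<Rightarrow> real"
  assumes "integrable M X" "\<phi> \<in> borel_measurable M" "\<And>\<omega>. \<omega> \<in> space M \<Longrightarrow> \<bar>\<phi> \<omega>\<bar> \<le> C"
  shows "integrable M (\<lambda>\<omega>. X \<omega> * \<phi> \<omega>)"
proof (rule Bochner_Integration.integrable_bound)
  show "integrable M (\<lambda>\<omega>. C * X \<omega>)" using assms by simp
  show "AE \<omega> in M. norm (X \<omega> * \<phi> \<omega>) \<le> norm (C * X \<omega>)"
  proof (rule AE_I2)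
    fix \<omega> assume "\<omega> \<in> space M"
    then have "\<bar>X \<omega>\<bar> * \<bar>\<phi> \<omega>\<bar> \<le> \<bar>X \<omega>\<bar> * \<bar>C\<bar>" using assms(3)[of \<omega>] by (intro mult_left_mono) auto
    then show "norm (X \<omega> * \<phi> \<omega>) \<le> norm (C * X \<omega>)" by (simp add: abs_mult mult.commute)
  qed
qed (use assms in auto)

lemma incr_orthogonal:
  assumes rs: "lo \<le> r" "r \<le> s" "s \<le> hi" and X: "X \<in> borel_measurable (H r)" "sq_int M X" and \<eta>: "bdd_rv r \<eta>"
  shows "(\<integral>\<omega>. X \<omega> * (\<eta> \<omega> \<bullet> incr r s \<omega>) \<partial>M) = 0"
proof -
  obtain C where C: "C \<ge> 0" "\<And>\<omega>. \<omega> \<in> space M \<Longrightarrow> norm (\<eta> \<omega>) \<le> C" using bdd_rv_bound[OF \<eta>] by auto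
  have \<eta>m: "\<eta> \<in> borel_measurable (H r)" using \<eta> by (simp add: bdd_rv_def)
  have i: "integrable M (\<lambda>\<omega>. X \<omega> * \<eta> \<omega> $ k)" for k
  proof (rule integrable_mult_bdd[OF sq_int_integrable_prob[OF X(2)], where C=C])
    have [measurable]: "\<eta> \<in> borel_measurable M"
      by (rule bdd_rv_measurable[OF rs(1) order_trans[OF rs(2,3)] \<eta>])
    show "(\<lambda>\<omega>. \<eta> \<omega> $ k) \<in> borel_measurable M" by measurable
    show "\<bar>\<eta> \<omega> $ k\<bar> \<le> C" if "\<omega> \<in> space M" for \<omega>
      using component_le_norm_cart[of "\<eta> \<omega>" k] C(2)[OF that] by linarith
  qed
  have m: "(\<lambda>\<omega>. X \<omega> * \<eta> \<omega> $ k) \<in> borel_measurable (H r)" for k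
    using X \<eta>m by measurable
  have "X \<omega> * (\<eta> \<omega> \<bullet> incr r s \<omega>) = (\<Sum>k\<in>UNIV. (X \<omega> * \<eta> \<omega> $ k) * incr r s \<omega> $ k)" for \<omega>
    by (simp add: inner_vec_def sum_distrib_left mult.assoc)
  then show ?thesis
    using expect_mult_incr[OF rs m i] by simp
qed

lemma incr_isometry:
  assumes rs: "lo \<le> r" "r \<le> s" "s \<le> hi" and \<eta>: "bdd_rv r \<eta>" "bdd_rv r \<eta>'"
  shows "(\<integral>\<omega>. (\<eta> \<omega> \<bullet> incr r s \<omega>) * (\<eta>' \<omega> \<bullet> incr r s \<omega>) \<partial>M) = (s - r) * (\<integral>\<omega>. \<eta> \<omega> \<bullet> \<eta>' \<omega> \<partial>M)"
proof -
  have m[measurable]: "\<eta> \<in> borel_measurable (H r)" "\<eta>' \<in> borel_measurable (H r)" using \<eta> by (auto simp: bdd_rv_def)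
  have c: "sq_int M (\<lambda>\<omega>. f \<omega> $ k)" if "bdd_rv r f" for f :: "'w \<Rightarrow> real ^ 'n" and k
  proof (rule sq_int_bound[where g="\<lambda>\<omega>. (norm (f \<omega>))\<^sup>2"])
    have "sq_int M f" using bdd_rv_sq_int[OF rs(1) _ that] rs by auto
    then show "integrable M (\<lambda>\<omega>. (norm (f \<omega>))\<^sup>2)" by (simp add: sq_int_def)
    from \<open>sq_int M f\<close> have [measurable]: "f \<in> borel_measurable M" by (simp add: sq_int_def)
    show "(\<lambda>\<omega>. f \<omega> $ k) \<in> borel_measurable M" by measurable
  qed (auto simp: component_le_norm_cart abs_le_square_iff[symmetric])
  have i: "integrable M (\<lambda>\<omega>. \<eta> \<omega> $ k * \<eta>' \<omega> $ l)" for k l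
    by (intro sq_int_integrable_mult c \<eta>)
  have mm: "(\<lambda>\<omega>. \<eta> \<omega> $ k * \<eta>' \<omega> $ l) \<in> borel_measurable (H r)" for k l by measurable
  note e = expect_mult_incr2[OF rs mm i]
  have "(\<eta> \<omega> \<bullet> incr r s \<omega>) * (\<eta>' \<omega> \<bullet> incr r s \<omega>)
     = (\<Sum>k\<in>UNIV. \<Sum>l\<in>UNIV. (\<eta> \<omega> $ k * \<eta>' \<omega> $ l) * (incr r s \<omega> $ k * incr r s \<omega> $ l))" for \<omega>
    by (simp add: inner_vec_def sum_product algebra_simps)
  then have "(\<integral>\<omega>. (\<eta> \<omega> \<bullet> incr r s \<omega>) * (\<eta>' \<omega> \<bullet> incr r s \<omega>) \<partial>M)
     = (\<Sum>k\<in>UNIV. \<Sum>l\<in>UNIV. (if k = l then (s - r) * (\<integral>\<omega>. \<eta> \<omega> $ k * \<eta>' \<omega> $ l \<partial>M) else 0))"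
    using e by simp
  also have "\<dots> = (s - r) * (\<Sum>k\<in>UNIV. \<integral>\<omega>. \<eta> \<omega> $ k * \<eta>' \<omega> $ k \<partial>M)"
    by (simp add: sum_distrib_left)
  also have "(\<Sum>k\<in>UNIV. \<integral>\<omega>. \<eta> \<omega> $ k * \<eta>' \<omega> $ k \<partial>M) = (\<integral>\<omega>. \<eta> \<omega> \<bullet> \<eta>' \<omega> \<partial>M)"
    using i by (simp add: inner_vec_def)
  finally show ?thesis .
qed

text \<open>Cut the longer window at the end of the shorter one: the common part gives the isometry,
  and the surplus is orthogonal to everything known at its left end.\<close>

lemma incr_isometry_start:
  assumes "lo \<le> r" "r \<le> s" "r \<le> s'" "s \<le> hi" "s' \<le> hi" and "bdd_rv r \<eta>" "bdd_rv r \<eta>'"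
  shows "(\<integral>\<omega>. (\<eta> \<omega> \<bullet> incr r s \<omega>) * (\<eta>' \<omega> \<bullet> incr r s' \<omega>) \<partial>M) = (min s s' - r) * (\<integral>\<omega>. \<eta> \<omega> \<bullet> \<eta>' \<omega> \<partial>M)"
proof -
  have *: "(\<integral>\<omega>. (\<eta> \<omega> \<bullet> incr r s \<omega>) * (\<eta>' \<omega> \<bullet> incr r s' \<omega>) \<partial>M) = (s - r) * (\<integral>\<omega>. \<eta> \<omega> \<bullet> \<eta>' \<omega> \<partial>M)"
    if rs: "lo \<le> r" "r \<le> s" "s \<le> s'" "s' \<le> hi" and \<eta>: "bdd_rv r \<eta>" "bdd_rv r \<eta>'" for s s' \<eta> \<eta>'
  proof -
    let ?X = "\<lambda>\<omega>. \<eta> \<omega> \<bullet> incr r s \<omega>"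
    have shi: "s \<le> hi" using rs by linarith
    have b: "bdd_rv s \<eta>'" "bdd_rv s \<eta>" using bdd_rv_mono[of r s] rs \<eta> by auto
    have "\<eta> \<in> borel_measurable (H s)" using b by (simp add: bdd_rv_def)
    moreover have "incr r s \<in> borel_measurable (H s)" by (rule incr_H[OF rs(1,2) shi])
    ultimately have X: "?X \<in> borel_measurable (H s)" by measurable
    have X2: "sq_int M ?X" by (rule sq_int_bdd_incr[OF rs(1,2) shi \<eta>(1)])
    note X = X X2
    have "(\<integral>\<omega>. ?X \<omega> * (\<eta>' \<omega> \<bullet> incr r s' \<omega>) \<partial>M) 
       = (\<integral>\<omega>. ?X \<omega> * (\<eta>' \<omega> \<bullet> incr r s \<omega>) + ?X \<omega> * (\<eta>' \<omega> \<bullet> incr s s' \<omega>) \<partial>M)"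
      by (subst incr_add[of r s' _ s]) (simp add: inner_add_right distrib_left)
    also have "\<dots> = (\<integral>\<omega>. ?X \<omega> * (\<eta>' \<omega> \<bullet> incr r s \<omega>) \<partial>M) + (\<integral>\<omega>. ?X \<omega> * (\<eta>' \<omega> \<bullet> incr s s' \<omega>) \<partial>M)"
      using rs \<eta> b X by (intro Bochner_Integration.integral_add sq_int_integrable_mult sq_int_bdd_incr) auto
    also have "\<dots> = (s - r) * (\<integral>\<omega>. \<eta> \<omega> \<bullet> \<eta>' \<omega> \<partial>M)"
      using incr_orthogonal[of s s' ?X \<eta>'] incr_isometry[of r s \<eta> \<eta>'] rs \<eta> b X by simp
    finally show ?thesis .
  qed
  show ?thesis
  proof (cases "s \<le> s'")
    case True
    then show ?thesis using *[of s s' \<eta> \<eta>'] assms by simp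
  next
    case False
    then show ?thesis using *[of s' s \<eta>' \<eta>] assms by (simp add: mult.commute inner_commute)
  qed
qed

lemma incr_bilinear:
  assumes "lo \<le> r" "r \<le> s" "s \<le> hi" "bdd_rv r \<eta>" "lo \<le> r'" "r' \<le> s'" "s' \<le> hi" "bdd_rv r' \<eta>'"
  shows "(\<integral>\<omega>. (\<eta> \<omega> \<bullet> incr r s \<omega>) * (\<eta>' \<omega> \<bullet> incr r' s' \<omega>) \<partial>M)
    = max 0 (min s s' - max r r') * (\<integral>\<omega>. \<eta> \<omega> \<bullet> \<eta>' \<omega> \<partial>M)"
proof -
  have *: "(\<integral>\<omega>. (\<eta> \<omega> \<bullet> incr r s \<omega>) * (\<eta>' \<omega> \<bullet> incr r' s' \<omega>) \<partial>M) = max 0 (min s s' - r') * (\<integral>\<omega>. \<eta> \<omega> \<bullet> \<eta>' \<omega> \<partial>M)"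
    if rs: "lo \<le> r" "r \<le> r'" "r \<le> s" "s \<le> hi" "r' \<le> s'" "s' \<le> hi" and \<eta>: "bdd_rv r \<eta>" "bdd_rv r' \<eta>'" for r s r' s' \<eta> \<eta>'
  proof -
    \<comment> \<open>The part of the first window before \<open>r'\<close> is known at
      \<open>r'\<close>, hence orthogonal to the second increment. If the windows are disjoint,
      \<open>q = s\<close> and nothing else remains.\<close>
    define q where "q = min s r'"
    have q: "r \<le> q" "q \<le> r'" "q \<le> s" using rs by (auto simp: q_def)
    have b: "bdd_rv r' \<eta>" "bdd_rv q \<eta>" using bdd_rv_mono[of r r' \<eta>] bdd_rv_mono[of r q \<eta>] rs \<eta> q by auto
    let ?X = "\<lambda>\<omega>. \<eta> \<omega> \<bullet> incr r q \<omega>"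
    have r'hi: "r' \<le> hi" "q \<le> hi" "lo \<le> q" using rs q by linarith+
    have "\<eta> \<in> borel_measurable (H r')" using b by (simp add: bdd_rv_def)
    moreover have "incr r q \<in> borel_measurable (H r')"
      by (rule H_mono[OF r'hi(3) q(2) r'hi(1) incr_H[OF rs(1) q(1) r'hi(2)]])
    ultimately have X: "?X \<in> borel_measurable (H r')" by measurable
    have X2: "sq_int M ?X" by (rule sq_int_bdd_incr[OF rs(1) q(1) r'hi(2) \<eta>(1)])
    note X = X X2
    have s': "sq_int M (\<lambda>\<omega>. \<eta>' \<omega> \<bullet> incr r' s' \<omega>)"  using sq_int_bdd_incr[of r' s' \<eta>'] rs \<eta> by auto
    have "(\<integral>\<omega>. (\<eta> \<omega> \<bullet> incr r s \<omega>) * (\<eta>' \<omega> \<bullet> incr r' s' \<omega>) \<partial>M) 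
       = (\<integral>\<omega>. ?X \<omega> * (\<eta>' \<omega> \<bullet> incr r' s' \<omega>) + (\<eta> \<omega> \<bullet> incr q s \<omega>) * (\<eta>' \<omega> \<bullet> incr r' s' \<omega>) \<partial>M)"
      by (subst incr_add[of r s _ q]) (simp add: inner_add_right distrib_right)
    also have "\<dots> = (\<integral>\<omega>. ?X \<omega> * (\<eta>' \<omega> \<bullet> incr r' s' \<omega>) \<partial>M) + (\<integral>\<omega>. (\<eta> \<omega> \<bullet> incr q s \<omega>) * (\<eta>' \<omega> \<bullet> incr r' s' \<omega>) \<partial>M)"
      using rs \<eta> b X q s' by (intro Bochner_Integration.integral_add sq_int_integrable_mult sq_int_bdd_incr) auto
    also have "(\<integral>\<omega>. ?X \<omega> * (\<eta>' \<omega> \<bullet> incr r' s' \<omega>) \<partial>M) = 0"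
      using incr_orthogonal[of r' s' ?X \<eta>'] rs \<eta> X by simp
    also have "(\<integral>\<omega>. (\<eta> \<omega> \<bullet> incr q s \<omega>) * (\<eta>' \<omega> \<bullet> incr r' s' \<omega>) \<partial>M) = max 0 (min s s' - r') * (\<integral>\<omega>. \<eta> \<omega> \<bullet> \<eta>' \<omega> \<partial>M)"
    proof (cases "s \<le> r'")
      case True
      then show ?thesis by (simp add: q_def max_def)
    next
      case False
      then show ?thesis using incr_isometry_start[of r' s s' \<eta> \<eta>'] rs \<eta> b by (simp add: q_def)
    qed
    finally show ?thesis by simp
  qed
  show ?thesis
  proof (cases "r \<le> r'")
    case True
    then have m: "max r r' = r'" by simp
    show ?thesis using *[of r r' s s' \<eta> \<eta>'] assms True unfolding m by blast
  next
    case False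
    then have m: "max r r' = r" "r' \<le> r" by simp_all
    have "(\<integral>\<omega>. (\<eta>' \<omega> \<bullet> incr r' s' \<omega>) * (\<eta> \<omega> \<bullet> incr r s \<omega>) \<partial>M) = max 0 (min s' s - r) * (\<integral>\<omega>. \<eta>' \<omega> \<bullet> \<eta> \<omega> \<partial>M)"
      using *[of r' r s' s \<eta>' \<eta>] assms m(2) by blast
    then show ?thesis unfolding m(1)
      by (simp only: mult.commute[of "\<eta>' _ \<bullet> _"] inner_commute[of "\<eta>' _" "\<eta> _"] min.commute[of s' s])
  qed
qed

end

section \<open>The Ito integral as an isometry\<close>

lemma l2_tendsto_diff:
  fixes f g :: "'a \<Rightarrow> 'b::euclidean_space"
  assumes f: "l2_tendsto N F f" and g: "l2_tendsto N G g"
  shows "l2_tendsto N (\<lambda>k x. F k x - G k x) (\<lambda>x. f x - g x)"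
  using l2_tendsto_add[OF f l2_tendsto_scaleR_bounded[OF g, of "\<lambda>_. -1" 1]] by simp

context bm_filtration
begin

sublocale MT: pair_sigma_finite M "lborel :: real measure" ..

lemma integrable_time_product:
  fixes f :: "'w \<Rightarrow> real" and h :: "real \<Rightarrow> real"
  assumes f: "integrable M f" and h: "integrable lborel h"
  shows "integrable MT (\<lambda>p. h (snd p) * f (fst p))"
    "(\<integral>p. h (snd p) * f (fst p) \<partial>MT) = (\<integral>t. h t \<partial>lborel) * (\<integral>\<omega>. f \<omega> \<partial>M)"
proof -
  have [measurable]: "f \<in> borel_measurable M" "h \<in> borel_measurable borel" using f h by auto
  have m: "(\<lambda>p. h (snd p) * f (fst p)) \<in> borel_measurable MT" by measurable
  show i: "integrable MT (\<lambda>p. h (snd p) * f (fst p))"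
    by (rule MT.Fubini_integrable) (use f h m in \<open>auto simp: abs_mult\<close>)
  have "(\<integral>p. h (snd p) * f (fst p) \<partial>MT) = (\<integral>\<omega>. (\<integral>t. h t * f \<omega> \<partial>lborel) \<partial>M)"
    using MT.integral_fst'[OF i] by simp
  also have "\<dots> = (\<integral>t. h t \<partial>lborel) * (\<integral>\<omega>. f \<omega> \<partial>M)" using h by simp
  finally show "(\<integral>p. h (snd p) * f (fst p) \<partial>MT) = (\<integral>t. h t \<partial>lborel) * (\<integral>\<omega>. f \<omega> \<partial>M)" .
qed

text \<open>For \<open>sg = - 1\<close> this is the indicator of \<open>{- s..<- r}\<close> in the
  original time, the half-open convention of the backward integral.\<close>

abbreviation win :: "real \<Rightarrow> real \<Rightarrow> 'w \<times> real \<Rightarrow> real" where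
  "win r s p \<equiv> indicator {r<..s} (sg * snd p)"

lemma time_window:
  "integrable lborel (\<lambda>t. indicator {r<..s} (sg * t) :: real)"
  "(\<integral>t. indicator {r<..s} (sg * t) \<partial>lborel) = max 0 (s - r)"
proof -
  define A where "A = (if sg = 1 then {r<..s} else {-s..<-r})"
  have eq: "(\<lambda>t. indicator {r<..s} (sg * t) :: real) = indicator A"
    using sg by (auto simp: A_def fun_eq_iff indicator_def)
  have e: "emeasure lborel A = ennreal (max 0 (s - r))" "A \<in> sets lborel"
    by (auto simp: A_def max_def emeasure_lborel_Ioc emeasure_lborel_Ico)
  then show "integrable lborel (\<lambda>t. indicator {r<..s} (sg * t) :: real)" 
    unfolding eq by (intro integrable_real_indicator) auto
  show "(\<integral>t. indicator {r<..s} (sg * t) \<partial>lborel) = max 0 (s - r)"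
    unfolding eq using e by (simp add: measure_def max_def ennreal_neg)
qed

lemma win_measurable [measurable]: "(\<lambda>p. win r s p) \<in> borel_measurable MT"
proof -
  have [measurable]: "(\<lambda>t. indicator {r<..s} (sg * t) :: real) \<in> borel_measurable borel"
    using time_window(1)[of r s] by auto
  show ?thesis by measurable
qed

text \<open>Simple integrands paired with their integrals, generated from single windows by addition
  rather than from partitions. Sums are then immediate, windows may overlap, and proofs go by
  induction.\<close>

inductive elem :: "real \<Rightarrow> real \<Rightarrow> ('w \<times> real \<Rightarrow> real ^ 'n) \<Rightarrow> ('w \<Rightarrow> real) \<Rightarrow> bool" for a b where
  elem_base: "a \<le> r \<Longrightarrow> r \<le> s \<Longrightarrow> s \<le> b \<Longrightarrow> bdd_rv r \<eta> \<Longrightarrow>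
     elem a b (\<lambda>p. win r s p *\<^sub>R \<eta> (fst p)) (\<lambda>\<omega>. \<eta> \<omega> \<bullet> incr r s \<omega>)"
| elem_add: "elem a b P X \<Longrightarrow> elem a b P' X' \<Longrightarrow> elem a b (\<lambda>p. P p + P' p) (\<lambda>\<omega>. X \<omega> + X' \<omega>)"

text \<open>The integrand is a function on the product space, so that the isometry becomes an
  equality of inner products in two spaces of square-integrable functions. A relation is used
  because \<open>X\<close> is determined only up to null sets.\<close>

definition ito :: "real \<Rightarrow> real \<Rightarrow> ('w \<times> real \<Rightarrow> real ^ 'n) \<Rightarrow> ('w \<Rightarrow> real) \<Rightarrow> bool" where
  "ito a b P X \<longleftrightarrow> (\<exists>Q Y. (\<forall>k. elem a b (Q k) (Y k)) \<and> l2_tendsto MT Q P \<and> l2_tendsto M Y X)"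

lemma elem_sq_int:
  assumes "elem a b P X" "lo \<le> a" "b \<le> hi"
  shows "sq_int MT P" "sq_int M X"
proof -
  have "sq_int MT P \<and> sq_int M X" using assms
  proof induction
    case (elem_base r s \<eta>)
    then have rs: "lo \<le> r" "r \<le> s" "s \<le> hi" "r \<le> hi" by linarith+
    have s: "sq_int M \<eta>" by (rule bdd_rv_sq_int[OF rs(1,4) elem_base(4)])
    have m[measurable]: "\<eta> \<in> borel_measurable M" using s by (rule sq_int_measurable)
    have i: "integrable MT (\<lambda>p. win r s p * (norm (\<eta> (fst p)))\<^sup>2)"
      by (rule integrable_time_product(1)[OF sq_int_integrable[OF s] time_window(1)])
    have "sq_int MT (\<lambda>p. win r s p *\<^sub>R \<eta> (fst p))"
      by (rule sq_int_bound[OF _ i]) (auto simp: indicator_def)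
    then show ?case using sq_int_bdd_incr[OF rs(1,2,3) elem_base(4)] by simp
  next
    case (elem_add P X P' X')
    then show ?case by (auto intro: sq_int_add)
  qed
  then show "sq_int MT P" "sq_int M X" by auto
qed

text \<open>A double induction reduces to two single windows, where \<open>incr_bilinear\<close>
  applies; the overlap length is the time integral of the product of the two indicators.\<close>

lemma elem_isometry:
  assumes "elem a b P X" "elem a' b' P' X'" and ab: "lo \<le> a" "b \<le> hi" "lo \<le> a'" "b' \<le> hi"
  shows "(\<integral>\<omega>. X \<omega> * X' \<omega> \<partial>M) = (\<integral>p. P p \<bullet> P' p \<partial>MT)"
  using assms(1)
proof induction
  case (elem_base r s \<eta>)
  then have rs: "lo \<le> r" "r \<le> s" "s \<le> hi" "r \<le> hi" using ab by linarith+
  note 1 = elem_sq_int[OF elem.elem_base[OF elem_base] ab(1,2)]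
  show ?case using assms(2)
  proof induction
    case (elem_base r' s' \<eta>')
    then have rs': "lo \<le> r'" "r' \<le> s'" "s' \<le> hi" "r' \<le> hi" using ab by linarith+
    have i: "integrable M (\<lambda>\<omega>. \<eta> \<omega> \<bullet> \<eta>' \<omega>)"
      by (intro sq_int_integrable_inner bdd_rv_sq_int[OF rs(1,4)] bdd_rv_sq_int[OF rs'(1,4)] elem_base(4) \<open>bdd_rv r \<eta>\<close>)
    have "(\<integral>\<omega>. (\<eta> \<omega> \<bullet> incr r s \<omega>) * (\<eta>' \<omega> \<bullet> incr r' s' \<omega>) \<partial>M)
        = max 0 (min s s' - max r r') * (\<integral>\<omega>. \<eta> \<omega> \<bullet> \<eta>' \<omega> \<partial>M)"
      by (rule incr_bilinear[OF rs(1-3) \<open>bdd_rv r \<eta>\<close> rs'(1-3) elem_base(4)])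
    also have "\<dots> = (\<integral>p. win (max r r') (min s s') p * (\<eta> (fst p) \<bullet> \<eta>' (fst p)) \<partial>MT)"
      using integrable_time_product(2)[OF i time_window(1)[of "max r r'" "min s s'"]] time_window(2)[of "max r r'" "min s s'"] by simp
    also have "\<dots> = (\<integral>p. (win r s p *\<^sub>R \<eta> (fst p)) \<bullet> (win r' s' p *\<^sub>R \<eta>' (fst p)) \<partial>MT)"
      by (intro Bochner_Integration.integral_cong refl) (auto simp: indicator_def)
    finally show ?case .
  next
    case (elem_add P X P' X')
    note 2 = elem_sq_int[OF elem_add(1) ab(3,4)]
    note 3 = elem_sq_int[OF elem_add(2) ab(3,4)]
    show ?case using elem_add.IH 1 2 3
      by (simp add: distrib_left inner_add_right sq_int_integrable_mult sq_int_integrable_inner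
          del: inner_scaleR_left inner_scaleR_right inner_real_def)
  qed
next
  case (elem_add P X P'' X'')
  note 1 = elem_sq_int[OF assms(2) ab(3,4)]
  note 2 = elem_sq_int[OF elem_add(1) ab(1,2)]
  note 3 = elem_sq_int[OF elem_add(2) ab(1,2)]
  show ?case using elem_add.IH 1 2 3
    by (simp add: distrib_right inner_add_left sq_int_integrable_mult sq_int_integrable_inner)
qed

lemma bdd_rv_zero: "bdd_rv r (\<lambda>_. 0)"
  by (auto simp: bdd_rv_def image_constant_conv)

lemma bdd_rv_scaleR:
  fixes \<phi> :: "'w \<Rightarrow> real" and \<eta> :: "'w \<Rightarrow> 'b::euclidean_space"
  assumes "bdd_rv r \<phi>" "bdd_rv r \<eta>"
  shows "bdd_rv r (\<lambda>\<omega>. \<phi> \<omega> *\<^sub>R \<eta> \<omega>)"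
proof -
  obtain C where C: "C \<ge> 0" "\<forall>\<omega>\<in>space M. norm (\<phi> \<omega>) \<le> C" using bdd_rv_bound[OF assms(1)] by auto
  obtain D where D: "D \<ge> 0" "\<forall>\<omega>\<in>space M. norm (\<eta> \<omega>) \<le> D" using bdd_rv_bound[OF assms(2)] by auto
  have "norm (\<phi> \<omega> *\<^sub>R \<eta> \<omega>) \<le> C * D" if "\<omega> \<in> space M" for \<omega>
    using C D that by (auto intro!: mult_mono)
  then have "bounded ((\<lambda>\<omega>. \<phi> \<omega> *\<^sub>R \<eta> \<omega>) ` space M)" by (auto simp: bounded_iff)
  moreover have "(\<lambda>\<omega>. \<phi> \<omega> *\<^sub>R \<eta> \<omega>) \<in> borel_measurable (H r)"
    using bdd_rv_measurable_H[OF assms(1)] bdd_rv_measurable_H[OF assms(2)] by measurable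
  ultimately show ?thesis by (simp only: bdd_rv_def)
qed

lemma bdd_rv_add:
  fixes \<phi> \<eta> :: "'w \<Rightarrow> 'b::euclidean_space"
  assumes "bdd_rv r \<phi>" "bdd_rv r \<eta>"
  shows "bdd_rv r (\<lambda>\<omega>. \<phi> \<omega> + \<eta> \<omega>)"
proof -
  have "bounded ((\<lambda>\<omega>. \<phi> \<omega> + \<eta> \<omega>) ` space M)"
    using assms by (auto simp: bdd_rv_def intro: bounded_plus_comp)
  moreover have "(\<lambda>\<omega>. \<phi> \<omega> + \<eta> \<omega>) \<in> borel_measurable (H r)"
    using bdd_rv_measurable_H[OF assms(1)] bdd_rv_measurable_H[OF assms(2)] by measurable
  ultimately show ?thesis by (simp only: bdd_rv_def)
qed

lemma elem_zero: "a \<le> b \<Longrightarrow> elem a b (\<lambda>_. 0) (\<lambda>_. 0)"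
  using elem_base[of a a a b "\<lambda>_. 0", OF _ _ _ bdd_rv_zero] by simp

text \<open>Every window starts at or after \<open>a\<close>, so a factor known at \<open>a\<close>
  can be absorbed into each coefficient.\<close>

lemma elem_scaleR:
  assumes "elem a b P X" "lo \<le> a" "b \<le> hi" "bdd_rv a \<phi>"
  shows "elem a b (\<lambda>p. \<phi> (fst p) *\<^sub>R P p) (\<lambda>\<omega>. \<phi> \<omega> * X \<omega>)"
  using assms(1)
proof induction
  case (elem_base r s \<eta>)
  then have "r \<le> hi" using assms by linarith
  then have "bdd_rv r \<phi>" using bdd_rv_mono[OF assms(2) elem_base(1) _ assms(4)] by blast
  from elem.elem_base[OF elem_base(1-3) bdd_rv_scaleR[OF this elem_base(4)]]
  show ?case by (simp add: mult.commute)
next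
  case (elem_add P X P' X')
  from elem.elem_add[OF elem_add.IH] show ?case by (simp add: scaleR_add_right distrib_left)
qed

lemma elem_orthogonal:
  assumes "elem a b P X" "lo \<le> a" "b \<le> hi" "\<phi> \<in> borel_measurable (H a)" "sq_int M \<phi>"
  shows "(\<integral>\<omega>. \<phi> \<omega> * X \<omega> \<partial>M) = 0"
  using assms(1)
proof induction
  case (elem_base r s \<eta>)
  then have rs: "lo \<le> r" "r \<le> s" "s \<le> hi" "r \<le> hi" using assms by linarith+
  show ?case
    by (rule incr_orthogonal[OF rs(1-3) H_mono[OF assms(2) elem_base(1) rs(4) assms(4)] assms(5) elem_base(4)])
next
  case (elem_add P X P' X')
  show ?case using elem_add.IH assms(5) elem_sq_int[OF elem_add(1) assms(2,3)] elem_sq_int[OF elem_add(2) assms(2,3)]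
    by (simp add: distrib_left sq_int_integrable_mult)
qed

lemma elem_mono: "elem a b P X \<Longrightarrow> a' \<le> a \<Longrightarrow> b \<le> b' \<Longrightarrow> elem a' b' P X"
  by (induction rule: elem.induct) (auto intro: elem.intros)

text \<open>A window across \<open>c\<close> is cut in two, its coefficient remaining admissible
  since it is also known at \<open>c\<close>. The integral \<open>E\<close> of the first part is
  existentially quantified because it depends on the representation of the integrand.\<close>

lemma elem_split:
  assumes "elem a b P X" "a \<le> c" "c \<le> b" "lo \<le> a" "b \<le> hi"
  shows "\<exists>E. elem a c (\<lambda>p. indicator {..c} (sg * snd p) *\<^sub>R P p) E \<and>
    elem c b (\<lambda>p. P p - indicator {..c} (sg * snd p) *\<^sub>R P p) (\<lambda>\<omega>. X \<omega> - E \<omega>)"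
  using assms(1)
proof induction
  case (elem_base r s \<eta>)
  consider "s \<le> c" | "c \<le> r" | "r < c" "c < s" by linarith
  then show ?case
  proof cases
    case 1
    have e: "indicator {..c} (sg * snd p) *\<^sub>R win r s p *\<^sub>R \<eta> (fst p) = win r s p *\<^sub>R \<eta> (fst p)" for p
      using 1 by (auto simp: indicator_def)
    show ?thesis
      by (rule exI[of _ "\<lambda>\<omega>. \<eta> \<omega> \<bullet> incr r s \<omega>"], unfold e diff_self)
        (intro conjI elem.elem_base[OF elem_base(1,2) 1 elem_base(4)] elem_zero[OF assms(3)])
  next
    case 2
    have e: "indicator {..c} (sg * snd p) *\<^sub>R win r s p *\<^sub>R \<eta> (fst p) = 0" for p
      using 2 by (auto simp: indicator_def)
    show ?thesis
      by (rule exI[of _ "\<lambda>\<omega>. 0"], unfold e diff_0_right)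
        (intro conjI elem.elem_base[OF 2 elem_base(2,3,4)] elem_zero[OF assms(2)])
  next
    case 3
    have e1: "indicator {..c} (sg * snd p) *\<^sub>R win r s p *\<^sub>R \<eta> (fst p) = win r c p *\<^sub>R \<eta> (fst p)" for p
      using 3 by (auto simp: indicator_def)
    have e2: "win r s p *\<^sub>R \<eta> (fst p) - win r c p *\<^sub>R \<eta> (fst p) = win c s p *\<^sub>R \<eta> (fst p)" for p
      using 3 by (auto simp: indicator_def)
    have e3: "\<eta> \<omega> \<bullet> incr r s \<omega> - \<eta> \<omega> \<bullet> incr r c \<omega> = \<eta> \<omega> \<bullet> incr c s \<omega>" for \<omega>
      by (auto simp: incr_def inner_diff_right)
    have r: "r \<le> c" "c \<le> s" "c \<le> hi" "lo \<le> r" using 3 elem_base assms by linarith+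
    show ?thesis
      by (rule exI[of _ "\<lambda>\<omega>. \<eta> \<omega> \<bullet> incr r c \<omega>"], unfold e1 e2 e3)
        (intro conjI elem.elem_base[OF elem_base(1) r(1) order_refl elem_base(4)]
          elem.elem_base[OF order_refl r(2) elem_base(3) bdd_rv_mono[OF r(4,1,3) elem_base(4)]])
  qed
next
  case (elem_add P X P' X')
  then obtain E E' where E:
    "elem a c (\<lambda>p. indicator {..c} (sg * snd p) *\<^sub>R P p) E"
    "elem c b (\<lambda>p. P p - indicator {..c} (sg * snd p) *\<^sub>R P p) (\<lambda>\<omega>. X \<omega> - E \<omega>)"
    "elem a c (\<lambda>p. indicator {..c} (sg * snd p) *\<^sub>R P' p) E'"
    "elem c b (\<lambda>p. P' p - indicator {..c} (sg * snd p) *\<^sub>R P' p) (\<lambda>\<omega>. X' \<omega> - E' \<omega>)" by blast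
  show ?case
    using elem.elem_add[OF E(1,3)] elem.elem_add[OF E(2,4)]
    by (intro exI[of _ "\<lambda>\<omega>. E \<omega> + E' \<omega>"]) (simp add: scaleR_add_right add_diff_add)
qed

text \<open>On an interval free of the break points in \<open>Q\<close> the integrand is a single
  random variable, known at the left end and bounded by a \<open>K\<close> that does not depend on
  the interval. This uniformity lets one approximant serve all fine partitions. Open intervals avoid
  any convention at the ends.\<close>

definition locally_const :: "real set \<Rightarrow> real \<Rightarrow> ('w \<times> real \<Rightarrow> real ^ 'n) \<Rightarrow> bool" where
  "locally_const Q K P \<longleftrightarrow> (\<forall>p q. lo \<le> p \<longrightarrow> p < q \<longrightarrow> q \<le> hi \<longrightarrow> {p<..<q} \<inter> Q = {} \<longrightarrow>
     (\<exists>\<eta>. bdd_rv p \<eta> \<and> (\<forall>\<omega>\<in>space M. norm (\<eta> \<omega>) \<le> K) \<and>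
       (\<forall>x. fst x \<in> space M \<longrightarrow> sg * snd x \<in> {p<..<q} \<longrightarrow> P x = \<eta> (fst x))))"

lemma elem_locally_const:
  assumes "elem a b P X" "lo \<le> a" "b \<le> hi"
  shows "\<exists>Q K. finite Q \<and> 0 \<le> K \<and> locally_const Q K P"
  using assms(1)
proof induction
  case (elem_base r s \<eta>)
  obtain K where K: "K \<ge> 0" "\<forall>\<omega>\<in>space M. norm (\<eta> \<omega>) \<le> K" using bdd_rv_bound[OF elem_base(4)] by auto
  have "locally_const {r, s} K (\<lambda>p. win r s p *\<^sub>R \<eta> (fst p))"
    unfolding locally_const_def
  proof (intro allI impI)
    fix p q assume pq: "lo \<le> p" "p < q" "q \<le> hi" "{p<..<q} \<inter> {r, s} = {}"
    then have rs: "r \<le> p \<or> q \<le> r" "s \<le> p \<or> q \<le> s" by auto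
    show "\<exists>\<eta>'. bdd_rv p \<eta>' \<and> (\<forall>\<omega>\<in>space M. norm (\<eta>' \<omega>) \<le> K) \<and>
       (\<forall>x. fst x \<in> space M \<longrightarrow> sg * snd x \<in> {p<..<q} \<longrightarrow> win r s x *\<^sub>R \<eta> (fst x) = \<eta>' (fst x))"
    proof (cases "r \<le> p \<and> q \<le> s")
      case True
      have r: "lo \<le> r" "r \<le> p" "p \<le> hi" using True pq elem_base(1) assms(2) by linarith+
      show ?thesis
        by (rule exI[of _ \<eta>]) (use True K(2) bdd_rv_mono[OF r elem_base(4)] in \<open>auto simp: indicator_def\<close>)
    next
      case False
      then have "s \<le> p \<or> q \<le> r" using rs elem_base(2) by linarith
      then show ?thesis
        by (intro exI[of _ "\<lambda>_. 0"]) (use K(1) bdd_rv_zero in \<open>auto simp: indicator_def\<close>)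
    qed
  qed
  then show ?case using K(1) by (intro exI[of _ "{r, s}"] exI[of _ K]) simp
next
  case (elem_add P X P' X')
  from elem_add.IH obtain Q K Q' K' where QK: "finite Q" "0 \<le> K" "locally_const Q K P"
    "finite Q'" "0 \<le> K'" "locally_const Q' K' P'" by blast
  have "locally_const (Q \<union> Q') (K + K') (\<lambda>p. P p + P' p)"
    unfolding locally_const_def
  proof (intro allI impI)
    fix p q assume pq: "lo \<le> p" "p < q" "q \<le> hi" "{p<..<q} \<inter> (Q \<union> Q') = {}"
    then have e: "{p<..<q} \<inter> Q = {}" "{p<..<q} \<inter> Q' = {}" by auto
    obtain \<eta> where \<eta>: "bdd_rv p \<eta>" "\<forall>\<omega>\<in>space M. norm (\<eta> \<omega>) \<le> K"
       "\<And>x. fst x \<in> space M \<Longrightarrow> sg * snd x \<in> {p<..<q} \<Longrightarrow> P x = \<eta> (fst x)"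
      using QK(3) pq(1-3) e(1) unfolding locally_const_def by blast
    obtain \<eta>' where \<eta>': "bdd_rv p \<eta>'" "\<forall>\<omega>\<in>space M. norm (\<eta>' \<omega>) \<le> K'"
       "\<And>x. fst x \<in> space M \<Longrightarrow> sg * snd x \<in> {p<..<q} \<Longrightarrow> P' x = \<eta>' (fst x)"
      using QK(6) pq(1-3) e(2) unfolding locally_const_def by blast
    show "\<exists>\<eta>. bdd_rv p \<eta> \<and> (\<forall>\<omega>\<in>space M. norm (\<eta> \<omega>) \<le> K + K') \<and>
       (\<forall>x. fst x \<in> space M \<longrightarrow> sg * snd x \<in> {p<..<q} \<longrightarrow> P x + P' x = \<eta> (fst x))"
      by (rule exI[of _ "\<lambda>\<omega>. \<eta> \<omega> + \<eta>' \<omega>"])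
        (use \<eta> \<eta>' bdd_rv_add[OF \<eta>(1) \<eta>'(1)] in \<open>auto intro: norm_triangle_mono\<close>)
  qed
  then show ?case using QK by (intro exI[of _ "Q \<union> Q'"] exI[of _ "K + K'"]) auto
qed

context
  fixes a b :: real
  assumes ab: "lo \<le> a" "b \<le> hi"
begin

lemma elem_ito: "elem a b P X \<Longrightarrow> ito a b P X"
  unfolding ito_def
  by (rule exI[of _ "\<lambda>_. P"], rule exI[of _ "\<lambda>_. X"]) (simp add: l2_tendsto_const elem_sq_int ab)

lemma ito_sq_int:
  assumes "ito a b P X" shows "sq_int MT P" "sq_int M X"
  using assms by (auto simp: ito_def l2_tendsto_def)

lemma ito_isometry:
  assumes "ito a b P X" "ito a' b' P' X'" "lo \<le> a'" "b' \<le> hi"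
  shows "(\<integral>\<omega>. X \<omega> * X' \<omega> \<partial>M) = (\<integral>p. P p \<bullet> P' p \<partial>MT)"
proof -
  obtain Q Y where Q: "\<And>k. elem a b (Q k) (Y k)" "l2_tendsto MT Q P" "l2_tendsto M Y X"
    using assms(1) by (auto simp: ito_def)
  obtain Q' Y' where Q': "\<And>k. elem a' b' (Q' k) (Y' k)" "l2_tendsto MT Q' P'" "l2_tendsto M Y' X'"
    using assms(2) by (auto simp: ito_def)
  have "(\<lambda>k. \<integral>\<omega>. Y k \<omega> * Y' k \<omega> \<partial>M) \<longlonglongrightarrow> (\<integral>\<omega>. X \<omega> * X' \<omega> \<partial>M)"
    using l2_tendsto_inner[OF Q(3) Q'(3)] by simp
  moreover have "(\<lambda>k. \<integral>\<omega>. Y k \<omega> * Y' k \<omega> \<partial>M) \<longlonglongrightarrow> (\<integral>p. P p \<bullet> P' p \<partial>MT)"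
    using l2_tendsto_inner[OF Q(2) Q'(2)] elem_isometry[OF Q(1) Q'(1) ab assms(3,4)] by simp
  ultimately show ?thesis by (rule LIMSEQ_unique)
qed

lemma ito_norm:
  assumes "ito a b P X"
  shows "(\<integral>\<omega>. (X \<omega>)\<^sup>2 \<partial>M) = (\<integral>p. (norm (P p))\<^sup>2 \<partial>MT)"
  using ito_isometry[OF assms assms ab] by (simp add: power2_eq_square flip: power2_norm_eq_inner)

text \<open>The martingale property in the form used for the first order Taylor terms. Square
  integrability of the factor is the right condition there, as \<open>psi'\<close> grows linearly
  and \<open>psi'\<close> of \<open>y\<close> is unbounded in general.\<close>

lemma ito_orthogonal:
  assumes "ito a b P X" "\<phi> \<in> borel_measurable (H a)" "sq_int M \<phi>"
  shows "(\<integral>\<omega>. \<phi> \<omega> * X \<omega> \<partial>M) = 0"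
proof -
  obtain Q Y where Q: "\<And>k. elem a b (Q k) (Y k)" "l2_tendsto M Y X"
    using assms(1) by (auto simp: ito_def)
  have "(\<lambda>k. \<integral>\<omega>. \<phi> \<omega> * Y k \<omega> \<partial>M) \<longlonglongrightarrow> (\<integral>\<omega>. \<phi> \<omega> * X \<omega> \<partial>M)"
    using l2_tendsto_inner[OF l2_tendsto_const[OF assms(3)] Q(2)] by simp
  then have "(\<lambda>k :: nat. 0) \<longlonglongrightarrow> (\<integral>\<omega>. \<phi> \<omega> * X \<omega> \<partial>M)"
    by (simp only: elem_orthogonal[OF Q(1) ab assms(2,3)])
  then show ?thesis by (simp only: LIMSEQ_const_iff)
qed

lemma ito_scaleR:
  assumes "ito a b P X" "bdd_rv a \<phi>" "a \<le> b"
  shows "ito a b (\<lambda>p. \<phi> (fst p) *\<^sub>R P p) (\<lambda>\<omega>. \<phi> \<omega> * X \<omega>)"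
proof -
  obtain Q Y where Q: "\<And>k. elem a b (Q k) (Y k)" "l2_tendsto MT Q P" "l2_tendsto M Y X"
    using assms(1) by (auto simp: ito_def)
  obtain C where C: "C \<ge> 0" "\<forall>\<omega>\<in>space M. norm (\<phi> \<omega>) \<le> C" using bdd_rv_bound[OF assms(2)] by auto
  have [measurable]: "\<phi> \<in> borel_measurable M" 
    by (rule bdd_rv_measurable[OF ab(1) order_trans[OF assms(3) ab(2)] assms(2)])
  have 1: "l2_tendsto MT (\<lambda>k p. \<phi> (fst p) *\<^sub>R Q k p) (\<lambda>p. \<phi> (fst p) *\<^sub>R P p)"
    by (rule l2_tendsto_scaleR_bounded[OF Q(2), where C=C]) (use C in \<open>auto simp: space_pair_measure\<close>)
  have 2: "l2_tendsto M (\<lambda>k \<omega>. \<phi> \<omega> *\<^sub>R Y k \<omega>) (\<lambda>\<omega>. \<phi> \<omega> *\<^sub>R X \<omega>)"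
    by (rule l2_tendsto_scaleR_bounded[OF Q(3), where C=C]) (use C in auto)
  show ?thesis unfolding ito_def
    by (rule exI[of _ "\<lambda>k p. \<phi> (fst p) *\<^sub>R Q k p"], rule exI[of _ "\<lambda>k \<omega>. \<phi> \<omega> *\<^sub>R Y k \<omega>"])
      (use 1 2 elem_scaleR[OF Q(1) ab assms(2)] in simp)
qed

lemma ito_add:
  assumes "ito a b P X" "ito a b P' X'"
  shows "ito a b (\<lambda>p. P p + P' p) (\<lambda>\<omega>. X \<omega> + X' \<omega>)"
proof -
  obtain Q Y where Q: "\<And>k. elem a b (Q k) (Y k)" "l2_tendsto MT Q P" "l2_tendsto M Y X"
    using assms(1) by (auto simp: ito_def)
  obtain Q' Y' where Q': "\<And>k. elem a b (Q' k) (Y' k)" "l2_tendsto MT Q' P'" "l2_tendsto M Y' X'"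
    using assms(2) by (auto simp: ito_def)
  show ?thesis unfolding ito_def
    by (rule exI[of _ "\<lambda>k p. Q k p + Q' k p"], rule exI[of _ "\<lambda>k \<omega>. Y k \<omega> + Y' k \<omega>"])
      (use elem_add[OF Q(1) Q'(1)] l2_tendsto_add[OF Q(2) Q'(2)] l2_tendsto_add[OF Q(3) Q'(3)] in blast)
qed

lemma ito_diff:
  assumes "a \<le> b" "ito a b P X" "ito a b P' X'"
  shows "ito a b (\<lambda>p. P p - P' p) (\<lambda>\<omega>. X \<omega> - X' \<omega>)"
proof -
  have "bdd_rv a (\<lambda>_. -1 :: real)" by (auto simp: bdd_rv_def image_constant_conv)
  from ito_add[OF assms(2) ito_scaleR[OF assms(3) this assms(1)]] show ?thesis by simp
qed

text \<open>A member of the approximating sequence far enough out is elementary, hence locally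
  constant. Only the integrand is approximated here; its integral follows by the isometry.\<close>

lemma ito_locally_const:
  assumes "ito a b P X" "0 < \<epsilon>"
  shows "\<exists>Q K L. finite Q \<and> 0 \<le> K \<and> locally_const Q K L \<and> sq_int MT L \<and> (\<integral>p. (norm (P p - L p))\<^sup>2 \<partial>MT) < \<epsilon>"
proof -
  obtain Q Y where Q: "\<And>k. elem a b (Q k) (Y k)" "l2_tendsto MT Q P"
    using assms(1) by (auto simp: ito_def)
  have "(\<lambda>k. \<integral>p. (norm (P p - Q k p))\<^sup>2 \<partial>MT) \<longlonglongrightarrow> 0" using Q(2) by (simp add: l2_tendsto_def)
  then obtain k where "(\<integral>p. (norm (P p - Q k p))\<^sup>2 \<partial>MT) < \<epsilon>"
    using order_tendstoD(2)[OF _ assms(2)] eventually_happens'[OF sequentially_bot] by blast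
  with elem_locally_const[OF Q(1)[of k] ab] elem_sq_int(1)[OF Q(1)[of k] ab] show ?thesis
    by (elim exE, intro exI[of _ "Q k"] exI conjI) auto
qed

end

lemma ito_mono: "ito a b P X \<Longrightarrow> a' \<le> a \<Longrightarrow> b \<le> b' \<Longrightarrow> ito a' b' P X"
  unfolding ito_def using elem_mono by blast

text \<open>Here \<open>X'\<close> is an arbitrary version of the integral over
  \<open>[a, c]\<close>, not one built from the approximants of \<open>X\<close>. Cutting these
  approximants at \<open>c\<close> gives elementary integrals \<open>E k\<close> that converge to
  \<open>X'\<close>, and what is left of them lives on \<open>[c, b]\<close>.\<close>

lemma ito_split:
  assumes "lo \<le> a" "a \<le> c" "c \<le> b" "b \<le> hi" "ito a b P X" "ito a c P' X'"
    and ae: "AE p in MT. P' p = indicator {..c} (sg * snd p) *\<^sub>R P p"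
  shows "ito c b (\<lambda>p. P p - P' p) (\<lambda>\<omega>. X \<omega> - X' \<omega>)"
proof -
  obtain Q Y where Q: "\<And>k. elem a b (Q k) (Y k)" "l2_tendsto MT Q P" "l2_tendsto M Y X"
    using assms(5) by (auto simp: ito_def)
  let ?i = "\<lambda>p :: 'w \<times> real. indicator {..c} (sg * snd p) :: real"
  have "\<exists>E. \<forall>k. elem a c (\<lambda>p. ?i p *\<^sub>R Q k p) (E k) \<and> elem c b (\<lambda>p. Q k p - ?i p *\<^sub>R Q k p) (\<lambda>\<omega>. Y k \<omega> - E k \<omega>)"
    by (rule choice) (use elem_split[OF Q(1) assms(2,3,1,4)] in blast)
  then obtain E where E: "\<And>k. elem a c (\<lambda>p. ?i p *\<^sub>R Q k p) (E k)"
    "\<And>k. elem c b (\<lambda>p. Q k p - ?i p *\<^sub>R Q k p) (\<lambda>\<omega>. Y k \<omega> - E k \<omega>)" by blast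
  have chi: "c \<le> hi" "a \<le> b" using assms by linarith+
  have "{..c} \<in> sets borel" by simp
  then have im[measurable]: "?i \<in> borel_measurable MT" by measurable
  have P': "P' \<in> borel_measurable MT" using ito_sq_int(1)[OF assms(1) chi(1) assms(6)] by (rule sq_int_measurable)
  have 1: "l2_tendsto MT (\<lambda>k p. ?i p *\<^sub>R Q k p) P'"
    by (rule l2_tendsto_cong_AE[OF l2_tendsto_scaleR_bounded[OF Q(2) im, of 1] P'])
      (use ae in \<open>auto simp: indicator_def\<close>)
  have X': "sq_int M X'" by (rule ito_sq_int(2)[OF assms(1) chi(1) assms(6)])
  \<comment> \<open>The isometry converts convergence of the cut integrands, which is obvious, into
    convergence of the integrals \<open>E k\<close>.\<close>
  have "(\<integral>\<omega>. (X' \<omega> - E k \<omega>)\<^sup>2 \<partial>M) = (\<integral>p. (norm (P' p - ?i p *\<^sub>R Q k p))\<^sup>2 \<partial>MT)" for k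
    by (rule ito_norm[OF assms(1) chi(1)], rule ito_diff[OF assms(1) chi(1) assms(2) assms(6)],
        rule elem_ito[OF assms(1) chi(1) E(1)])
  then have 2: "l2_tendsto M E X'"
    using 1 X' elem_sq_int(2)[OF E(1) assms(1) chi(1)] by (simp add: l2_tendsto_def)
  show ?thesis unfolding ito_def
    by (rule exI[of _ "\<lambda>k p. Q k p - ?i p *\<^sub>R Q k p"], rule exI[of _ "\<lambda>k \<omega>. Y k \<omega> - E k \<omega>"])
      (intro conjI allI E(2) l2_tendsto_diff[OF Q(2) 1] l2_tendsto_diff[OF Q(3) 2])
qed

end

section \<open>Brownian increments and the two filtrations\<close>

lemma space_incr_sigma [simp]: "space (incr_sigma M \<phi> s t) = space M"
  by (simp add: incr_sigma_def space_measure_of_conv)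

lemma space_join_sigma [simp]: "space (join_sigma M F G) = space M"
  by (simp add: join_sigma_def space_measure_of_conv)

lemma incr_gen_subset:
  "{(\<lambda>\<omega>. \<phi> r \<omega> - \<phi> s \<omega>) -` A \<inter> space M | r A. r \<in> {s..t} \<and> A \<in> sets borel} \<union> null_sets M \<subseteq> Pow (space M)"
  using sets.sets_into_space by (auto dest: null_setsD2)

lemma sets_incr_sigma:
  "sets (incr_sigma M \<phi> s t) = sigma_sets (space M)
     ({(\<lambda>\<omega>. \<phi> r \<omega> - \<phi> s \<omega>) -` A \<inter> space M | r A. r \<in> {s..t} \<and> A \<in> sets borel} \<union> null_sets M)"
  unfolding incr_sigma_def by (rule sets_measure_of[OF incr_gen_subset])

lemma sets_join_sigma:
  assumes "sets F \<subseteq> Pow (space M)" "sets G \<subseteq> Pow (space M)"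
  shows "sets (join_sigma M F G) = sigma_sets (space M) (sets F \<union> sets G)"
  unfolding join_sigma_def by (rule sets_measure_of) (use assms in auto)

lemma incr_sigma_Pow: "sets (incr_sigma M \<phi> s t) \<subseteq> Pow (space M)"
  using sets.sets_into_space[of _ "incr_sigma M \<phi> s t"] by auto

lemma join_sigma_least:
  assumes "sets (incr_sigma M \<phi> s t) \<subseteq> C" "sets (incr_sigma M \<psi> s' t') \<subseteq> C" "sigma_algebra (space M) C"
  shows "sets (join_sigma M (incr_sigma M \<phi> s t) (incr_sigma M \<psi> s' t')) \<subseteq> C"
  unfolding sets_join_sigma[OF incr_sigma_Pow incr_sigma_Pow]
  by (rule sigma_algebra.sigma_sets_subset[OF assms(3)]) (use assms in auto)

lemma join_sigma_upper:
  "sets (incr_sigma M \<phi> s t) \<subseteq> sets (join_sigma M (incr_sigma M \<phi> s t) (incr_sigma M \<psi> s' t'))"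
  "sets (incr_sigma M \<psi> s' t') \<subseteq> sets (join_sigma M (incr_sigma M \<phi> s t) (incr_sigma M \<psi> s' t'))"
  unfolding sets_join_sigma[OF incr_sigma_Pow incr_sigma_Pow] by auto

lemma join_sigma_mono:
  assumes "sets (incr_sigma M \<phi> s t) \<subseteq> sets (incr_sigma M \<phi> u v)" 
    "sets (incr_sigma M \<psi> s' t') \<subseteq> sets (incr_sigma M \<psi> u' v')"
  shows "sets (join_sigma M (incr_sigma M \<phi> s t) (incr_sigma M \<psi> s' t'))
    \<subseteq> sets (join_sigma M (incr_sigma M \<phi> u v) (incr_sigma M \<psi> u' v'))"
proof (rule join_sigma_least)
  show "sigma_algebra (space M) (sets (join_sigma M (incr_sigma M \<phi> u v) (incr_sigma M \<psi> u' v')))"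
    using sets.sigma_algebra_axioms[of "join_sigma M (incr_sigma M \<phi> u v) (incr_sigma M \<psi> u' v')"] by simp
  show "sets (incr_sigma M \<phi> s t) \<subseteq> sets (join_sigma M (incr_sigma M \<phi> u v) (incr_sigma M \<psi> u' v'))"
    by (rule order_trans[OF assms(1) join_sigma_upper(1)])
  show "sets (incr_sigma M \<psi> s' t') \<subseteq> sets (join_sigma M (incr_sigma M \<phi> u v) (incr_sigma M \<psi> u' v'))"
    by (rule order_trans[OF assms(2) join_sigma_upper(2)])
qed

lemma incr_sigma_measurable:
  fixes \<phi> :: "real \<Rightarrow> 'w \<Rightarrow> 'a::euclidean_space"
  assumes "r \<in> {s..t}"
  shows "(\<lambda>\<omega>. \<phi> r \<omega> - \<phi> s \<omega>) \<in> borel_measurable (incr_sigma M \<phi> s t)"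
proof (rule measurableI)
  fix A assume "A \<in> sets (borel :: 'a measure)"
  then show "(\<lambda>\<omega>. \<phi> r \<omega> - \<phi> s \<omega>) -` A \<inter> space (incr_sigma M \<phi> s t) \<in> sets (incr_sigma M \<phi> s t)"
    unfolding sets_incr_sigma using assms by (intro sigma_sets.Basic) auto
qed simp

text \<open>The generators on the two sides have different base points; an increment from
  \<open>u\<close> is a difference of two increments from \<open>u'\<close>.\<close>

lemma incr_sigma_mono:
  fixes \<phi> :: "real \<Rightarrow> 'w \<Rightarrow> 'a::euclidean_space"
  assumes "u' \<le> u" "v \<le> v'"
  shows "sets (incr_sigma M \<phi> u v) \<subseteq> sets (incr_sigma M \<phi> u' v')"
proof -
  let ?S = "incr_sigma M \<phi> u' v'"
  have "(\<lambda>\<omega>. \<phi> r \<omega> - \<phi> u \<omega>) -` A \<inter> space M \<in> sets ?S" if "r \<in> {u..v}" "A \<in> sets borel" for r A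
  proof -
    have "(\<lambda>\<omega>. (\<phi> r \<omega> - \<phi> u' \<omega>) - (\<phi> u \<omega> - \<phi> u' \<omega>)) \<in> borel_measurable ?S"
      by (intro borel_measurable_diff incr_sigma_measurable) (use that assms in auto)
    then have "(\<lambda>\<omega>. \<phi> r \<omega> - \<phi> u \<omega>) \<in> borel_measurable ?S" by simp
    from measurable_sets[OF this that(2)] show ?thesis by simp
  qed
  moreover have "null_sets M \<subseteq> sets ?S" unfolding sets_incr_sigma by auto
  ultimately have "{(\<lambda>\<omega>. \<phi> r \<omega> - \<phi> u \<omega>) -` A \<inter> space M | r A. r \<in> {u..v} \<and> A \<in> sets borel} \<union> null_sets M \<subseteq> sets ?S"
    by blast
  from sets.sigma_sets_subset[OF this] show ?thesis by (simp add: sets_incr_sigma)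
qed

lemma incr_sigma_subset_M:
  fixes \<phi> :: "real \<Rightarrow> 'w \<Rightarrow> 'a::euclidean_space"
  assumes "\<And>r. r \<in> {u..v} \<Longrightarrow> \<phi> r \<in> borel_measurable M"
  shows "sets (incr_sigma M \<phi> u v) \<subseteq> sets M"
proof -
  have "(\<lambda>\<omega>. \<phi> r \<omega> - \<phi> u \<omega>) -` A \<inter> space M \<in> sets M" if "r \<in> {u..v}" "A \<in> sets borel" for r A
    by (rule measurable_sets[OF borel_measurable_diff that(2)]) (use that assms in auto)
  then have "{(\<lambda>\<omega>. \<phi> r \<omega> - \<phi> u \<omega>) -` A \<inter> space M | r A. r \<in> {u..v} \<and> A \<in> sets borel} \<union> null_sets M \<subseteq> sets M"
    by auto
  from sets.sigma_sets_subset[OF this] show ?thesis by (simp add: sets_incr_sigma)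
qed

section \<open>Independence of an increment from the past and from the other process\<close>

context prob_space
begin

text \<open>Brownian motion is defined through consecutive increments along one partition. All times
  involved are sorted into a single list, each increment telescopes over a block of its steps, and
  variables built from disjoint blocks are independent. The two alternatives in \<open>disj\<close>
  serve the forward and the backward filtration.\<close>

lemma bm_increments_indep:
  fixes P :: "real \<Rightarrow> 'a \<Rightarrow> real ^ 'n"
  assumes bm: "brownian_motion M S P" and K: "finite K" "K \<subseteq> {u..v}" and A: "\<And>q. q \<in> K \<Longrightarrow> A q \<in> sets borel"
    and uv: "0 \<le> u" "u \<le> v" "v \<le> S" and rs: "0 \<le> r" "r \<le> s" "s \<le> S" and disj: "s \<le> u \<or> v \<le> r"
    and D: "D \<in> sets borel"
  shows "prob ({\<omega>\<in>space M. \<forall>q\<in>K. P q \<omega> - P u \<omega> \<in> A q} \<inter> ((\<lambda>\<omega>. P s \<omega> - P r \<omega>) -` D \<inter> space M))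
    = prob {\<omega>\<in>space M. \<forall>q\<in>K. P q \<omega> - P u \<omega> \<in> A q} * prob ((\<lambda>\<omega>. P s \<omega> - P r \<omega>) -` D \<inter> space M)"
proof -
  define E where "E = K \<union> {u, r, s}"
  define L where "L = sorted_list_of_set E"
  define n where "n = length L - 1"
  have E: "finite E" "E \<subseteq> {0..S}" using K uv rs by (auto simp: E_def)
  have L: "set L = E" "sorted_wrt (<) L" using E(1) by (auto simp: L_def)
  have ln: "length L = Suc n" using L(1) by (cases L) (auto simp: n_def E_def)
  have lt: "L ! i < L ! j" if "i < j" "j \<le> n" for i j
    using sorted_wrt_nth_less[OF L(2), of i j] that ln by simp
  then have le: "L ! i \<le> L ! j" if "i \<le> j" "j \<le> n" for i j
    using that by (cases "i = j") (auto simp: less_imp_le)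
  define X where "X = (\<lambda>i \<omega>. P (L ! Suc i) \<omega> - P (L ! i) \<omega>)"
  have "mono_on {..n} (\<lambda>i. L ! i)" "(\<lambda>i. L ! i) ` {..n} \<subseteq> {0..S}"
    using le E(2) L(1) ln by (auto simp: mono_on_def)
  then have ind: "indep_vars (\<lambda>_. borel) X {..<n}"
    using bm unfolding brownian_motion_def X_def by blast
  define idx where "idx q = (SOME i. i \<le> n \<and> L ! i = q)" for q
  have idx: "idx q \<le> n" "L ! idx q = q" if "q \<in> E" for q
  proof -
    have "\<exists>i. i \<le> n \<and> L ! i = q" using that L(1) ln by (metis in_set_conv_nth less_Suc_eq_le)
    from someI_ex[OF this] show "idx q \<le> n" "L ! idx q = q" by (auto simp: idx_def)
  qed
  have idx_le: "idx p \<le> idx q" if "p \<in> E" "q \<in> E" "p \<le> q" for p q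
  proof (rule ccontr)
    assume "\<not> idx p \<le> idx q"
    then have "L ! idx q < L ! idx p" using lt idx(1)[OF that(1)] by simp
    then show False using idx that by simp
  qed
  have tele: "P q \<omega> - P p \<omega> = (\<Sum>k\<in>{idx p..<idx q}. X k \<omega>)" if "p \<in> E" "q \<in> E" "p \<le> q" for p q \<omega>
    using sum_Suc_diff'[OF idx_le[OF that], of "\<lambda>i. P (L ! i) \<omega>"] idx that by (simp add: X_def)
  define I1 where "I1 = {i. i < n \<and> u \<le> L ! i \<and> L ! Suc i \<le> v}"
  define I2 where "I2 = {i. i < n \<and> r \<le> L ! i \<and> L ! Suc i \<le> s}"
  \<comment> \<open>Adjacent windows may share a time but no step: the list is strictly increasing,
    so there are no steps of length zero.\<close>
  have I: "I1 \<inter> I2 = {}" "I1 \<subseteq> {..<n}" "I2 \<subseteq> {..<n}"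
  proof -
    have "False" if "i \<in> I1" "i \<in> I2" for i
    proof -
      have "L ! i < L ! Suc i" using that lt[of i "Suc i"] by (auto simp: I1_def)
      then show False using that disj by (auto simp: I1_def I2_def)
    qed
    then show "I1 \<inter> I2 = {}" by auto
  qed (auto simp: I1_def I2_def)
  have sub1: "{idx u..<idx q} \<subseteq> I1" if "q \<in> K" for q
  proof
    fix i assume i: "i \<in> {idx u..<idx q}"
    have q: "q \<in> E" "u \<in> E" "q \<le> v" using that K by (auto simp: E_def)
    have "idx u \<le> i" "i \<le> n" "Suc i \<le> idx q" using i idx(1)[OF q(1)] by auto
    then have "L ! idx u \<le> L ! i" "L ! Suc i \<le> L ! idx q" using le idx(1)[OF q(1)] by blast+
    then show "i \<in> I1" using i idx[OF q(1)] idx[OF q(2)] q(3) by (auto simp: I1_def)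
  qed
  have sub2: "{idx r..<idx s} \<subseteq> I2"
  proof
    fix i assume i: "i \<in> {idx r..<idx s}"
    have q: "r \<in> E" "s \<in> E" by (auto simp: E_def)
    have "idx r \<le> i" "i \<le> n" "Suc i \<le> idx s" using i idx(1)[OF q(2)] by auto
    then have "L ! idx r \<le> L ! i" "L ! Suc i \<le> L ! idx s" using le idx(1)[OF q(2)] by blast+
    then show "i \<in> I2" using i idx[OF q(1)] idx[OF q(2)] by (auto simp: I2_def)
  qed
  let ?R1 = "\<lambda>\<omega>. \<lambda>i\<in>I1. X i \<omega>" and ?R2 = "\<lambda>\<omega>. \<lambda>i\<in>I2. X i \<omega>"
  let ?P1 = "PiM I1 (\<lambda>_. borel :: (real ^ 'n) measure)" and ?P2 = "PiM I2 (\<lambda>_. borel :: (real ^ 'n) measure)"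
  have iv: "indep_var ?P1 ?R1 ?P2 ?R2"
    by (rule indep_var_restrict[OF ind I])
  define S1 where "S1 = {x\<in>space ?P1. \<forall>q\<in>K. (\<Sum>k\<in>{idx u..<idx q}. x k) \<in> A q}"
  define S2 where "S2 = {x\<in>space ?P2. (\<Sum>k\<in>{idx r..<idx s}. x k) \<in> D}"
  have m1: "(\<lambda>x. \<Sum>k\<in>{idx u..<idx q}. x k) \<in> borel_measurable ?P1" if "q \<in> K" for q
    by (intro borel_measurable_sum measurable_component_singleton) (use sub1[OF that] in auto)
  have m2: "(\<lambda>x. \<Sum>k\<in>{idx r..<idx s}. x k) \<in> borel_measurable ?P2"
    by (intro borel_measurable_sum measurable_component_singleton) (use sub2 in auto)
  have S1: "S1 \<in> sets ?P1"
    unfolding S1_def by (rule sets.sets_Collect_finite_All[OF _ K(1)])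
      (use measurable_sets[OF m1 A] in \<open>simp add: vimage_def Int_def conj_commute\<close>)
  have S2: "S2 \<in> sets ?P2"
    unfolding S2_def using measurable_sets[OF m2 D] by (simp add: vimage_def Int_def conj_commute)
  have e1: "?R1 -` S1 \<inter> space M = {\<omega>\<in>space M. \<forall>q\<in>K. P q \<omega> - P u \<omega> \<in> A q}"
  proof -
    have "(\<Sum>k\<in>{idx u..<idx q}. ?R1 \<omega> k) = P q \<omega> - P u \<omega>" if "q \<in> K" for q \<omega>
    proof -
      have "q \<in> E" "u \<in> E" "u \<le> q" using that K by (auto simp: E_def)
      then show ?thesis using tele[of u q \<omega>] sub1[OF that] by (simp add: subset_eq)
    qed
    then show ?thesis by (auto simp: S1_def space_PiM)
  qed
  have e2: "?R2 -` S2 \<inter> space M = (\<lambda>\<omega>. P s \<omega> - P r \<omega>) -` D \<inter> space M"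
  proof -
    have "(\<Sum>k\<in>{idx r..<idx s}. ?R2 \<omega> k) = P s \<omega> - P r \<omega>" for \<omega>
    proof -
      have "r \<in> E" "s \<in> E" by (auto simp: E_def)
      then show ?thesis using tele[of r s \<omega>] sub2 rs by (simp add: subset_eq)
    qed
    then show ?thesis by (auto simp: S2_def space_PiM)
  qed
  have "(\<lambda>\<omega>. (?R1 \<omega>, ?R2 \<omega>)) -` (S1 \<times> S2) \<inter> space M = (?R1 -` S1 \<inter> space M) \<inter> (?R2 -` S2 \<inter> space M)" by auto
  with indep_varD[OF iv S1 S2] show ?thesis by (simp only: e1 e2)
qed

text \<open>Used to adjoin null sets: events that agree almost everywhere with a member of
  \<open>C\<close> have the same probabilities, so independence extends to them at no cost.\<close>

lemma sigma_algebra_AE_equal: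
  assumes "sigma_algebra (space M) C" "C \<subseteq> sets M"
  shows "sigma_algebra (space M) {E \<in> sets M. \<exists>E0\<in>C. AE \<omega> in M. \<omega> \<in> E \<longleftrightarrow> \<omega> \<in> E0}"
proof -
  interpret C: sigma_algebra "space M" C by fact
  show ?thesis unfolding sigma_algebra_iff2
  proof (intro conjI ballI allI impI)
    show "{E \<in> sets M. \<exists>E0\<in>C. AE \<omega> in M. \<omega> \<in> E \<longleftrightarrow> \<omega> \<in> E0} \<subseteq> Pow (space M)" using sets.sets_into_space by auto
    show "{} \<in> {E \<in> sets M. \<exists>E0\<in>C. AE \<omega> in M. \<omega> \<in> E \<longleftrightarrow> \<omega> \<in> E0}" by (auto intro!: bexI[of _ "{}"])
  next
    fix E assume "E \<in> {E \<in> sets M. \<exists>E0\<in>C. AE \<omega> in M. \<omega> \<in> E \<longleftrightarrow> \<omega> \<in> E0}"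
    then obtain E0 where E: "E \<in> sets M" "E0 \<in> C" "AE \<omega> in M. \<omega> \<in> E \<longleftrightarrow> \<omega> \<in> E0" by auto
    then show "space M - E \<in> {E \<in> sets M. \<exists>E0\<in>C. AE \<omega> in M. \<omega> \<in> E \<longleftrightarrow> \<omega> \<in> E0}"
      by (auto intro!: bexI[of _ "space M - E0"])
  next
    fix F :: "nat \<Rightarrow> _" assume "range F \<subseteq> {E \<in> sets M. \<exists>E0\<in>C. AE \<omega> in M. \<omega> \<in> E \<longleftrightarrow> \<omega> \<in> E0}"
    then have F: "F i \<in> sets M" "\<exists>E0\<in>C. AE \<omega> in M. \<omega> \<in> F i \<longleftrightarrow> \<omega> \<in> E0" for i by auto
    then have "\<exists>G. \<forall>i. G i \<in> C \<and> (AE \<omega> in M. \<omega> \<in> F i \<longleftrightarrow> \<omega> \<in> G i)" by (intro choice) blast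
    then obtain G where G: "\<And>i. G i \<in> C" "\<And>i. AE \<omega> in M. \<omega> \<in> F i \<longleftrightarrow> \<omega> \<in> G i" by blast
    have "AE \<omega> in M. \<forall>i. \<omega> \<in> F i \<longleftrightarrow> \<omega> \<in> G i" using G(2) by (simp add: AE_all_countable)
    then have "AE \<omega> in M. \<omega> \<in> (\<Union>i. F i) \<longleftrightarrow> \<omega> \<in> (\<Union>i. G i)" by eventually_elim auto
    moreover have "(\<Union>i. G i) \<in> C" using G(1) by auto
    ultimately show "(\<Union>i. F i) \<in> {E \<in> sets M. \<exists>E0\<in>C. AE \<omega> in M. \<omega> \<in> E \<longleftrightarrow> \<omega> \<in> E0}" using F(1) by (auto intro!: bexI[of _ "\<Union>i. G i"])
  qed
qed

text \<open>Intersections of a finite-dimensional event of \<open>P\<close> with an event of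
  \<open>Q\<close> form an intersection-stable family independent of the increment. Independence
  passes to the generated sigma-algebra and then to its completion by null sets, which contains both
  increment sigma-algebras. The whole path of \<open>Q\<close> is covered, so either enlarged
  filtration can be treated.\<close>

lemma bm_past_indep:
  fixes P :: "real \<Rightarrow> 'a \<Rightarrow> real ^ 'n" and Q :: "real \<Rightarrow> 'a \<Rightarrow> real ^ 'm"
  assumes P: "brownian_motion M S P" and Q: "brownian_motion M S Q" and PQ: "indep_processes M S P Q"
    and uv: "0 \<le> u" "u \<le> v" "v \<le> S" and rs: "0 \<le> r" "r \<le> s" "s \<le> S" and disj: "s \<le> u \<or> v \<le> r"
    and uv': "0 \<le> u'" "v' \<le> S"
  obtains C where "sigma_algebra (space M) C" "sets (incr_sigma M P u v) \<subseteq> C" "sets (incr_sigma M Q u' v') \<subseteq> C"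
    "indep_set C {(\<lambda>\<omega>. P s \<omega> - P r \<omega>) -` A \<inter> space M | A. A \<in> sets borel}"
proof -
  let ?AP = "sigma_sets (space M) {P t -` A \<inter> space M | t A. t \<in> {0..S} \<and> A \<in> sets borel}"
  let ?AQ = "sigma_sets (space M) {Q t -` A \<inter> space M | t A. t \<in> {0..S} \<and> A \<in> sets borel}"
  let ?U = "{(\<lambda>\<omega>. P s \<omega> - P r \<omega>) -` A \<inter> space M | A. A \<in> sets borel}"
  have Pm: "P t \<in> borel_measurable M" and Qm: "Q t \<in> borel_measurable M" if "t \<in> {0..S}" for t
    using P Q that by (auto simp: brownian_motion_def)
  have PQi: "indep_set ?AP ?AQ" using PQ by (simp add: indep_processes_def)
  have gP: "{P t -` A \<inter> space M | t A. t \<in> {0..S} \<and> A \<in> sets borel} \<subseteq> sets M"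
    using Pm by (auto intro: measurable_sets)
  have gQ: "{Q t -` A \<inter> space M | t A. t \<in> {0..S} \<and> A \<in> sets borel} \<subseteq> sets M"
    using Qm by (auto intro: measurable_sets)
  have AQ: "?AQ \<subseteq> sets M" by (rule sets.sigma_sets_subset[OF gQ])
  define MP where "MP = sigma (space M) {P t -` A \<inter> space M | t A. t \<in> {0..S} \<and> A \<in> sets borel}"
  have MP: "space MP = space M" "sets MP = ?AP"
    unfolding MP_def using gP sets.sets_into_space by (auto simp: space_measure_of_conv intro!: sets_measure_of)
  define MQ where "MQ = sigma (space M) {Q t -` A \<inter> space M | t A. t \<in> {0..S} \<and> A \<in> sets borel}"
  have MQ: "space MQ = space M" "sets MQ = ?AQ"
    unfolding MQ_def using gQ sets.sets_into_space by (auto simp: space_measure_of_conv intro!: sets_measure_of)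
  have PMP: "P t \<in> borel_measurable MP" if "t \<in> {0..S}" for t
    by (rule measurableI) (use that MP in \<open>auto intro!: sigma_sets.Basic\<close>)
  have QMQ: "Q t \<in> borel_measurable MQ" if "t \<in> {0..S}" for t
    by (rule measurableI) (use that MQ in \<open>auto intro!: sigma_sets.Basic\<close>)
  define cyl where "cyl K A = {\<omega>\<in>space M. \<forall>q\<in>K. P q \<omega> - P u \<omega> \<in> A q}" for K A
  define C1 where "C1 = {cyl K A | K A. finite K \<and> K \<subseteq> {u..v} \<and> (\<forall>q. A q \<in> sets borel)}"
  define C2 where "C2 = {E \<inter> F | E F. E \<in> C1 \<and> F \<in> ?AQ}"
  have C1MP: "E \<in> sets MP" if EC: "E \<in> C1" for E
  proof -
    obtain K A where E: "E = cyl K A" "finite K" "K \<subseteq> {u..v}" "\<forall>q. A q \<in> sets borel"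
      using EC unfolding C1_def by blast
    have "(\<lambda>\<omega>. P q \<omega> - P u \<omega>) \<in> borel_measurable MP" if "q \<in> K" for q
      by (intro borel_measurable_diff PMP) (use that E uv in auto)
    from measurable_sets[OF this E(4)[rule_format]]
    have "{\<omega>\<in>space MP. P q \<omega> - P u \<omega> \<in> A q} \<in> sets MP" if "q \<in> K" for q
      using that by (simp add: vimage_def Int_def conj_commute)
    from sets.sets_Collect_finite_All[OF this E(2)] show ?thesis by (simp add: E(1) cyl_def MP)
  qed
  have MPM: "sets MP \<subseteq> sets M" unfolding MP by (rule sets.sigma_sets_subset[OF gP])
  have C2M: "C2 \<subseteq> sets M" using C1MP MPM AQ by (auto simp: C2_def)
  have Um: "E \<in> sets MP" if EU: "E \<in> ?U" for E
  proof -
    obtain A where A: "E = (\<lambda>\<omega>. P s \<omega> - P r \<omega>) -` A \<inter> space MP" "A \<in> sets borel" using EU MP by auto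
    have "(\<lambda>\<omega>. P s \<omega> - P r \<omega>) \<in> borel_measurable MP"
      by (intro borel_measurable_diff PMP) (use rs in auto)
    from measurable_sets[OF this A(2)] show ?thesis by (simp add: A(1))
  qed
  have i1: "indep_set C2 ?U"
  proof (rule indep_setI)
    show "C2 \<subseteq> events" by fact
    show "?U \<subseteq> events" using Um MPM by blast
    fix a b assume "a \<in> C2" and b: "b \<in> ?U"
    then obtain E F where EF: "a = E \<inter> F" "E \<in> C1" "F \<in> ?AQ" unfolding C2_def by blast
    obtain K A where E: "E = cyl K A" "finite K" "K \<subseteq> {u..v}" "\<forall>q. A q \<in> sets borel"
      using EF(2) unfolding C1_def by blast
    obtain D where D: "b = (\<lambda>\<omega>. P s \<omega> - P r \<omega>) -` D \<inter> space M" "D \<in> sets borel" using b by auto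
    have Eb: "E \<inter> b \<in> ?AP" using C1MP[OF EF(2)] Um[OF b] sets.Int unfolding MP(2)[symmetric] by blast
    have E': "E \<in> ?AP" using C1MP[OF EF(2)] unfolding MP(2) .
    \<comment> \<open>First the increments of \<open>P\<close> are separated from each other, then
      \<open>E \<inter> b\<close>, which is still an event of \<open>P\<close>, is separated from
      the event \<open>F\<close> of \<open>Q\<close>.\<close>
    have 1: "prob (E \<inter> b) = prob E * prob b"
      unfolding E(1) D(1) cyl_def by (rule bm_increments_indep[OF P E(2,3) E(4)[rule_format] uv rs disj D(2)])
    have "prob (a \<inter> b) = prob ((E \<inter> b) \<inter> F)" unfolding EF(1) by (intro arg_cong[of _ _ prob]) auto
    also have "\<dots> = prob (E \<inter> b) * prob F" by (rule indep_setD[OF PQi Eb EF(3)])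
    also have "\<dots> = prob (E \<inter> F) * prob b" using 1 indep_setD[OF PQi E' EF(3)] by simp
    finally show "prob (a \<inter> b) = prob a * prob b" unfolding EF(1) .
  qed
  have C1_stable: "Int_stable C1"
  proof (rule Int_stableI)
    fix a b assume "a \<in> C1" "b \<in> C1"
    then obtain K A K' A' where KA: "a = cyl K A" "finite K" "K \<subseteq> {u..v}" "\<forall>q. A q \<in> sets borel"
      "b = cyl K' A'" "finite K'" "K' \<subseteq> {u..v}" "\<forall>q. A' q \<in> sets borel" unfolding C1_def by blast
    \<comment> \<open>Times missing from one of the two cylinders are padded with the trivial
      condition \<open>UNIV\<close>.\<close>
    have "a \<inter> b = cyl (K \<union> K') (\<lambda>q. (if q \<in> K then A q else UNIV) \<inter> (if q \<in> K' then A' q else UNIV))"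
      by (auto simp: KA cyl_def)
    moreover have "(if q \<in> K then A q else UNIV) \<inter> (if q \<in> K' then A' q else UNIV) \<in> sets borel" for q
      using KA by auto
    ultimately show "a \<inter> b \<in> C1" unfolding C1_def using KA(2,3,6,7) by blast
  qed
  have C2_stable: "Int_stable C2"
  proof (rule Int_stableI)
    fix a b assume "a \<in> C2" "b \<in> C2"
    then obtain E F E' F' where EF: "a = E \<inter> F" "E \<in> C1" "F \<in> ?AQ" "b = E' \<inter> F'" "E' \<in> C1" "F' \<in> ?AQ" unfolding C2_def by blast
    have "E \<inter> E' \<in> C1" using Int_stableD[OF C1_stable] EF by blast
    moreover have "F \<inter> F' \<in> ?AQ" using EF(3,6) unfolding MQ(2)[symmetric] by (rule sets.Int)
    ultimately have "(E \<inter> E') \<inter> (F \<inter> F') \<in> C2" unfolding C2_def by blast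
    then show "a \<inter> b \<in> C2" unfolding EF by (simp add: Int_ac)
  qed
  \<comment> \<open>Shows that \<open>?U\<close> is itself a sigma-algebra: hence it is intersection
    stable and unchanged when the generated sigma-algebra is taken.\<close>
  have Ux: "sigma_sets (space M) ?U = sets (vimage_algebra (space M) (\<lambda>\<omega>. P s \<omega> - P r \<omega>) borel)"
    by (simp add: sets_vimage_algebra)
  have Uv: "sets (vimage_algebra (space M) (\<lambda>\<omega>. P s \<omega> - P r \<omega>) borel) = ?U"
    by (rule sets_vimage_algebra2) auto
  have U_stable: "Int_stable ?U" unfolding Uv[symmetric] by (rule sets.Int_stable)
  let ?C = "sigma_sets (space M) C2"
  have i2: "indep_set ?C ?U"
    using indep_set_sigma_sets[OF i1 C2_stable U_stable] unfolding Ux Uv .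
  have CM: "?C \<subseteq> sets M" by (rule sets.sigma_sets_subset[OF C2M])
  \<comment> \<open>The null sets in \<open>incr_sigma\<close> need not belong to \<open>?C\<close>;
    enlarging it by almost sure equality takes them in.\<close>
  define C where "C = {E \<in> sets M. \<exists>E0\<in>?C. AE \<omega> in M. \<omega> \<in> E \<longleftrightarrow> \<omega> \<in> E0}"
  have C: "sigma_algebra (space M) C"
    unfolding C_def
    by (rule sigma_algebra_AE_equal[OF sigma_algebra_sigma_sets CM]) (use C2M sets.sets_into_space in auto)
  have CC: "E \<in> C" if "E \<in> ?C" for E unfolding C_def using that CM by auto
  have nullC: "null_sets M \<subseteq> C"
  proof
    fix E assume E: "E \<in> null_sets M"
    have "AE \<omega> in M. \<omega> \<notin> E" by (rule AE_not_in[OF E])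
    then show "E \<in> C" unfolding C_def using E by (auto intro!: bexI[of _ "{}"] sigma_sets.Empty)
  qed
  have i3: "indep_set C ?U"
  proof (rule indep_setI)
    show "C \<subseteq> events" by (auto simp: C_def)
    show U: "?U \<subseteq> events" using Um MPM by blast
    fix a b assume "a \<in> C" and b: "b \<in> ?U"
    then obtain E where E: "a \<in> sets M" "E \<in> ?C" "AE \<omega> in M. \<omega> \<in> a \<longleftrightarrow> \<omega> \<in> E" by (auto simp: C_def)
    have bM: "b \<in> sets M" using U b by blast
    have EM: "E \<in> sets M" using E(2) CM by blast
    have "prob (a \<inter> b) = prob (E \<inter> b)"
      by (rule finite_measure_eq_AE) (use E bM EM in auto)
    moreover have "prob a = prob E"
      by (rule finite_measure_eq_AE) (use E bM EM in auto)
    ultimately show "prob (a \<inter> b) = prob a * prob b"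
      using indep_setD[OF i2 E(2) b] by simp
  qed
  have full1: "space M \<in> C1"
    unfolding C1_def by (rule CollectI, rule exI[of _ "{}"], rule exI[of _ "\<lambda>_. {}"]) (simp add: cyl_def)
  have fullQ: "space M \<in> ?AQ" by (rule sigma_sets_top)
  have inP: "sets (incr_sigma M P u v) \<subseteq> C"
    unfolding sets_incr_sigma
  proof (rule sigma_algebra.sigma_sets_subset[OF C], rule Un_least[OF _ nullC], rule subsetI)
    fix E assume "E \<in> {(\<lambda>\<omega>. P r \<omega> - P u \<omega>) -` A \<inter> space M |r A. r \<in> {u..v} \<and> A \<in> sets borel}"
    then obtain q A where q: "E = (\<lambda>\<omega>. P q \<omega> - P u \<omega>) -` A \<inter> space M" "q \<in> {u..v}" "A \<in> sets borel" by auto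
    have "E = cyl {q} (\<lambda>_. A) \<inter> space M" unfolding q(1) cyl_def by auto
    moreover have "cyl {q} (\<lambda>_. A) \<in> C1" unfolding C1_def using q(2,3) by blast
    ultimately have "E \<in> C2" using fullQ unfolding C2_def by blast
    then show "E \<in> C" by (intro CC sigma_sets.Basic)
  qed
  have inQ: "sets (incr_sigma M Q u' v') \<subseteq> C"
    unfolding sets_incr_sigma
  proof (rule sigma_algebra.sigma_sets_subset[OF C], rule Un_least[OF _ nullC], rule subsetI)
    fix E assume "E \<in> {(\<lambda>\<omega>. Q r \<omega> - Q u' \<omega>) -` A \<inter> space M |r A. r \<in> {u'..v'} \<and> A \<in> sets borel}"
    then obtain q A where q: "E = (\<lambda>\<omega>. Q q \<omega> - Q u' \<omega>) -` A \<inter> space M" "q \<in> {u'..v'}" "A \<in> sets borel" by auto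
    have "(\<lambda>\<omega>. Q q \<omega> - Q u' \<omega>) \<in> borel_measurable MQ"
      by (intro borel_measurable_diff QMQ) (use q uv' in auto)
    from measurable_sets[OF this q(3)] have "E \<in> ?AQ" using q(1) MQ by simp
    moreover have "E = space M \<inter> E" using q(1) by auto
    ultimately have "E \<in> C2" using full1 unfolding C2_def by blast
    then show "E \<in> C" by (intro CC sigma_sets.Basic)
  qed
  show thesis by (rule that[OF C inP inQ i3])
qed

lemma indep_processes_sym:
  assumes "indep_processes M S P Q" shows "indep_processes M S Q P"
proof -
  have i: "indep_set A B \<Longrightarrow> indep_set B A" for A B
  proof (rule indep_setI)
    assume AB: "indep_set A B"
    show "B \<subseteq> events" "A \<subseteq> events" using AB indep_setD_ev1 indep_setD_ev2 by auto
    fix b a assume "b \<in> B" "a \<in> A"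
    from indep_setD[OF AB this(2,1)] show "prob (b \<inter> a) = prob b * prob a"
      by (simp add: Int_commute mult.commute)
  qed
  show ?thesis using assms unfolding indep_processes_def by (rule i)
qed

end

lemma measurable_mono_sigma:
  "f \<in> borel_measurable F \<Longrightarrow> sets F \<subseteq> sets G \<Longrightarrow> space F = space G \<Longrightarrow> f \<in> borel_measurable G"
  by (rule measurable_from_subalg) (simp_all add: subalgebra_def)

locale brownian_pair = prob_space M for M :: "'w measure" +
  fixes S :: real and W :: "real \<Rightarrow> 'w \<Rightarrow> real ^ 'd" and B :: "real \<Rightarrow> 'w \<Rightarrow> real ^ 'l"
  assumes bmW: "brownian_motion M S W" and bmB: "brownian_motion M S B" and indWB: "indep_processes M S W B"
    and S: "0 \<le> S"
begin

abbreviation "HF \<equiv> fwd_sigma M S W B"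
abbreviation "HB \<equiv> bwd_sigma M S W B"

lemma W_measurable: "t \<in> {0..S} \<Longrightarrow> W t \<in> borel_measurable M" 
  and B_measurable: "t \<in> {0..S} \<Longrightarrow> B t \<in> borel_measurable M"
  using bmW bmB by (auto simp: brownian_motion_def)

lemma space_filtrations: "space (HF t) = space M" "space (HB t) = space M" "space (bd_sigma M S W B t) = space M"
  by (simp_all add: fwd_sigma_def bwd_sigma_def bd_sigma_def)

lemma bd_subset:
  assumes "0 \<le> t" "t \<le> S"
  shows "sets (bd_sigma M S W B t) \<subseteq> sets (HF t)" "sets (bd_sigma M S W B t) \<subseteq> sets (HB t)"
  unfolding fwd_sigma_def bwd_sigma_def bd_sigma_def
  by (intro join_sigma_mono incr_sigma_mono; use assms in simp)+

lemma sets_join_subset_M: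
  assumes "0 \<le> u" "v \<le> S" "0 \<le> u'" "v' \<le> S"
  shows "sets (join_sigma M (incr_sigma M W u v) (incr_sigma M B u' v')) \<subseteq> sets M"
  using assms by (intro join_sigma_least incr_sigma_subset_M W_measurable B_measurable sets.sigma_algebra_axioms) auto

sublocale fwd: bm_filtration M HF W 0 S 1
proof
  fix r assume "r \<in> {0..S}"
  then show "subalgebra M (HF r)"
    unfolding subalgebra_def space_filtrations fwd_sigma_def by (intro conjI refl sets_join_subset_M) auto
next
  fix r s :: real assume rs: "0 \<le> r" "r \<le> s" "s \<le> S"
  then show "sets (HF r) \<subseteq> sets (HF s)"
    unfolding fwd_sigma_def by (intro join_sigma_mono incr_sigma_mono) auto
  have "(\<lambda>\<omega>. (W s \<omega> - W 0 \<omega>) - (W r \<omega> - W 0 \<omega>)) \<in> borel_measurable (incr_sigma M W 0 s)"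
    by (intro borel_measurable_diff incr_sigma_measurable) (use rs in auto)
  then have "(\<lambda>\<omega>. W s \<omega> - W r \<omega>) \<in> borel_measurable (incr_sigma M W 0 s)" by simp
  then show "(\<lambda>\<omega>. W s \<omega> - W r \<omega>) \<in> borel_measurable (HF s)"
    by (rule measurable_mono_sigma) (simp_all add: fwd_sigma_def join_sigma_upper)
next
  fix r s :: real assume rs: "0 \<le> r" "r < s" "s \<le> S"
  obtain C where C: "sigma_algebra (space M) C" "sets (incr_sigma M W 0 r) \<subseteq> C" "sets (incr_sigma M B 0 S) \<subseteq> C"
    "indep_set C {(\<lambda>\<omega>. W s \<omega> - W r \<omega>) -` A \<inter> space M | A. A \<in> sets borel}"
    by (rule bm_past_indep[OF bmW bmB indWB, of 0 r r s 0 S]) (use rs in auto)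
  have "sets (HF r) \<subseteq> C" unfolding fwd_sigma_def by (rule join_sigma_least[OF C(2,3,1)])
  then show "indep_set (sets (HF r)) {(\<lambda>\<omega>. W s \<omega> - W r \<omega>) -` A \<inter> space M | A. A \<in> sets borel}"
    using C(4) unfolding indep_set_def by (elim indep_sets_mono_sets) (auto split: bool.split)
  show "distributed M lborel (\<lambda>\<omega>. W s \<omega> - W r \<omega>) (\<lambda>x. ennreal (\<Prod>i\<in>UNIV. normal_density 0 (sqrt (s - r)) (x $ i)))"
    using bmW rs by (simp add: brownian_motion_def)
qed simp

text \<open>In reversed time the increment of \<open>- B (- s)\<close> from \<open>r\<close> to
  \<open>s\<close> is \<open>B (- r) - B (- s)\<close>, so the orientation of the backward sums is
  preserved. What is known at reversed time \<open>r\<close> is the path of \<open>B\<close> after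
  \<open>- r\<close>, together with all of \<open>W\<close>.\<close>

sublocale bwd: bm_filtration M "\<lambda>s. HB (- s)" "\<lambda>s \<omega>. - B (- s) \<omega>" "- S" 0 "- 1"
proof
  fix r assume "r \<in> {-S..0}"
  then show "subalgebra M (HB (- r))"
    unfolding subalgebra_def space_filtrations bwd_sigma_def by (intro conjI refl sets_join_subset_M) auto
next
  fix r s :: real assume rs: "- S \<le> r" "r \<le> s" "s \<le> 0"
  then show "sets (HB (- r)) \<subseteq> sets (HB (- s))"
    unfolding bwd_sigma_def by (intro join_sigma_mono incr_sigma_mono) auto
  have "(\<lambda>\<omega>. B (- r) \<omega> - B (- s) \<omega>) \<in> borel_measurable (incr_sigma M B (- s) S)"
    by (intro incr_sigma_measurable) (use rs in auto)
  then have "(\<lambda>\<omega>. B (- r) \<omega> - B (- s) \<omega>) \<in> borel_measurable (HB (- s))"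
    by (rule measurable_mono_sigma) (simp_all add: bwd_sigma_def join_sigma_upper)
  then show "(\<lambda>\<omega>. - B (- s) \<omega> - - B (- r) \<omega>) \<in> borel_measurable (HB (- s))" by simp
next
  fix r s :: real assume rs: "- S \<le> r" "r < s" "s \<le> 0"
  have e: "(\<lambda>\<omega>. - B (- s) \<omega> - - B (- r) \<omega>) = (\<lambda>\<omega>. B (- r) \<omega> - B (- s) \<omega>)" by auto
  \<comment> \<open>Now the increment precedes the window \<open>[- r, S]\<close> that it must be
    independent of: the first alternative of \<open>disj\<close>.\<close>
  obtain C where C: "sigma_algebra (space M) C" "sets (incr_sigma M B (- r) S) \<subseteq> C" "sets (incr_sigma M W 0 S) \<subseteq> C"
    "indep_set C {(\<lambda>\<omega>. B (- r) \<omega> - B (- s) \<omega>) -` A \<inter> space M | A. A \<in> sets borel}"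
    by (rule bm_past_indep[OF bmB bmW indep_processes_sym[OF indWB], of "- r" S "- s" "- r" 0 S]) (use rs S in auto)
  have "sets (HB (- r)) \<subseteq> C" unfolding bwd_sigma_def by (rule join_sigma_least[OF C(3,2,1)])
  then show "indep_set (sets (HB (- r))) {(\<lambda>\<omega>. - B (- s) \<omega> - - B (- r) \<omega>) -` A \<inter> space M | A. A \<in> sets borel}"
    unfolding e using C(4) unfolding indep_set_def by (elim indep_sets_mono_sets) (auto split: bool.split)
  show "distributed M lborel (\<lambda>\<omega>. - B (- s) \<omega> - - B (- r) \<omega>) (\<lambda>x. ennreal (\<Prod>i\<in>UNIV. normal_density 0 (sqrt (s - r)) (x $ i)))"
  proof -
    have "\<And>s t. 0 \<le> s \<Longrightarrow> s < t \<Longrightarrow> t \<le> S \<Longrightarrow> distributed M lborel (\<lambda>\<omega>. B t \<omega> - B s \<omega>)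
      (\<lambda>x. ennreal (\<Prod>i\<in>UNIV. normal_density 0 (sqrt (t - s)) (x $ i)))"
      using bmB by (simp add: brownian_motion_def)
    from this[of "- s" "- r"] show ?thesis unfolding e using rs by simp
  qed
qed simp

end

section \<open>From processes on an interval to functions on the product space\<close>

lemma progressive_time_change:
  fixes \<phi> :: "real \<Rightarrow> 'w \<Rightarrow> 'a::euclidean_space"
  assumes "progressive M H a b \<phi>" "\<theta> \<in> borel_measurable borel" "\<And>t. \<theta> t \<in> {a..b}"
  shows "(\<lambda>p. \<phi> (\<theta> (snd p)) (fst p)) \<in> borel_measurable (M \<Otimes>\<^sub>M lborel)"
proof -
  have 1: "(\<lambda>(\<omega>, t). \<phi> t \<omega>) \<in> borel_measurable (M \<Otimes>\<^sub>M restrict_space borel {a..b})"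
    using assms(1) by (simp add: progressive_def)
  have "(\<lambda>p. \<theta> (snd p)) \<in> borel_measurable (M \<Otimes>\<^sub>M lborel)"
    using assms(2) by measurable
  then have "(\<lambda>p. \<theta> (snd p)) \<in> (M \<Otimes>\<^sub>M lborel) \<rightarrow>\<^sub>M restrict_space borel {a..b}"
    by (rule measurable_restrict_space2[rotated]) (use assms(3) in auto)
  then have "(\<lambda>p. (fst p, \<theta> (snd p))) \<in> (M \<Otimes>\<^sub>M lborel) \<rightarrow>\<^sub>M (M \<Otimes>\<^sub>M restrict_space borel {a..b})"
    by (intro measurable_Pair measurable_fst)
  from measurable_comp[OF this 1] show ?thesis by (simp add: comp_def)
qed

text \<open>Nothing is known about a process outside its interval, not even measurability. Extension
  by zero gives a function on the whole product space, whose squared norm there is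
  \<open>mean_sq\<close>.\<close>

definition cutoff :: "real \<Rightarrow> real \<Rightarrow> (real \<Rightarrow> 'w \<Rightarrow> 'a::real_vector) \<Rightarrow> 'w \<times> real \<Rightarrow> 'a" where
  "cutoff a b \<phi> p = indicator {a..b} (snd p) *\<^sub>R \<phi> (snd p) (fst p)"

lemma cutoff_measurable:
  fixes \<phi> :: "real \<Rightarrow> 'w \<Rightarrow> 'a::euclidean_space"
  assumes "progressive M H a b \<phi>" "a \<le> b"
  shows "cutoff a b \<phi> \<in> borel_measurable (M \<Otimes>\<^sub>M lborel)"
proof -
  \<comment> \<open>Clamping the time keeps the argument inside \<open>[a, b]\<close>, where joint
    measurability is available; the indicator hides the difference.\<close>
  have "(\<lambda>p. \<phi> (max a (min b (snd p))) (fst p)) \<in> borel_measurable (M \<Otimes>\<^sub>M lborel)"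
    by (rule progressive_time_change[OF assms(1), of "\<lambda>t. max a (min b t)"]) (use assms(2) in auto)
  then have "(\<lambda>p. indicator {a..b} (snd p) *\<^sub>R \<phi> (max a (min b (snd p))) (fst p)) \<in> borel_measurable (M \<Otimes>\<^sub>M lborel)"
    by measurable
  also have "(\<lambda>p. indicator {a..b} (snd p) *\<^sub>R \<phi> (max a (min b (snd p))) (fst p)) = cutoff a b \<phi>"
    by (auto simp: fun_eq_iff cutoff_def indicator_def max_def min_def)
  finally show ?thesis .
qed

lemma mean_sq_eq:
  fixes \<phi> :: "real \<Rightarrow> 'w \<Rightarrow> 'a::euclidean_space"
  assumes "cutoff a b \<phi> \<in> borel_measurable (M \<Otimes>\<^sub>M lborel)"
  shows "mean_sq M a b \<phi> = (\<integral>\<^sup>+p. ennreal ((norm (cutoff a b \<phi> p))\<^sup>2) \<partial>(M \<Otimes>\<^sub>M lborel))"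
proof -
  note assms[measurable]
  have "(\<integral>\<^sup>+p. ennreal ((norm (cutoff a b \<phi> p))\<^sup>2) \<partial>(M \<Otimes>\<^sub>M lborel)) 
     = (\<integral>\<^sup>+\<omega>. (\<integral>\<^sup>+t. ennreal ((norm (cutoff a b \<phi> (\<omega>, t)))\<^sup>2) \<partial>lborel) \<partial>M)"
    by (rule lborel.nn_integral_fst[symmetric]) measurable
  also have "\<dots> = mean_sq M a b \<phi>"
    unfolding mean_sq_def
    by (intro nn_integral_cong) (auto simp: cutoff_def indicator_def)
  finally show ?thesis by simp
qed

lemma L2_process_sq_int:
  assumes "L2_process M H a b \<phi>" "a \<le> b"
  shows "sq_int (M \<Otimes>\<^sub>M lborel) (cutoff a b \<phi>)"
  using assms cutoff_measurable[of M H a b \<phi>] mean_sq_eq[of a b \<phi> M] sq_int_iff_nn[of "cutoff a b \<phi>" "M \<Otimes>\<^sub>M lborel"]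
  by (simp add: L2_process_def)

context bm_filtration
begin

lemma elem_sum:
  assumes "a \<le> b" "\<And>i. i < n \<Longrightarrow> elem a b (P i) (X i)"
  shows "elem a b (\<lambda>p. \<Sum>i<n. P i p) (\<lambda>\<omega>. \<Sum>i<(n::nat). X i \<omega>)"
  using assms(2)
proof (induction n)
  case 0
  show ?case using elem_zero[OF assms(1)] by simp
next
  case (Suc n)
  have "elem a b (\<lambda>p. (\<Sum>i<n. P i p) + P n p) (\<lambda>\<omega>. (\<Sum>i<n. X i \<omega>) + X n \<omega>)"
    by (rule elem_add) (use Suc in auto)
  then show ?case by simp
qed

text \<open>Common bridge from both definitions of a stochastic integral to \<open>ito\<close>. The
  interval \<open>[a, b]\<close> is in the time of the filtration and \<open>[a', b']\<close> in the
  original time; \<open>supp\<close> links them, and it makes the simple integrands vanish outside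
  \<open>[a', b']\<close>.\<close>

lemma ito_limitI:
  fixes r s :: "nat \<Rightarrow> nat \<Rightarrow> real" and N :: "nat \<Rightarrow> nat" and \<eta> :: "nat \<Rightarrow> nat \<Rightarrow> 'w \<Rightarrow> real ^ 'n" and \<phi> :: "real \<Rightarrow> 'w \<Rightarrow> real ^ 'n" and a' b' :: real
  defines "P \<equiv> \<lambda>k p. \<Sum>i<N k. win (r k i) (s k i) p *\<^sub>R \<eta> k i (fst p)"
  assumes ab: "lo \<le> a" "a \<le> b" "b \<le> hi"
    and rs: "\<And>k i. i < N k \<Longrightarrow> a \<le> r k i \<and> r k i \<le> s k i \<and> s k i \<le> b \<and> bdd_rv (r k i) (\<eta> k i)"
    and supp: "\<And>t. sg * t \<in> {a..b} \<longleftrightarrow> t \<in> {a'..b'}"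
    and \<phi>: "L2_process M H' a' b' \<phi>" "a' \<le> b'" and X: "X \<in> borel_measurable M"
    and lim1: "(\<lambda>k. mean_sq M a' b' (\<lambda>t \<omega>. \<phi> t \<omega> - P k (\<omega>, t))) \<longlonglongrightarrow> 0"
    and lim2: "(\<lambda>k. \<integral>\<^sup>+ \<omega>. ennreal ((X \<omega> - (\<Sum>i<N k. \<eta> k i \<omega> \<bullet> incr (r k i) (s k i) \<omega>))\<^sup>2) \<partial>M) \<longlonglongrightarrow> 0"
  shows "ito a b (cutoff a' b' \<phi>) X"
proof -
  let ?Y = "\<lambda>k \<omega>. \<Sum>i<N k. \<eta> k i \<omega> \<bullet> incr (r k i) (s k i) \<omega>"
  have el: "elem a b (P k) (?Y k)" for k
    unfolding P_def by (rule elem_sum[OF ab(2)]) (use rs in \<open>blast intro: elem_base\<close>)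
  note sq = elem_sq_int[OF el ab(1,3)]
  have 0: "P k p = indicator {a'..b'} (snd p) *\<^sub>R P k p" for k p
  proof (cases "snd p \<in> {a'..b'}")
    case False
    then have "sg * snd p \<notin> {a..b}" using supp by simp
    then have "win (r k i) (s k i) p = 0" if "i < N k" for i
      using rs[OF that] by (auto simp: indicator_def)
    then have "P k p = 0" unfolding P_def by (intro sum.neutral) auto
    then show ?thesis by simp
  qed simp
  have c: "cutoff a' b' (\<lambda>t \<omega>. \<phi> t \<omega> - P k (\<omega>, t)) p = cutoff a' b' \<phi> p - P k p" for k p
    by (subst (2) 0) (simp add: cutoff_def scaleR_diff_right)
  have \<phi>m: "cutoff a' b' \<phi> \<in> borel_measurable MT"
    using cutoff_measurable \<phi> by (auto simp: L2_process_def)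
  have "l2_tendsto MT P (cutoff a' b' \<phi>)"
  proof (rule l2_tendstoI_nn[OF sq(1) \<phi>m])
    have m: "cutoff a' b' (\<lambda>t \<omega>. \<phi> t \<omega> - P k (\<omega>, t)) \<in> borel_measurable MT" for k
      unfolding c using \<phi>m sq_int_measurable[OF sq(1)] by (rule borel_measurable_diff)
    show "(\<lambda>k. \<integral>\<^sup>+p. ennreal ((norm (cutoff a' b' \<phi> p - P k p))\<^sup>2) \<partial>MT) \<longlonglongrightarrow> 0"
      using lim1 unfolding mean_sq_eq[OF m] c .
  qed
  moreover have "l2_tendsto M ?Y X"
    by (rule l2_tendstoI_nn[OF sq(2) X]) (use lim2 in simp)
  ultimately show ?thesis unfolding ito_def
    by (intro exI[of _ P] exI[of _ ?Y] conjI allI el)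
qed

end

lemma partition_points_bounds:
  assumes "partition_points a b n \<tau>" "i < n"
  shows "a \<le> \<tau> i" "\<tau> i \<le> \<tau> (Suc i)" "\<tau> (Suc i) \<le> b"
proof -
  have m: "\<tau> j \<le> \<tau> k" if "j \<le> k" "k \<le> n" for j k
    using assms that by (auto simp: partition_points_def mono_on_def)
  show "a \<le> \<tau> i" "\<tau> i \<le> \<tau> (Suc i)" "\<tau> (Suc i) \<le> b"
    using m[of 0 i] m[of i "Suc i"] m[of "Suc i" n] assms by (auto simp: partition_points_def)
qed

context brownian_pair
begin

lemma has_ito_integral_ito:
  assumes "has_ito_integral M HF W a b \<phi> X" "0 \<le> a" "a \<le> b" "b \<le> S"
  shows "fwd.ito a b (cutoff a b \<phi>) X"
proof -
  obtain N \<tau> \<eta> where h: "\<forall>k. partition_points a b (N k) (\<tau> k) \<and>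
        (\<forall>i<N k. \<eta> k i \<in> borel_measurable (HF (\<tau> k i)) \<and> bounded (\<eta> k i ` space M))"
      "(\<lambda>k. mean_sq M a b (\<lambda>t \<omega>. \<phi> t \<omega> -
            (\<Sum>i<N k. indicator {\<tau> k i<..\<tau> k (Suc i)} t *\<^sub>R \<eta> k i \<omega>))) \<longlonglongrightarrow> 0"
      "(\<lambda>k. \<integral>\<^sup>+ \<omega>. ennreal ((X \<omega> -
            (\<Sum>i<N k. \<eta> k i \<omega> \<bullet> (W (\<tau> k (Suc i)) \<omega> - W (\<tau> k i) \<omega>)))\<^sup>2) \<partial>M) \<longlonglongrightarrow> 0"
    and L: "L2_process M HF a b \<phi>" "X \<in> borel_measurable M"
    using assms(1) unfolding has_ito_integral_def by (elim conjE exE) (rule that, assumption+)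
  have h1: "partition_points a b (N k) (\<tau> k)" for k using h(1) by blast
  have h2: "\<eta> k i \<in> borel_measurable (HF (\<tau> k i)) \<and> bounded (\<eta> k i ` space M)" if "i < N k" for k i
    using h(1) that by blast
  show ?thesis
  proof (rule fwd.ito_limitI[OF assms(2-4), where r=\<tau> and s="\<lambda>k i. \<tau> k (Suc i)" and N=N and \<eta>=\<eta>, OF _ _ L(1) assms(3) L(2)])
    show "a \<le> \<tau> k i \<and> \<tau> k i \<le> \<tau> k (Suc i) \<and> \<tau> k (Suc i) \<le> b \<and> fwd.bdd_rv (\<tau> k i) (\<eta> k i)" if "i < N k" for k i
      using partition_points_bounds[OF h1 that] h2[OF that] by (simp add: fwd.bdd_rv_def)
  qed (use h(2,3) in \<open>simp_all add: fwd.incr_def\<close>)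
qed

text \<open>Negation turns the cell from \<open>\<tau> k i\<close> to
  \<open>\<tau> k (Suc i)\<close> around: its right end, where the coefficient is measurable,
  becomes the left end of a forward window.\<close>

lemma has_backward_ito_integral_ito:
  assumes "has_backward_ito_integral M HB B a b \<phi> X" "0 \<le> a" "a \<le> b" "b \<le> S"
  shows "bwd.ito (- b) (- a) (cutoff a b \<phi>) X"
proof -
  obtain N \<tau> \<eta> where h: "\<forall>k. partition_points a b (N k) (\<tau> k) \<and>
        (\<forall>i<N k. \<eta> k i \<in> borel_measurable (HB (\<tau> k (Suc i))) \<and> bounded (\<eta> k i ` space M))"
      "(\<lambda>k. mean_sq M a b (\<lambda>t \<omega>. \<phi> t \<omega> -
            (\<Sum>i<N k. indicator {\<tau> k i..<\<tau> k (Suc i)} t *\<^sub>R \<eta> k i \<omega>))) \<longlonglongrightarrow> 0"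
      "(\<lambda>k. \<integral>\<^sup>+ \<omega>. ennreal ((X \<omega> -
            (\<Sum>i<N k. \<eta> k i \<omega> \<bullet> (B (\<tau> k (Suc i)) \<omega> - B (\<tau> k i) \<omega>)))\<^sup>2) \<partial>M) \<longlonglongrightarrow> 0"
    and L: "L2_process M HB a b \<phi>" "X \<in> borel_measurable M"
    using assms(1) unfolding has_backward_ito_integral_def by (elim conjE exE) (rule that, assumption+)
  have h1: "partition_points a b (N k) (\<tau> k)" for k using h(1) by blast
  have h2: "\<eta> k i \<in> borel_measurable (HB (\<tau> k (Suc i))) \<and> bounded (\<eta> k i ` space M)" if "i < N k" for k i
    using h(1) that by blast
  have i: "indicator {- v<..- u} (- 1 * t) = (indicator {u..<v} t :: real)" for u v t :: real
    by (auto simp: indicator_def)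
  show ?thesis
  proof (rule bwd.ito_limitI[where r="\<lambda>k i. - \<tau> k (Suc i)" and s="\<lambda>k i. - \<tau> k i" and N=N and \<eta>=\<eta>, OF _ _ _ _ _ L(1) assms(3) L(2)])
    show "- b \<le> - \<tau> k (Suc i) \<and> - \<tau> k (Suc i) \<le> - \<tau> k i \<and> - \<tau> k i \<le> - a \<and> bwd.bdd_rv (- \<tau> k (Suc i)) (\<eta> k i)" if "i < N k" for k i
      using partition_points_bounds[OF h1 that] h2[OF that] by (simp add: bwd.bdd_rv_def)
    show "(\<lambda>k. mean_sq M a b (\<lambda>t \<omega>. \<phi> t \<omega> - (\<Sum>i<N k. bwd.win (- \<tau> k (Suc i)) (- \<tau> k i) (\<omega>, t) *\<^sub>R \<eta> k i (fst (\<omega>, t))))) \<longlonglongrightarrow> 0"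
      using h(2) by (simp only: i fst_conv snd_conv)
  qed (use h(3) assms in \<open>auto simp: bwd.incr_def\<close>)
qed

end

section \<open>The test function\<close>

text \<open>
  A smooth substitute for the square of the positive part: near \<open>0\<close> it behaves like a cube, so it is
  twice continuously differentiable; for large arguments it grows quadratically, so that only second
  moments are needed. The inequality \<open>(\<psi>')\<^sup>2 \<le> 2 \<psi> \<psi>''\<close> lets the gradient term be absorbed.
\<close>

definition psi :: "real \<Rightarrow> real" where
  "psi x = (let p = max 0 x in p\<^sup>2 - p + 1 - 1 / (1 + p))"

definition psi' :: "real \<Rightarrow> real" where
  "psi' x = (let p = max 0 x in 2 * p - 1 + 1 / (1 + p)\<^sup>2)"

definition psi'' :: "real \<Rightarrow> real" where
  "psi'' x = (let p = max 0 x in 2 - 2 / (1 + p) ^ 3)"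

lemma psi_zero: "x \<le> 0 \<Longrightarrow> psi x = 0" "x \<le> 0 \<Longrightarrow> psi' x = 0" "x \<le> 0 \<Longrightarrow> psi'' x = 0"
  by (auto simp: psi_def psi'_def psi''_def max_def)

text \<open>The origin of the test function: it is \<open>x ^ 3 / (1 + x)\<close> on the positive
  axis, and its definition is the result of polynomial division, which is easier to differentiate.
  The quotients given here are the form suited to comparisons.\<close>

lemma psi_pos:
  assumes "0 < x"
  shows "psi x = x ^ 3 / (1 + x)" "psi' x = x\<^sup>2 * (2 * x + 3) / (1 + x)\<^sup>2" "psi'' x = 2 * x * (x\<^sup>2 + 3 * x + 3) / (1 + x) ^ 3"
  using assms by (auto simp: psi_def psi'_def psi''_def max_def divide_simps) (auto simp: algebra_simps power2_eq_square power3_eq_cube)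

text \<open>There is no kink at 0: the difference quotient there is either zero or that of
  \<open>g\<close>, and the latter tends to \<open>g' 0 = 0\<close>.\<close>

lemma DERIV_max_zero:
  fixes g g' :: "real \<Rightarrow> real"
  assumes g: "\<And>x. 0 \<le> x \<Longrightarrow> (g has_real_derivative g' x) (at x)" and 0: "g' 0 = 0"
  shows "((\<lambda>x. g (max 0 x)) has_real_derivative g' (max 0 x)) (at x)"
proof -
  consider "x < 0" | "x = 0" | "0 < x" by linarith
  then show ?thesis
  proof cases
    case 1
    have "((\<lambda>_. g 0) has_real_derivative 0) (at x)" by simp
    then have "((\<lambda>x. g (max 0 x)) has_real_derivative 0) (at x)"
      by (rule has_field_derivative_transform_within_open[where S="{..<0}"]) (use 1 in \<open>auto simp: max_def\<close>)
    then show ?thesis using 1 0 by (simp add: max_def)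
  next
    case 3
    have "((\<lambda>x. g (max 0 x)) has_real_derivative g' x) (at x)"
      by (rule has_field_derivative_transform_within_open[OF g, where S="{0<..}"]) (use 3 in \<open>auto simp: max_def\<close>)
    then show ?thesis using 3 by (simp add: max_def)
  next
    case 2
    have lim: "((\<lambda>h. (g (0 + h) - g 0) / h) \<longlongrightarrow> 0) (at 0)"
      using g[of 0] 0 by (simp add: DERIV_def)
    have "((\<lambda>h. (g (max 0 (0 + h)) - g (max 0 0)) / h) \<longlongrightarrow> 0) (at 0)"
    proof (rule Lim_null_comparison)
      show "((\<lambda>h. \<bar>(g (0 + h) - g 0) / h\<bar>) \<longlongrightarrow> 0) (at 0)"
        using tendsto_rabs[OF lim] by simp
      show "\<forall>\<^sub>F h in at 0. norm ((g (max 0 (0 + h)) - g (max 0 0)) / h) \<le> \<bar>(g (0 + h) - g 0) / h\<bar>"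
        by (intro always_eventually) (auto simp: max_def simp del: abs_divide)
    qed
    then show ?thesis using 2 0 by (simp add: DERIV_def)
  qed
qed

lemma psi_deriv: "(psi has_real_derivative psi' x) (at x)"
  unfolding psi_def psi'_def Let_def
  by (rule DERIV_max_zero[where g="\<lambda>p. p\<^sup>2 - p + 1 - 1 / (1 + p)" and g'="\<lambda>p. 2 * p - 1 + 1 / (1 + p)\<^sup>2"])
    (auto intro!: derivative_eq_intros simp: power2_eq_square)

lemma psi'_deriv: "(psi' has_real_derivative psi'' x) (at x)"
proof -
  have "((\<lambda>p. 2 * p - 1 + 1 / (1 + p)\<^sup>2) has_real_derivative 2 - 2 / (1 + x) ^ 3) (at x)" if "0 \<le> x" for x :: real
  proof -
    have "((\<lambda>p. 2 * p - 1 + 1 / (1 + p)\<^sup>2) has_real_derivative 2 - (2 * (1 + x)) / ((1 + x)\<^sup>2 * (1 + x)\<^sup>2)) (at x)"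
      using that by (auto intro!: derivative_eq_intros) (simp add: minus_divide_left)
    also have "(2 * (1 + x)) / ((1 + x)\<^sup>2 * (1 + x)\<^sup>2) = 2 / (1 + x) ^ 3"
    proof -
      have "2 * d / (d\<^sup>2 * d\<^sup>2) = 2 / d ^ 3" if "d \<noteq> 0" for d :: real
        using that by (simp add: eval_nat_numeral)
      from this[of "1 + x"] show ?thesis using that by simp
    qed
    finally show ?thesis .
  qed
  then show ?thesis
    unfolding psi'_def psi''_def Let_def
    by (rule DERIV_max_zero[where g="\<lambda>p. 2 * p - 1 + 1 / (1 + p)\<^sup>2" and g'="\<lambda>p. 2 - 2 / (1 + p) ^ 3"]) auto
qed

lemma psi''_bounds: "0 \<le> psi'' x" "psi'' x \<le> 2"
proof -
  have "1 / (1 + max 0 x) ^ 3 \<le> 1" "0 \<le> 1 / (1 + max 0 x) ^ 3" by (simp_all add: one_le_power)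
  moreover have "psi'' x = 2 - 2 * (1 / (1 + max 0 x) ^ 3)" by (simp add: psi''_def Let_def)
  ultimately show "0 \<le> psi'' x" "psi'' x \<le> 2" by linarith+
qed

text \<open>The constant is the supremum of the third derivative \<open>6 / (1 + x) ^ 4\<close> over
  positive \<open>x\<close>. The proof factors a difference of reciprocal cubes instead, which
  avoids differentiating once more across 0.\<close>

lemma psi''_Lipschitz: "\<bar>psi'' x - psi'' y\<bar> \<le> 6 * \<bar>x - y\<bar>"
proof -
  have *: "\<bar>psi'' x - psi'' y\<bar> \<le> 6 * \<bar>x - y\<bar>" if "y \<le> x" for x y
  proof -
    define p q where "p = 1 + max 0 x" and "q = 1 + max 0 y"
    have pq: "1 \<le> q" "q \<le> p" "p - q \<le> x - y" using that by (auto simp: p_def q_def)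
    have "psi'' x - psi'' y = 2 * (1 / q ^ 3 - 1 / p ^ 3)"
      by (simp add: psi''_def Let_def p_def q_def)
    also have "1 / q ^ 3 - 1 / p ^ 3 = (1 / q - 1 / p) * (1 / q\<^sup>2 + 1 / (p * q) + 1 / p\<^sup>2)"
      using pq by (simp add: divide_simps) (simp add: algebra_simps power2_eq_square power3_eq_cube)
    finally have e: "psi'' x - psi'' y = 2 * ((1 / q - 1 / p) * (1 / q\<^sup>2 + 1 / (p * q) + 1 / p\<^sup>2))" .
    have i: "0 \<le> 1 / q - 1 / p" "1 / q - 1 / p \<le> p - q"
    proof -
      have "1 / q - 1 / p = (p - q) / (p * q)" using pq by (simp add: field_simps)
      moreover have "1 \<le> p * q" using pq mult_mono[of 1 p 1 q] by simp
      ultimately show "0 \<le> 1 / q - 1 / p" "1 / q - 1 / p \<le> p - q" using pq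
        by (auto simp: divide_le_eq mult_le_cancel_left1)
    qed
    have "1 / q\<^sup>2 \<le> 1" "1 / p\<^sup>2 \<le> 1" "1 / (p * q) \<le> 1"
      using pq mult_mono[of 1 p 1 q] by (auto simp: one_le_power)
    then have j: "0 \<le> 1 / q\<^sup>2 + 1 / (p * q) + 1 / p\<^sup>2" "1 / q\<^sup>2 + 1 / (p * q) + 1 / p\<^sup>2 \<le> 3"
      using pq by (simp, linarith)
    have "(1 / q - 1 / p) * (1 / q\<^sup>2 + 1 / (p * q) + 1 / p\<^sup>2) \<le> (p - q) * 3"
      using i j pq by (intro mult_mono) auto
    moreover have "0 \<le> (1 / q - 1 / p) * (1 / q\<^sup>2 + 1 / (p * q) + 1 / p\<^sup>2)" using i j by simp
    ultimately show ?thesis unfolding e using pq that by simp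
  qed
  show ?thesis using *[of y x] *[of x y] by (cases "y \<le> x") (auto simp: abs_minus_commute)
qed

text \<open>Lagrange form: the remainder is half the change of \<open>psi''\<close> times
  \<open>h\<^sup>2\<close>. Boundedness of \<open>psi''\<close> gives the quadratic bound, which
  second moments can pay for, and its Lipschitz continuity gives the cubic one, which is small on
  fine partitions.\<close>

lemma psi_Taylor: "\<bar>psi (x + h) - psi x - psi' x * h - psi'' x / 2 * h\<^sup>2\<bar> \<le> min (h\<^sup>2) (3 * \<bar>h\<bar> ^ 3)"
proof (cases "h = 0")
  case False
  let ?d = "\<lambda>m :: nat. if m = 0 then psi else if m = 1 then psi' else psi''"
  define a b where "a = min x (x + h)" and "b = max x (x + h)"
  have "\<exists>t. (if x + h < x then x + h < t \<and> t < x else x < t \<and> t < x + h) \<and>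
    psi (x + h) = (\<Sum>m<2. (?d m x / fact m) * (x + h - x) ^ m) + (?d 2 t / fact 2) * (x + h - x) ^ 2"
  proof (rule Taylor[of 2 ?d psi a b x "x + h"])
    show "\<forall>m t. m < 2 \<and> a \<le> t \<and> t \<le> b \<longrightarrow> (?d m has_real_derivative ?d (Suc m) t) (at t)"
      by (auto simp: less_2_cases_iff psi_deriv psi'_deriv)
  qed (use False in \<open>auto simp: a_def b_def\<close>)
  then obtain t where tc: "if x + h < x then x + h < t \<and> t < x else x < t \<and> t < x + h" and
    e: "psi (x + h) = (\<Sum>m<2. (?d m x / fact m) * (x + h - x) ^ m) + (?d 2 t / fact 2) * (x + h - x) ^ 2"
    by (elim exE conjE)
  have t: "\<bar>t - x\<bar> \<le> \<bar>h\<bar>" using tc by (auto split: if_splits)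
  have e2: "psi (x + h) - psi x - psi' x * h - psi'' x / 2 * h\<^sup>2 = (psi'' t - psi'' x) / 2 * h\<^sup>2"
    using e by (simp add: numeral_2_eq_2 algebra_simps)
  have "\<bar>psi'' t - psi'' x\<bar> \<le> 2" using psi''_bounds[of t] psi''_bounds[of x] by linarith
  then have 1: "\<bar>(psi'' t - psi'' x) / 2 * h\<^sup>2\<bar> \<le> h\<^sup>2"
    using mult_right_mono[of "\<bar>psi'' t - psi'' x\<bar>" 2 "h\<^sup>2"] by (simp add: abs_mult)
  have "\<bar>psi'' t - psi'' x\<bar> \<le> 6 * \<bar>h\<bar>"
    by (rule order_trans[OF psi''_Lipschitz]) (use t in simp)
  then have "\<bar>psi'' t - psi'' x\<bar> / 2 * h\<^sup>2 \<le> (6 * \<bar>h\<bar>) / 2 * h\<^sup>2" by (intro mult_right_mono) auto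
  then have 2: "\<bar>(psi'' t - psi'' x) / 2 * h\<^sup>2\<bar> \<le> 3 * \<bar>h\<bar> ^ 3"
    by (simp add: abs_mult power2_eq_square power3_eq_cube)
  show ?thesis unfolding e2 using 1 2 by simp
qed simp

lemma psi_bounds: "0 \<le> psi x" "psi x \<le> x\<^sup>2" "0 \<le> psi' x" "psi' x \<le> 2 * \<bar>x\<bar>" "psi x = 0 \<Longrightarrow> x \<le> 0"
proof -
  have "0 \<le> psi x \<and> psi x \<le> x\<^sup>2 \<and> 0 \<le> psi' x \<and> psi' x \<le> 2 * \<bar>x\<bar> \<and> (psi x = 0 \<longrightarrow> x \<le> 0)"
  proof (cases "0 < x")
    case True
    have "x ^ 3 / (1 + x) \<le> x\<^sup>2"
      using True by (simp add: divide_simps) (simp add: algebra_simps power2_eq_square power3_eq_cube)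
    moreover have "x\<^sup>2 * (2 * x + 3) / (1 + x)\<^sup>2 \<le> 2 * x"
      using True by (simp add: divide_simps) (simp add: algebra_simps power2_eq_square)
    ultimately show ?thesis using True by (simp add: psi_pos)
  qed (simp add: psi_zero)
  then show "0 \<le> psi x" "psi x \<le> x\<^sup>2" "0 \<le> psi' x" "psi' x \<le> 2 * \<bar>x\<bar>" "psi x = 0 \<Longrightarrow> x \<le> 0" by auto
qed

text \<open>With the rational forms, the three estimates reduce for \<open>x > 0\<close> to
  \<open>2 * x + 3 \<le> 3 * (1 + x)\<close>, to
  \<open>x\<^sup>2 + 3 * x + 3 \<le> 3 * (1 + x)\<^sup>2\<close>, and to
  \<open>(2 * x + 3)\<^sup>2 \<le> 4 * (x\<^sup>2 + 3 * x + 3)\<close>, that is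
  \<open>9 \<le> 12\<close>.\<close>

lemma psi_compare:
  "psi' x * \<bar>x\<bar> \<le> 3 * psi x" "psi'' x * x\<^sup>2 \<le> 6 * psi x" "(psi' x)\<^sup>2 \<le> 2 * psi x * psi'' x"
proof -
  have "psi' x * \<bar>x\<bar> \<le> 3 * psi x \<and> psi'' x * x\<^sup>2 \<le> 6 * psi x \<and> (psi' x)\<^sup>2 \<le> 2 * psi x * psi'' x"
  proof (cases "0 < x")
    case True
    have d: "1 + x \<noteq> 0" using True by simp
    have g: "a * (3 * d) / d\<^sup>2 = 3 * (a / d)" "2 * a * (3 * d\<^sup>2) / d ^ 3 = 6 * (a / d)" if "d \<noteq> 0" for a d :: real
      using that by (simp_all add: power2_eq_square power3_eq_cube)
    have "psi' x * \<bar>x\<bar> = x ^ 3 * (2 * x + 3) / (1 + x)\<^sup>2"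
      using True by (simp add: psi_pos power2_eq_square power3_eq_cube)
    also have "\<dots> \<le> x ^ 3 * (3 * (1 + x)) / (1 + x)\<^sup>2"
      using True by (intro divide_right_mono mult_left_mono) auto
    also have "\<dots> = 3 * psi x" unfolding g(1)[OF d] psi_pos(1)[OF True] ..
    finally have 1: "psi' x * \<bar>x\<bar> \<le> 3 * psi x" .
    have "psi'' x * x\<^sup>2 = 2 * x ^ 3 * (x\<^sup>2 + 3 * x + 3) / (1 + x) ^ 3"
      using True by (simp add: psi_pos power2_eq_square power3_eq_cube)
    also have "\<dots> \<le> 2 * x ^ 3 * (3 * (1 + x)\<^sup>2) / (1 + x) ^ 3"
      using True by (intro divide_right_mono mult_left_mono) (auto simp: power2_eq_square algebra_simps)
    also have "\<dots> = 6 * psi x" unfolding g(2)[OF d] psi_pos(1)[OF True] ..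
    finally have 2: "psi'' x * x\<^sup>2 \<le> 6 * psi x" .
    have "(psi' x)\<^sup>2 = x ^ 4 * (2 * x + 3)\<^sup>2 / (1 + x) ^ 4"
      using True by (simp add: psi_pos power_divide power_mult_distrib flip: power_mult)
    also have "\<dots> \<le> x ^ 4 * (4 * (x\<^sup>2 + 3 * x + 3)) / (1 + x) ^ 4"
      using True by (intro divide_right_mono mult_left_mono) (auto simp: power2_eq_square algebra_simps)
    also have "\<dots> = 2 * psi x * psi'' x"
    proof -
      have "x ^ 4 = x ^ 3 * x" "(1 + x) ^ 4 = (1 + x) * (1 + x) ^ 3" by (simp_all add: eval_nat_numeral)
      then show ?thesis using True by (simp add: psi_pos)
    qed
    finally show ?thesis using 1 2 by blast
  qed (simp add: psi_zero)
  then show "psi' x * \<bar>x\<bar> \<le> 3 * psi x" "psi'' x * x\<^sup>2 \<le> 6 * psi x" "(psi' x)\<^sup>2 \<le> 2 * psi x * psi'' x" by auto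
qed

lemma psi_continuous: "isCont psi x" "isCont psi' x" "isCont psi'' x"
proof -
  show "isCont psi x" "isCont psi' x" using psi_deriv psi'_deriv DERIV_isCont by blast+
  have "1 + max 0 x \<noteq> 0" by (simp add: max_def)
  then show "isCont psi'' x" unfolding psi''_def Let_def by (intro continuous_intros) auto
qed

lemma psi_measurable [measurable]: 
  "psi \<in> borel_measurable borel" "psi' \<in> borel_measurable borel" "psi'' \<in> borel_measurable borel"
  using psi_continuous by (auto intro!: borel_measurable_continuous_onI simp: continuous_on_eq_continuous_within continuous_at_imp_continuous_at_within)

text \<open>The expression bounded here is the drift of \<open>\<psi>\<close> along the difference of the two solutions.\<close>

lemma psi_drift:
  fixes z \<Gamma> :: real
  assumes F: "F \<le> sqrt c * (\<bar>y\<bar> + z)" and G: "\<Gamma>\<^sup>2 \<le> c * y\<^sup>2 + \<alpha> * z\<^sup>2" and c: "0 < c" and \<alpha>: "\<alpha> < 1"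
  shows "psi' y * F + psi'' y / 2 * (\<Gamma>\<^sup>2 - z\<^sup>2) \<le> (3 * sqrt c + c / (1 - \<alpha>) + 3 * c) * psi y"
proof (cases "psi'' y = 0")
  case True
  have "psi' y = 0" using psi_compare(3)[of y] True by simp
  moreover have "0 \<le> 3 * sqrt c + c / (1 - \<alpha>) + 3 * c" using c \<alpha> by simp
  ultimately show ?thesis using True psi_bounds(1)[of y] by simp
next
  case False
  then have p: "0 < psi'' y" using psi''_bounds(1)[of y] by simp
  \<comment> \<open>This is the coefficient of \<open>- z\<^sup>2\<close> that remains of the second
    order term after the Lipschitz bound on \<open>\<Gamma>\<close>. Young's inequality with exactly
    this weight absorbs the gradient term of the generator, and the factor \<open>psi''\<close>
    cancels in what is left over.\<close>
  define \<beta> where "\<beta> = (1 - \<alpha>) / 2 * psi'' y"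
  have \<beta>: "0 < \<beta>" using p \<alpha> by (simp add: \<beta>_def)
  have "psi' y * F \<le> psi' y * (sqrt c * (\<bar>y\<bar> + z))" by (rule mult_left_mono[OF F psi_bounds(3)])
  moreover have "psi' y * (sqrt c * (\<bar>y\<bar> + z)) = sqrt c * (psi' y * \<bar>y\<bar>) + psi' y * sqrt c * z"
    by (simp add: algebra_simps)
  moreover have "sqrt c * (psi' y * \<bar>y\<bar>) \<le> sqrt c * (3 * psi y)"
    by (rule mult_left_mono[OF psi_compare(1)]) (use c in simp)
  moreover have "psi' y * sqrt c * z \<le> \<beta> * z\<^sup>2 + (psi' y)\<^sup>2 * c / (4 * \<beta>)"
  proof -
    have "0 \<le> (2 * \<beta> * z - psi' y * sqrt c)\<^sup>2 / (4 * \<beta>)" using \<beta> by simp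
    also have "\<dots> = \<beta> * z\<^sup>2 + (psi' y)\<^sup>2 * c / (4 * \<beta>) - psi' y * sqrt c * z"
      using \<beta> c by (simp add: power2_diff power_mult_distrib field_simps) (simp add: power2_eq_square)
    finally show ?thesis by simp
  qed
  moreover have "(psi' y)\<^sup>2 * c / (4 * \<beta>) \<le> c / (1 - \<alpha>) * psi y"
  proof -
    have "(psi' y)\<^sup>2 * c / (4 * \<beta>) \<le> (2 * psi y * psi'' y) * c / (4 * \<beta>)"
      by (intro divide_right_mono mult_right_mono psi_compare(3)) (use c \<beta> in auto)
    also have "\<dots> = c / (1 - \<alpha>) * psi y" using p \<alpha> by (simp add: \<beta>_def)
    finally show ?thesis .
  qed
  moreover have "psi'' y / 2 * (\<Gamma>\<^sup>2 - z\<^sup>2) \<le> psi'' y / 2 * (c * y\<^sup>2 - (1 - \<alpha>) * z\<^sup>2)"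
    by (rule mult_left_mono) (use G p in \<open>auto simp: algebra_simps\<close>)
  moreover have "psi'' y / 2 * (c * y\<^sup>2 - (1 - \<alpha>) * z\<^sup>2) = c / 2 * (psi'' y * y\<^sup>2) - \<beta> * z\<^sup>2"
    by (simp add: \<beta>_def field_simps)
  moreover have "c / 2 * (psi'' y * y\<^sup>2) \<le> c / 2 * (6 * psi y)"
    by (rule mult_left_mono[OF psi_compare(2)]) (use c in simp)
  moreover have "(3 * sqrt c + c / (1 - \<alpha>) + 3 * c) * psi y = sqrt c * (3 * psi y) + c / (1 - \<alpha>) * psi y + c / 2 * (6 * psi y)"
    by (simp add: algebra_simps)
  ultimately show ?thesis by linarith
qed

section \<open>The one-step estimate\<close>

lemma (in pair_sigma_finite) AE_fst:
  assumes "AE x in M1. P x" shows "AE p in M1 \<Otimes>\<^sub>M M2. P (fst p)"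
proof -
  obtain N where N: "N \<in> null_sets M1" "{x\<in>space M1. \<not> P x} \<subseteq> N"
    using assms by (auto elim!: AE_E simp: null_sets_def)
  have "N \<times> space M2 \<in> null_sets (M1 \<Otimes>\<^sub>M M2)"
    using N(1) by (auto simp: null_sets_def M2.emeasure_pair_measure_Times)
  then show ?thesis
    by (rule AE_I') (use N(2) in \<open>auto simp: space_pair_measure\<close>)
qed

lemma (in pair_sigma_finite) AE_snd:
  assumes "AE x in M2. P x" shows "AE p in M1 \<Otimes>\<^sub>M M2. P (snd p)"
proof -
  obtain N where N: "N \<in> null_sets M2" "{x\<in>space M2. \<not> P x} \<subseteq> N"
    using assms by (auto elim!: AE_E simp: null_sets_def)
  have "space M1 \<times> N \<in> null_sets (M1 \<Otimes>\<^sub>M M2)"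
    using N(1) by (auto simp: null_sets_def M2.emeasure_pair_measure_Times)
  then show ?thesis
    by (rule AE_I') (use N(2) in \<open>auto simp: space_pair_measure\<close>)
qed

lemma integrable_indicator_interval:
  fixes p q :: real
  shows "integrable lborel (indicator {p..<q} :: real \<Rightarrow> real)" "integrable lborel (indicator {p..q} :: real \<Rightarrow> real)"
  by (cases "p \<le> q"; auto intro!: integrable_real_indicator)+

text \<open>The difference equation stripped of its coefficients: \<open>F\<close>,
  \<open>\<Gamma>\<close> and \<open>z\<close> are given functions on the product space,
  \<open>R\<close> dominates the squared paths, and the equation is required separately at each
  time, with versions of the integrals that may depend on it. The Lipschitz conditions enter only
  later, as a bound on the drift.\<close>

locale bdsde_difference = brownian_pair M S W B
  for M :: "'w measure" and S and W :: "real \<Rightarrow> 'w \<Rightarrow> real ^ 'd" and B :: "real \<Rightarrow> 'w \<Rightarrow> real ^ 'l" +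
  fixes T :: real and y :: "real \<Rightarrow> 'w \<Rightarrow> real" and F :: "'w \<times> real \<Rightarrow> real"
    and \<Gamma> :: "'w \<times> real \<Rightarrow> real ^ 'l" and z :: "'w \<times> real \<Rightarrow> real ^ 'd" and R \<xi> :: "'w \<Rightarrow> real"
  assumes T: "0 < T" "T \<le> S"
    and y_prog: "progressive M (bd_sigma M S W B) 0 T y"
    and y_cont: "AE \<omega> in M. continuous_on {0..T} (\<lambda>t. y t \<omega>)"
    and R: "integrable M R" "AE \<omega> in M. \<forall>t\<in>{0..T}. (y t \<omega>)\<^sup>2 \<le> R \<omega>"
    and F: "sq_int (M \<Otimes>\<^sub>M lborel) F" and \<Gamma>: "sq_int (M \<Otimes>\<^sub>M lborel) \<Gamma>" and z: "sq_int (M \<Otimes>\<^sub>M lborel) z"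
    and eq: "\<And>p. p \<in> {0..T} \<Longrightarrow> \<exists>I J. bwd.ito (- T) (- p) (\<lambda>x. indicator {p..T} (snd x) *\<^sub>R \<Gamma> x) I \<and>
      fwd.ito p T (\<lambda>x. indicator {p..T} (snd x) *\<^sub>R z x) J \<and>
      (AE \<omega> in M. y p \<omega> = \<xi> \<omega> + (\<integral>t. indicator {p..T} t * F (\<omega>, t) \<partial>lborel) + I \<omega> - J \<omega>)"
begin

abbreviation "NT \<equiv> M \<Otimes>\<^sub>M (lborel :: real measure)"

text \<open>Half-open in time, so that integrals over adjacent cells add up exactly.\<close>

definition dint :: "real \<Rightarrow> real \<Rightarrow> ('w \<times> real \<Rightarrow> real) \<Rightarrow> real" where
  "dint p q g = (\<integral>x. indicator {p..<q} (snd x) * g x \<partial>NT)"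

lemma window_measurable [measurable]: "(\<lambda>x. indicator {p..<q::real} (snd x) :: real) \<in> borel_measurable NT"
  "(\<lambda>x. indicator {p..q::real} (snd x) :: real) \<in> borel_measurable NT"
proof -
  have [measurable]: "{p..<q} \<in> sets borel" "{p..q} \<in> sets borel" by simp_all
  show "(\<lambda>x. indicator {p..<q::real} (snd x) :: real) \<in> borel_measurable NT"
    "(\<lambda>x. indicator {p..q::real} (snd x) :: real) \<in> borel_measurable NT" by measurable
qed

lemma integrable_window:
  fixes g :: "'w \<times> real \<Rightarrow> real"
  assumes "integrable NT g" shows "integrable NT (\<lambda>x. indicator {p..<q::real} (snd x) * g x)"
proof (rule Bochner_Integration.integrable_bound[OF assms])
  show "(\<lambda>x. indicator {p..<q::real} (snd x) * g x) \<in> borel_measurable NT"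
    using assms by measurable
qed (auto simp: indicator_def)

lemma sq_int_window:
  fixes g :: "'w \<times> real \<Rightarrow> 'b::euclidean_space"
  assumes "sq_int NT g" shows "sq_int NT (\<lambda>x. indicator {p..<q::real} (snd x) *\<^sub>R g x)"
  by (rule sq_int_scaleR_bounded[OF assms, where C=1]) (auto simp: indicator_def)

lemma sq_int_fst_window:
  fixes X :: "'w \<Rightarrow> real"
  assumes "sq_int M X" shows "sq_int NT (\<lambda>x. indicator {p..<q::real} (snd x) * X (fst x))"
proof (rule sq_int_bound)
  show "integrable NT (\<lambda>x. indicator {p..<q} (snd x) * (X (fst x))\<^sup>2)"
    by (rule fwd.integrable_time_product(1)) (use assms integrable_indicator_interval in \<open>auto simp: sq_int_def\<close>)
  have "X \<in> borel_measurable M" using assms by (rule sq_int_measurable)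
  then show "(\<lambda>x. indicator {p..<q} (snd x) * X (fst x)) \<in> borel_measurable NT" by measurable
qed (auto simp: indicator_def)

text \<open>The point at which the non-monotone family pays off: at each time its sigma-algebra is
  contained in both filtrations, so \<open>y p\<close> may serve as a left end value for
  \<open>W\<close> and as a right end value for \<open>B\<close>.\<close>

lemma y_meas:
  assumes "p \<in> {0..T}"
  shows "y p \<in> borel_measurable (HF p)" "y p \<in> borel_measurable (HB p)" "y p \<in> borel_measurable M"
proof -
  have m: "y p \<in> borel_measurable (bd_sigma M S W B p)" using y_prog assms by (simp add: progressive_def)
  have p: "0 \<le> p" "p \<le> S" using assms T by auto
  show 1: "y p \<in> borel_measurable (HF p)" and "y p \<in> borel_measurable (HB p)"
    by (rule measurable_mono_sigma[OF m], rule bd_subset[OF p], simp add: space_filtrations)+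
  show "y p \<in> borel_measurable M" by (rule fwd.H_measurable[OF p 1])
qed

lemma y_sq_int: "p \<in> {0..T} \<Longrightarrow> sq_int M (y p)"
  by (rule sq_int_bound[OF y_meas(3) R(1)]) (use R(2) in auto)

definition u :: "real \<Rightarrow> real" where "u p = (\<integral>\<omega>. psi (y p \<omega>) \<partial>M)"

lemma psi_y_integrable: "p \<in> {0..T} \<Longrightarrow> integrable M (\<lambda>\<omega>. psi (y p \<omega>))"
proof -
  assume p: "p \<in> {0..T}"
  note y_meas(3)[OF p, measurable]
  show "integrable M (\<lambda>\<omega>. psi (y p \<omega>))"
    by (rule Bochner_Integration.integrable_bound[OF sq_int_integrable[OF y_sq_int[OF p]]])
      (use psi_bounds in auto)
qed

definition A :: "real \<Rightarrow> real \<Rightarrow> 'w \<Rightarrow> real" where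
  "A p q \<omega> = (\<integral>t. indicator {p..<q} t * F (\<omega>, t) \<partial>lborel)"

lemma F_measurable [measurable]: "F \<in> borel_measurable NT"
  using F by (rule sq_int_measurable)

lemma F_slices: "AE \<omega> in M. sq_int lborel (\<lambda>t. F (\<omega>, t))"
proof -
  have "integrable NT (\<lambda>x. (norm (F x))\<^sup>2)" using F by (rule sq_int_integrable)
  from fwd.MT.AE_integrable_fst'[OF this] AE_space show ?thesis
  proof eventually_elim
    case (elim \<omega>)
    have "(\<lambda>t. F (\<omega>, t)) \<in> borel_measurable lborel"
      by (rule measurable_compose[OF measurable_Pair1'[OF elim(2)] F_measurable])
    then show ?case using elim(1) by (simp add: sq_int_def)
  qed
qed

lemma sq_int_indicator:
  fixes p q :: real
  shows "sq_int lborel (\<lambda>t. indicator {p..<q} t :: real)" "sq_int lborel (\<lambda>t. indicator {p..q} t :: real)"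
proof -
  have e: "(norm (indicator Q t :: real))\<^sup>2 = indicator Q t" for Q and t :: real by (simp add: indicator_def)
  show "sq_int lborel (\<lambda>t. indicator {p..<q} t :: real)" "sq_int lborel (\<lambda>t. indicator {p..q} t :: real)"
    unfolding sq_int_def e using integrable_indicator_interval borel_measurable_integrable by blast+
qed

text \<open>Cauchy-Schwarz in time yields the extra factor \<open>q - p\<close>. It makes
  \<open>A\<close> negligible at second order, although \<open>A\<close> is not adapted to either
  filtration at an end of the cell.\<close>

lemma A_sq_int: 
  assumes "p \<le> q"
  shows "sq_int M (A p q)" "(\<integral>\<omega>. (A p q \<omega>)\<^sup>2 \<partial>M) \<le> (q - p) * dint p q (\<lambda>x. (F x)\<^sup>2)"
proof -
  have mA: "A p q \<in> borel_measurable M"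
    unfolding A_def[abs_def] by (rule lborel.borel_measurable_lebesgue_integral) measurable
  have i: "integrable NT (\<lambda>x. indicator {p..<q} (snd x) * (F x)\<^sup>2)"
    by (rule integrable_window) (use F in \<open>simp add: sq_int_def\<close>)
  from fwd.MT.integrable_fst'[OF i] have i2: "integrable M (\<lambda>\<omega>. (q - p) * (\<integral>t. indicator {p..<q} t * (F (\<omega>, t))\<^sup>2 \<partial>lborel))"
    by simp
  have le: "AE \<omega> in M. (A p q \<omega>)\<^sup>2 \<le> (q - p) * (\<integral>t. indicator {p..<q} t * (F (\<omega>, t))\<^sup>2 \<partial>lborel)"
    using F_slices
  proof eventually_elim
    case (elim \<omega>)
    have s: "sq_int lborel (\<lambda>t. indicator {p..<q} t * F (\<omega>, t))"
      by (rule sq_int_mult_bounded[OF elim, where C=1]) (auto simp: indicator_def)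
    have "(A p q \<omega>)\<^sup>2 = (\<integral>t. indicator {p..<q} t \<bullet> (indicator {p..<q} t * F (\<omega>, t)) \<partial>lborel)\<^sup>2"
      unfolding A_def by (intro arg_cong[of _ _ "\<lambda>x. x\<^sup>2"] Bochner_Integration.integral_cong) (auto simp: indicator_def)
    also have "\<dots> \<le> (\<integral>t. (norm (indicator {p..<q} t :: real))\<^sup>2 \<partial>lborel) * (\<integral>t. (norm (indicator {p..<q} t * F (\<omega>, t)))\<^sup>2 \<partial>lborel)"
      by (rule integral_inner_Cauchy_Schwarz[OF sq_int_indicator(1) s])
    also have "(\<integral>t. (norm (indicator {p..<q} t :: real))\<^sup>2 \<partial>lborel) = (\<integral>t. indicator {p..<q} t \<partial>lborel)"
      by (intro Bochner_Integration.integral_cong) (auto simp: indicator_def)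
    also have "\<dots> = q - p" using assms by simp
    also have "(\<integral>t. (norm (indicator {p..<q} t * F (\<omega>, t)))\<^sup>2 \<partial>lborel) = (\<integral>t. indicator {p..<q} t * (F (\<omega>, t))\<^sup>2 \<partial>lborel)"
      by (intro Bochner_Integration.integral_cong) (auto simp: indicator_def)
    finally show ?case .
  qed
  show "sq_int M (A p q)" by (rule sq_int_bound[OF mA i2]) (use le in simp)
  then have "(\<integral>\<omega>. (A p q \<omega>)\<^sup>2 \<partial>M) \<le> (\<integral>\<omega>. (q - p) * (\<integral>t. indicator {p..<q} t * (F (\<omega>, t))\<^sup>2 \<partial>lborel) \<partial>M)"
    by (intro integral_mono_AE i2 le) (simp add: sq_int_def)
  also have "\<dots> = (q - p) * dint p q (\<lambda>x. (F x)\<^sup>2)"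
    unfolding dint_def using fwd.MT.integral_fst'[OF i] by simp
  finally show "(\<integral>\<omega>. (A p q \<omega>)\<^sup>2 \<partial>M) \<le> (q - p) * dint p q (\<lambda>x. (F x)\<^sup>2)" .
qed

lemma A_pair:
  assumes "sq_int M X"
  shows "(\<integral>\<omega>. X \<omega> * A p q \<omega> \<partial>M) = dint p q (\<lambda>x. X (fst x) * F x)"
    "integrable NT (\<lambda>x. indicator {p..<q} (snd x) * (X (fst x) * F x))"
proof -
  have e: "indicator {p..<q} (snd x) * (X (fst x) * F x) = (indicator {p..<q} (snd x) * X (fst x)) * F x" for x by simp
  show i: "integrable NT (\<lambda>x. indicator {p..<q} (snd x) * (X (fst x) * F x))"
    unfolding e by (rule sq_int_integrable_mult[OF sq_int_fst_window[OF assms] F])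
  have "dint p q (\<lambda>x. X (fst x) * F x) = (\<integral>\<omega>. (\<integral>t. indicator {p..<q} t * (X \<omega> * F (\<omega>, t)) \<partial>lborel) \<partial>M)"
    unfolding dint_def using fwd.MT.integral_fst'[OF i] by simp
  also have "\<dots> = (\<integral>\<omega>. X \<omega> * A p q \<omega> \<partial>M)"
    by (intro Bochner_Integration.integral_cong refl) (simp add: A_def mult.left_commute)
  finally show "(\<integral>\<omega>. X \<omega> * A p q \<omega> \<partial>M) = dint p q (\<lambda>x. X (fst x) * F x)" ..
qed

text \<open>Subtract the equations at \<open>p\<close> and \<open>q\<close>. The two integrals are
  treated differently because the equation is anchored at \<open>T\<close>. The forward integrals
  already start at \<open>p\<close> or later, so their difference is orthogonal to what is known at
  \<open>p\<close>. In reversed time both backward integrals start at \<open>- T\<close>, and only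
  splitting at \<open>- q\<close> gives orthogonality to what \<open>HB\<close> knows at
  \<open>q\<close>.\<close>

lemma step_decomposition:
  assumes pq: "0 \<le> p" "p \<le> q" "q \<le> T"
  shows "\<exists>G D. bwd.ito (- q) (- p) (\<lambda>x. indicator {p..<q} (snd x) *\<^sub>R \<Gamma> x) G \<and>
    fwd.ito p T (\<lambda>x. indicator {p..<q} (snd x) *\<^sub>R z x) D \<and>
    (AE \<omega> in M. y p \<omega> = y q \<omega> + A p q \<omega> + G \<omega> - D \<omega>)"
proof -
  have "p \<in> {0..T}" using pq by auto
  from eq[OF this] obtain I J where p: "bwd.ito (- T) (- p) (\<lambda>x. indicator {p..T} (snd x) *\<^sub>R \<Gamma> x) I"
      "fwd.ito p T (\<lambda>x. indicator {p..T} (snd x) *\<^sub>R z x) J"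
      "AE \<omega> in M. y p \<omega> = \<xi> \<omega> + (\<integral>t. indicator {p..T} t * F (\<omega>, t) \<partial>lborel) + I \<omega> - J \<omega>"
    by (elim exE conjE)
  have "q \<in> {0..T}" using pq by auto
  from eq[OF this] obtain I' J' where q: "bwd.ito (- T) (- q) (\<lambda>x. indicator {q..T} (snd x) *\<^sub>R \<Gamma> x) I'"
      "fwd.ito q T (\<lambda>x. indicator {q..T} (snd x) *\<^sub>R z x) J'"
      "AE \<omega> in M. y q \<omega> = \<xi> \<omega> + (\<integral>t. indicator {q..T} t * F (\<omega>, t) \<partial>lborel) + I' \<omega> - J' \<omega>"
    by (elim exE conjE)
  have w: "indicator {p..T} t - indicator {q..T} t = (indicator {p..<q} t :: real)" for t
    using pq by (auto simp: indicator_def)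
  have "bwd.ito (- q) (- p) (\<lambda>x. indicator {p..T} (snd x) *\<^sub>R \<Gamma> x - indicator {q..T} (snd x) *\<^sub>R \<Gamma> x) (\<lambda>\<omega>. I \<omega> - I' \<omega>)"
  proof (rule bwd.ito_split[OF _ _ _ _ p(1) q(1)])
    show "AE x in NT. indicator {q..T} (snd x) *\<^sub>R \<Gamma> x = indicator {..- q} (- 1 * snd x) *\<^sub>R indicator {p..T} (snd x) *\<^sub>R \<Gamma> x"
      using pq by (intro AE_I2) (auto simp: indicator_def)
  qed (use pq T in auto)
  then have 1: "bwd.ito (- q) (- p) (\<lambda>x. indicator {p..<q} (snd x) *\<^sub>R \<Gamma> x) (\<lambda>\<omega>. I \<omega> - I' \<omega>)"
    by (simp only: w flip: scaleR_diff_left)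
  have "fwd.ito p T (\<lambda>x. indicator {p..T} (snd x) *\<^sub>R z x - indicator {q..T} (snd x) *\<^sub>R z x) (\<lambda>\<omega>. J \<omega> - J' \<omega>)"
    by (rule fwd.ito_diff[OF _ _ _ p(2) fwd.ito_mono[OF q(2)]]) (use pq T in auto)
  then have 2: "fwd.ito p T (\<lambda>x. indicator {p..<q} (snd x) *\<^sub>R z x) (\<lambda>\<omega>. J \<omega> - J' \<omega>)"
    by (simp only: w flip: scaleR_diff_left)
  have 3: "AE \<omega> in M. y p \<omega> = y q \<omega> + A p q \<omega> + (I \<omega> - I' \<omega>) - (J \<omega> - J' \<omega>)"
    using p(3) q(3) F_slices
  proof eventually_elim
    case (elim \<omega>)
    have "A p q \<omega> = (\<integral>t. indicator {p..T} t * F (\<omega>, t) - indicator {q..T} t * F (\<omega>, t) \<partial>lborel)"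
      unfolding A_def by (intro Bochner_Integration.integral_cong refl) (simp only: w flip: left_diff_distrib)
    also have "\<dots> = (\<integral>t. indicator {p..T} t * F (\<omega>, t) \<partial>lborel) - (\<integral>t. indicator {q..T} t * F (\<omega>, t) \<partial>lborel)"
      by (intro Bochner_Integration.integral_diff sq_int_integrable_mult sq_int_indicator elim(3))
    finally show ?case using elim(1,2) by simp
  qed
  show ?thesis using 1 2 3 by blast
qed

end

context bm_filtration
begin

text \<open>A bounded weight known at \<open>a\<close> passes through the integral, so this is the
  isometry of \<open>\<phi> X\<close> against \<open>X\<close>. It evaluates the second order Taylor
  terms exactly.\<close>

lemma ito_weighted_norm:
  assumes "ito a b P X" "bdd_rv a \<phi>" "lo \<le> a" "a \<le> b" "b \<le> hi"
  shows "(\<integral>\<omega>. \<phi> \<omega> * (X \<omega>)\<^sup>2 \<partial>M) = (\<integral>x. \<phi> (fst x) * (norm (P x))\<^sup>2 \<partial>MT)"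
  using ito_isometry[OF assms(3,5) ito_scaleR[OF assms(3,5,1,2,4)] assms(1,3,5)]
  by (simp add: power2_eq_square mult.assoc flip: power2_norm_eq_inner)

lemma ito_residual:
  assumes "ito p b P X" "bdd_rv p \<eta>" "lo \<le> p" "p \<le> q" "q \<le> b" "b \<le> hi"
  shows "(\<integral>\<omega>. (X \<omega> - \<eta> \<omega> \<bullet> incr p q \<omega>)\<^sup>2 \<partial>M) = (\<integral>x. (norm (P x - win p q x *\<^sub>R \<eta> (fst x)))\<^sup>2 \<partial>MT)"
proof -
  have "elem p b (\<lambda>x. win p q x *\<^sub>R \<eta> (fst x)) (\<lambda>\<omega>. \<eta> \<omega> \<bullet> incr p q \<omega>)"
    by (rule elem_base[OF order_refl assms(4,5,2)])
  from elem_ito[OF assms(3,6) this]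
  have "ito p b (\<lambda>x. P x - win p q x *\<^sub>R \<eta> (fst x)) (\<lambda>\<omega>. X \<omega> - \<eta> \<omega> \<bullet> incr p q \<omega>)"
    using ito_diff[OF assms(3,6) _ assms(1)] assms(4,5) by auto
  from ito_norm[OF assms(3,6) this] show ?thesis .
qed

lemma bdd_incr_moments:
  assumes rs: "lo \<le> r" "r \<le> s" "s \<le> hi" and \<eta>: "bdd_rv r \<eta>" "\<forall>\<omega>\<in>space M. norm (\<eta> \<omega>) \<le> K"
  shows "(\<integral>\<omega>. (\<eta> \<omega> \<bullet> incr r s \<omega>)\<^sup>2 \<partial>M) \<le> K\<^sup>2 * (real CARD('n) * (s - r))"
    "integrable M (\<lambda>\<omega>. (\<eta> \<omega> \<bullet> incr r s \<omega>) ^ 4)"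
    "(\<integral>\<omega>. (\<eta> \<omega> \<bullet> incr r s \<omega>) ^ 4 \<partial>M) \<le> K ^ 4 * (3 * (real CARD('n))\<^sup>2 * (s - r)\<^sup>2)"
proof -
  have le: "\<bar>\<eta> \<omega> \<bullet> incr r s \<omega>\<bar> \<le> K * norm (incr r s \<omega>)" if "\<omega> \<in> space M" for \<omega>
    using \<eta>(2) that by (intro order_trans[OF Cauchy_Schwarz_ineq2] mult_right_mono) auto
  have le2: "(\<eta> \<omega> \<bullet> incr r s \<omega>)\<^sup>2 \<le> K\<^sup>2 * (norm (incr r s \<omega>))\<^sup>2" if "\<omega> \<in> space M" for \<omega>
    using power_mono[OF le[OF that], of 2] by (simp add: power_mult_distrib)
  have le4: "(\<eta> \<omega> \<bullet> incr r s \<omega>) ^ 4 \<le> K ^ 4 * norm (incr r s \<omega>) ^ 4" if "\<omega> \<in> space M" for \<omega>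
    using power_mono[OF le[OF that], of 4] by (simp add: power_mult_distrib power_even_abs_numeral)
  note sq = sq_int_bdd_incr[OF rs \<eta>(1)]
  have "(\<integral>\<omega>. (\<eta> \<omega> \<bullet> incr r s \<omega>)\<^sup>2 \<partial>M) \<le> (\<integral>\<omega>. K\<^sup>2 * (norm (incr r s \<omega>))\<^sup>2 \<partial>M)"
    by (intro integral_mono le2) (use sq incr_norm2[OF rs] in \<open>auto simp: sq_int_def\<close>)
  then show "(\<integral>\<omega>. (\<eta> \<omega> \<bullet> incr r s \<omega>)\<^sup>2 \<partial>M) \<le> K\<^sup>2 * (real CARD('n) * (s - r))"
    using incr_norm2[OF rs] by simp
  have i: "integrable M (\<lambda>\<omega>. K ^ 4 * norm (incr r s \<omega>) ^ 4)" using incr_norm4[OF rs] by simp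
  have m: "(\<lambda>\<omega>. (\<eta> \<omega> \<bullet> incr r s \<omega>) ^ 4) \<in> borel_measurable M"
    using sq_int_measurable[OF sq] by measurable
  show I: "integrable M (\<lambda>\<omega>. (\<eta> \<omega> \<bullet> incr r s \<omega>) ^ 4)"
    by (rule Bochner_Integration.integrable_bound[OF i m]) (use le4 in \<open>auto simp: abs_mult\<close>)
  have "(\<integral>\<omega>. (\<eta> \<omega> \<bullet> incr r s \<omega>) ^ 4 \<partial>M) \<le> (\<integral>\<omega>. K ^ 4 * norm (incr r s \<omega>) ^ 4 \<partial>M)"
    by (intro integral_mono I i le4)
  also have "\<dots> \<le> K ^ 4 * (3 * (real CARD('n))\<^sup>2 * (s - r)\<^sup>2)"
    using incr_norm4[OF rs] by (simp add: mult_left_mono)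
  finally show "(\<integral>\<omega>. (\<eta> \<omega> \<bullet> incr r s \<omega>) ^ 4 \<partial>M) \<le> K ^ 4 * (3 * (real CARD('n))\<^sup>2 * (s - r)\<^sup>2)" .
qed

end

text \<open>Here \<open>h\<close> is a stochastic increment with second moments only and
  \<open>w\<close> an approximation with fourth moments. If \<open>w\<close> dominates the error,
  then \<open>\<bar>h\<bar> \<le> 2 * \<bar>w\<bar>\<close>, and the cubic bound is split by
  \<open>2 * \<bar>w\<bar> ^ 3 \<le> l * w\<^sup>2 + w ^ 4 / l\<close>; otherwise the quadratic
  bound charges everything to the error. The weight \<open>l\<close> stays free, to be adapted to
  the mesh.\<close>

lemma remainder_split:
  fixes h w l :: real
  assumes "0 < l"
  shows "min (h\<^sup>2) (3 * \<bar>h\<bar> ^ 3) \<le> 12 * (l * w\<^sup>2 + w ^ 4 / l) + 4 * (h - w)\<^sup>2"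
proof (cases "\<bar>h - w\<bar> \<le> \<bar>w\<bar>")
  case True
  have "0 \<le> w\<^sup>2 * (l - \<bar>w\<bar>)\<^sup>2 / l" using assms by simp
  also have "\<dots> = l * w\<^sup>2 + w ^ 4 / l - 2 * \<bar>w\<bar> ^ 3"
  proof -
    have "a\<^sup>2 * (l - a)\<^sup>2 / l = l * a\<^sup>2 + a ^ 4 / l - 2 * a ^ 3" for a :: real
      using assms by (simp add: field_simps power2_eq_square power3_eq_cube power4_eq_xxxx)
    from this[of "\<bar>w\<bar>"] show ?thesis by (simp add: power_even_abs_numeral)
  qed
  finally have 1: "2 * \<bar>w\<bar> ^ 3 \<le> l * w\<^sup>2 + w ^ 4 / l" by simp
  have "\<bar>h\<bar> \<le> 2 * \<bar>w\<bar>" using True by linarith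
  then have "\<bar>h\<bar> ^ 3 \<le> (2 * \<bar>w\<bar>) ^ 3" by (intro power_mono) auto
  then have "3 * \<bar>h\<bar> ^ 3 \<le> 12 * (2 * \<bar>w\<bar> ^ 3)" by (simp add: power_mult_distrib)
  also have "\<dots> \<le> 12 * (l * w\<^sup>2 + w ^ 4 / l)" by (rule mult_left_mono[OF 1]) simp
  finally have "3 * \<bar>h\<bar> ^ 3 \<le> 12 * (l * w\<^sup>2 + w ^ 4 / l)" .
  moreover have "0 \<le> 4 * (h - w)\<^sup>2" by simp
  ultimately show ?thesis by linarith
next
  case False
  moreover have "\<bar>h\<bar> \<le> \<bar>h - w\<bar> + \<bar>w\<bar>" using abs_triangle_ineq[of "h - w" w] by simp
  ultimately have "\<bar>h\<bar> \<le> 2 * \<bar>h - w\<bar>" by (simp add: not_le)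
  then have "\<bar>h\<bar>\<^sup>2 \<le> (2 * \<bar>h - w\<bar>)\<^sup>2" by (intro power_mono) auto
  then have "h\<^sup>2 \<le> 4 * (h - w)\<^sup>2" by (simp add: power_mult_distrib)
  moreover have "0 \<le> 12 * (l * w\<^sup>2 + w ^ 4 / l)" using assms by simp
  ultimately show ?thesis by linarith
qed

text \<open>
  Expanding \<open>\<psi>\<close> at \<open>b\<close> along \<open>A + G\<close> and at \<open>a\<close> along \<open>D\<close>, where \<open>a + D = b + A + G\<close>, pairs
  each stochastic increment with the end point that is measurable for its own filtration; no
  mixed term in \<open>G\<close> and \<open>D\<close> appears.
\<close>

lemma psi_step:
  assumes a: "a = b + A + G - D" and l: "0 < l"
  shows "psi a - psi b \<le> psi' b * A + psi' b * G - psi' a * D + psi'' b / 2 * G\<^sup>2 - psi'' a / 2 * D\<^sup>2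
    + (9 + 1 / l) * A\<^sup>2 + l * G\<^sup>2 + 12 * l * (w\<^sup>2 + w'\<^sup>2) + 12 / l * (w ^ 4 + w' ^ 4) + 4 * (D - w)\<^sup>2 + 8 * (G - w')\<^sup>2"
proof -
  let ?u = "A + G"
  have e: "a + D = b + ?u" using a by simp
  have 1: "psi (b + ?u) - psi b - psi' b * ?u - psi'' b / 2 * ?u\<^sup>2 \<le> min (?u\<^sup>2) (3 * \<bar>?u\<bar> ^ 3)"
    using psi_Taylor[of b ?u] by linarith
  have 2: "- (psi (a + D) - psi a - psi' a * D - psi'' a / 2 * D\<^sup>2) \<le> min (D\<^sup>2) (3 * \<bar>D\<bar> ^ 3)"
    using psi_Taylor[of a D] by linarith
  have r1: "min (?u\<^sup>2) (3 * \<bar>?u\<bar> ^ 3) \<le> 12 * (l * w'\<^sup>2 + w' ^ 4 / l) + 4 * (?u - w')\<^sup>2" by (rule remainder_split[OF l])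
  have r2: "min (D\<^sup>2) (3 * \<bar>D\<bar> ^ 3) \<le> 12 * (l * w\<^sup>2 + w ^ 4 / l) + 4 * (D - w)\<^sup>2" by (rule remainder_split[OF l])
  \<comment> \<open>The approximation \<open>w'\<close> is for \<open>G\<close> alone, so the drift
    part is split off here. Its 8 squares and the one from the next estimate make up the coefficient
    9.\<close>
  have r3: "4 * (?u - w')\<^sup>2 \<le> 8 * A\<^sup>2 + 8 * (G - w')\<^sup>2"
    using power2_norm_add_le[of A "G - w'"] by (simp add: add_diff_eq)
  \<comment> \<open>The cross term \<open>2 * (A * G)\<close> is divided with weight
    \<open>l\<close>: \<open>G\<close> gets the small factor, and \<open>A\<close> can afford
    \<open>1 / l\<close>.\<close>
  have q: "psi'' b / 2 * ?u\<^sup>2 \<le> psi'' b / 2 * G\<^sup>2 + A\<^sup>2 + (A\<^sup>2 / l + l * G\<^sup>2)"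
  proof -
    have "2 * (A * G) \<le> A\<^sup>2 / l + l * G\<^sup>2"
    proof -
      have "0 \<le> (A - l * G)\<^sup>2 / l" using l by simp
      also have "\<dots> = A\<^sup>2 / l + l * G\<^sup>2 - 2 * (A * G)" using l by (simp add: field_simps power2_eq_square)
      finally show ?thesis by simp
    qed
    moreover have "0 \<le> A\<^sup>2 / l + l * G\<^sup>2" using l by simp
    ultimately have "psi'' b / 2 * (A\<^sup>2 + 2 * (A * G)) \<le> psi'' b / 2 * (A\<^sup>2 + (A\<^sup>2 / l + l * G\<^sup>2))"
      using psi''_bounds[of b] by (intro mult_left_mono) auto
    also have "\<dots> \<le> 1 * (A\<^sup>2 + (A\<^sup>2 / l + l * G\<^sup>2))"
      using psi''_bounds[of b] l by (intro mult_right_mono) auto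
    finally have "psi'' b / 2 * (A\<^sup>2 + 2 * (A * G)) \<le> A\<^sup>2 + (A\<^sup>2 / l + l * G\<^sup>2)" by simp
    moreover have "psi'' b / 2 * ?u\<^sup>2 = psi'' b / 2 * G\<^sup>2 + psi'' b / 2 * (A\<^sup>2 + 2 * (A * G))"
      by (simp add: power2_sum algebra_simps add_divide_distrib)
    ultimately show ?thesis by linarith
  qed
  have d: "psi' b * ?u = psi' b * A + psi' b * G" by (rule distrib_left)
  have m: "(9 + 1 / l) * A\<^sup>2 = 9 * A\<^sup>2 + A\<^sup>2 / l" "12 * l * (w\<^sup>2 + w'\<^sup>2) = 12 * (l * w\<^sup>2) + 12 * (l * w'\<^sup>2)"
    "12 / l * (w ^ 4 + w' ^ 4) = 12 * (w ^ 4 / l) + 12 * (w' ^ 4 / l)"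
    by (simp_all add: distrib_left distrib_right add_divide_distrib)
  have s1: "psi (b + ?u) - psi b - (psi' b * A + psi' b * G) - psi'' b / 2 * ?u\<^sup>2
      \<le> 12 * (l * w'\<^sup>2) + 12 * (w' ^ 4 / l) + 4 * (?u - w')\<^sup>2"
    using order_trans[OF 1 r1] by (simp only: d distrib_left)
  have s2: "- (psi (b + ?u) - psi a - psi' a * D - psi'' a / 2 * D\<^sup>2)
      \<le> 12 * (l * w\<^sup>2) + 12 * (w ^ 4 / l) + 4 * (D - w)\<^sup>2"
    using order_trans[OF 2 r2] by (simp only: e distrib_left)
  show ?thesis using s1 s2 r3 q unfolding m by linarith
qed

context bdsde_difference
begin

lemma psi'_y_sq_int: "p \<in> {0..T} \<Longrightarrow> sq_int M (\<lambda>\<omega>. psi' (y p \<omega>))"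
proof -
  assume p: "p \<in> {0..T}"
  note y_meas(3)[OF p, measurable]
  have i: "integrable M (\<lambda>\<omega>. 4 * (y p \<omega>)\<^sup>2)" using y_sq_int[OF p] by (simp add: sq_int_def)
  have "(psi' v)\<^sup>2 \<le> 4 * v\<^sup>2" for v
    using power_mono[OF psi_bounds(4,3)[of v], of 2] by (simp add: power_mult_distrib)
  then show ?thesis by (intro sq_int_bound[OF _ i]) auto
qed

lemma psi''_y_bdd:
  assumes "p \<in> {0..T}"
  shows "fwd.bdd_rv p (\<lambda>\<omega>. psi'' (y p \<omega>) / 2)" "bwd.bdd_rv (- p) (\<lambda>\<omega>. psi'' (y p \<omega>) / 2)"
proof -
  have "- 2 \<le> psi'' v" for v using psi''_bounds(1)[of v] by linarith
  then have b: "bounded ((\<lambda>\<omega>. psi'' (y p \<omega>) / 2) ` space M)"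
    using psi''_bounds by (intro boundedI[where B=1]) (auto simp: abs_le_iff)
  have "(\<lambda>\<omega>. psi'' (y p \<omega>) / 2) \<in> borel_measurable (HF p)" "(\<lambda>\<omega>. psi'' (y p \<omega>) / 2) \<in> borel_measurable (HB p)"
    using y_meas(1,2)[OF assms] by measurable
  then show "fwd.bdd_rv p (\<lambda>\<omega>. psi'' (y p \<omega>) / 2)" "bwd.bdd_rv (- p) (\<lambda>\<omega>. psi'' (y p \<omega>) / 2)"
    using b by (simp_all add: fwd.bdd_rv_def bwd.bdd_rv_def)
qed

lemma dint_norm:
  fixes g :: "'w \<times> real \<Rightarrow> 'b::euclidean_space"
  shows "(\<integral>x. c x * (norm (indicator {p..<q::real} (snd x) *\<^sub>R g x))\<^sup>2 \<partial>NT) = dint p q (\<lambda>x. c x * (norm (g x))\<^sup>2)"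
  unfolding dint_def by (intro Bochner_Integration.integral_cong refl) (auto simp: indicator_def)

text \<open>The expectation of \<open>psi_step\<close> with \<open>w\<close> and \<open>w'\<close>
  the elementary increments with coefficients \<open>\<eta>\<close> and \<open>\<gamma>\<close>.
  First order terms vanish by orthogonality, second order terms are exact by the weighted isometry,
  and the residuals are exact squared distances of integrands. Only the terms in \<open>A\<close>,
  \<open>w\<close> and \<open>w'\<close> are estimated.\<close>

lemma one_step:
  fixes L :: "'w \<times> real \<Rightarrow> real ^ 'd" and L' :: "'w \<times> real \<Rightarrow> real ^ 'l"
  defines "N1 \<equiv> real CARD('d)" and "N2 \<equiv> real CARD('l)"
  assumes pq: "0 \<le> p" "p < q" "q \<le> T" and l: "0 < l"
    and \<eta>: "fwd.bdd_rv p \<eta>" "\<forall>\<omega>\<in>space M. norm (\<eta> \<omega>) \<le> K"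
    and \<gamma>: "bwd.bdd_rv (- q) \<gamma>" "\<forall>\<omega>\<in>space M. norm (\<gamma> \<omega>) \<le> K"
    and L: "\<forall>x. fst x \<in> space M \<longrightarrow> snd x \<in> {p<..<q} \<longrightarrow> L x = \<eta> (fst x)" "sq_int NT L"
    and L': "\<forall>x. fst x \<in> space M \<longrightarrow> snd x \<in> {p<..<q} \<longrightarrow> L' x = \<gamma> (fst x)" "sq_int NT L'"
  shows "u p - u q \<le> dint p q (\<lambda>x. psi' (y q (fst x)) * F x)
      + dint p q (\<lambda>x. psi'' (y q (fst x)) / 2 * (norm (\<Gamma> x))\<^sup>2) - dint p q (\<lambda>x. psi'' (y p (fst x)) / 2 * (norm (z x))\<^sup>2)
    + (9 + 1 / l) * ((q - p) * dint p q (\<lambda>x. (F x)\<^sup>2)) + l * dint p q (\<lambda>x. (norm (\<Gamma> x))\<^sup>2)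
    + 12 * l * (K\<^sup>2 * (N1 * (q - p)) + K\<^sup>2 * (N2 * (q - p)))
    + 12 / l * (K ^ 4 * (3 * N1\<^sup>2 * (q - p)\<^sup>2) + K ^ 4 * (3 * N2\<^sup>2 * (q - p)\<^sup>2))
    + 4 * dint p q (\<lambda>x. (norm (z x - L x))\<^sup>2) + 8 * dint p q (\<lambda>x. (norm (\<Gamma> x - L' x))\<^sup>2)"
proof -
  have pT: "p \<in> {0..T}" "q \<in> {0..T}" "p \<le> q" "q \<le> S" "p \<le> T" "p \<le> S" using pq T by auto
  have mS: "- S \<le> - q" "- q \<le> - p" "- p \<le> 0" using pq pT by auto
  obtain G D where G: "bwd.ito (- q) (- p) (\<lambda>x. indicator {p..<q} (snd x) *\<^sub>R \<Gamma> x) G"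
    and D: "fwd.ito p T (\<lambda>x. indicator {p..<q} (snd x) *\<^sub>R z x) D"
    and yeq: "AE \<omega> in M. y p \<omega> = y q \<omega> + A p q \<omega> + G \<omega> - D \<omega>"
    using step_decomposition[OF pq(1) pT(3) pq(3)] by (elim exE conjE)
  define w where "w \<omega> = \<eta> \<omega> \<bullet> fwd.incr p q \<omega>" for \<omega>
  define w' where "w' \<omega> = \<gamma> \<omega> \<bullet> bwd.incr (- q) (- p) \<omega>" for \<omega>
  note A = A_sq_int[OF pT(3)]
  have Gs: "sq_int M G" by (rule bwd.ito_sq_int(2)[OF mS(1,3) G])
  have Ds: "sq_int M D" by (rule fwd.ito_sq_int(2)[OF pq(1) T(2) D])
  have ws: "sq_int M w" unfolding w_def[abs_def] by (rule fwd.sq_int_bdd_incr[OF pq(1) pT(3,4) \<eta>(1)])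
  have w's: "sq_int M w'" unfolding w'_def[abs_def] by (rule bwd.sq_int_bdd_incr[OF mS \<gamma>(1)])
  note wm = fwd.bdd_incr_moments[OF pq(1) pT(3,4) \<eta>, folded w_def N1_def]
  note w'm = bwd.bdd_incr_moments[OF mS \<gamma>, folded w'_def N2_def]
  note Ps = psi'_y_sq_int[OF pT(1)] psi'_y_sq_int[OF pT(2)]
  note [measurable] = y_meas(3)[OF pT(1)] y_meas(3)[OF pT(2)] sq_int_measurable[OF Gs] sq_int_measurable[OF Ds]
  have i2: "integrable M (\<lambda>\<omega>. psi'' (y r \<omega>) / 2 * (X \<omega>)\<^sup>2)" if "sq_int M X" "r \<in> {0..T}" for r X
  proof (rule Bochner_Integration.integrable_bound)
    show "integrable M (\<lambda>\<omega>. (X \<omega>)\<^sup>2)" using that by (simp add: sq_int_def)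
    note [measurable] = y_meas(3)[OF that(2)] sq_int_measurable[OF that(1)]
    show "(\<lambda>\<omega>. psi'' (y r \<omega>) / 2 * (X \<omega>)\<^sup>2) \<in> borel_measurable M" by measurable
    have "psi'' v * s \<le> s * 2" if "0 \<le> s" for v s
      using mult_right_mono[OF psi''_bounds(2)[of v] that] by simp
    then show "AE \<omega> in M. norm (psi'' (y r \<omega>) / 2 * (X \<omega>)\<^sup>2) \<le> norm ((X \<omega>)\<^sup>2)"
      using psi''_bounds by (intro AE_I2) (auto simp: abs_mult)
  qed
  have sqi: "integrable M (\<lambda>\<omega>. (X \<omega>)\<^sup>2)" if "sq_int M X" for X :: "'w \<Rightarrow> real"
    using that by (simp add: sq_int_def)
  note ii = sq_int_integrable_mult[OF Ps(2) A(1)] sq_int_integrable_mult[OF Ps(2) Gs] sq_int_integrable_mult[OF Ps(1) Ds]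
    i2[OF Gs pT(2)] i2[OF Ds pT(1)] sqi[OF A(1)] sqi[OF Gs] sqi[OF ws] sqi[OF w's] wm(2) w'm(2)
    sqi[OF sq_int_diff[OF Ds ws]] sqi[OF sq_int_diff[OF Gs w's]]
  let ?rhs = "\<lambda>\<omega>. psi' (y q \<omega>) * A p q \<omega> + psi' (y q \<omega>) * G \<omega> - psi' (y p \<omega>) * D \<omega> + psi'' (y q \<omega>) / 2 * (G \<omega>)\<^sup>2
    - psi'' (y p \<omega>) / 2 * (D \<omega>)\<^sup>2 + (9 + 1 / l) * (A p q \<omega>)\<^sup>2 + l * (G \<omega>)\<^sup>2 + 12 * l * ((w \<omega>)\<^sup>2 + (w' \<omega>)\<^sup>2)
    + 12 / l * ((w \<omega>) ^ 4 + (w' \<omega>) ^ 4) + 4 * (D \<omega> - w \<omega>)\<^sup>2 + 8 * (G \<omega> - w' \<omega>)\<^sup>2"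
  have iq: "integrable M (\<lambda>\<omega>. psi (y p \<omega>))" "integrable M (\<lambda>\<omega>. psi (y q \<omega>))"
    using psi_y_integrable pT by auto
  have "u p - u q = (\<integral>\<omega>. psi (y p \<omega>) - psi (y q \<omega>) \<partial>M)"
    unfolding u_def using iq by simp
  also have "\<dots> \<le> (\<integral>\<omega>. ?rhs \<omega> \<partial>M)"
  proof (rule integral_mono_AE)
    show "integrable M (\<lambda>\<omega>. psi (y p \<omega>) - psi (y q \<omega>))" using iq by simp
    show "integrable M ?rhs"
      by (intro Bochner_Integration.integrable_add Bochner_Integration.integrable_diff integrable_mult_right ii)
    show "AE \<omega> in M. psi (y p \<omega>) - psi (y q \<omega>) \<le> ?rhs \<omega>"
      using yeq by eventually_elim (rule psi_step[OF _ l])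
  qed
  also have "\<dots> = (\<integral>\<omega>. psi' (y q \<omega>) * A p q \<omega> \<partial>M) + (\<integral>\<omega>. psi' (y q \<omega>) * G \<omega> \<partial>M) - (\<integral>\<omega>. psi' (y p \<omega>) * D \<omega> \<partial>M)
    + (\<integral>\<omega>. psi'' (y q \<omega>) / 2 * (G \<omega>)\<^sup>2 \<partial>M) - (\<integral>\<omega>. psi'' (y p \<omega>) / 2 * (D \<omega>)\<^sup>2 \<partial>M) + (9 + 1 / l) * (\<integral>\<omega>. (A p q \<omega>)\<^sup>2 \<partial>M)
    + l * (\<integral>\<omega>. (G \<omega>)\<^sup>2 \<partial>M) + 12 * l * ((\<integral>\<omega>. (w \<omega>)\<^sup>2 \<partial>M) + (\<integral>\<omega>. (w' \<omega>)\<^sup>2 \<partial>M))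
    + 12 / l * ((\<integral>\<omega>. (w \<omega>) ^ 4 \<partial>M) + (\<integral>\<omega>. (w' \<omega>) ^ 4 \<partial>M)) + 4 * (\<integral>\<omega>. (D \<omega> - w \<omega>)\<^sup>2 \<partial>M) + 8 * (\<integral>\<omega>. (G \<omega> - w' \<omega>)\<^sup>2 \<partial>M)"
  proof -
    note int_add = Bochner_Integration.integral_add and int_diff = Bochner_Integration.integral_diff
    note I = Bochner_Integration.integrable_add Bochner_Integration.integrable_diff integrable_mult_right ii
    show ?thesis
      by (subst int_add int_diff, (intro I)+)+ (simp only: integral_mult_right_zero int_add[OF ii(8,9)] int_add[OF ii(10,11)])
  qed
  also have "(\<integral>\<omega>. psi' (y q \<omega>) * A p q \<omega> \<partial>M) = dint p q (\<lambda>x. psi' (y q (fst x)) * F x)"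
    by (rule A_pair(1)[OF Ps(2)])
  also have "(\<integral>\<omega>. psi' (y q \<omega>) * G \<omega> \<partial>M) = 0"
    by (rule bwd.ito_orthogonal[OF mS(1,3) G _ Ps(2)]) (use y_meas(2)[OF pT(2)] in simp)
  also have "(\<integral>\<omega>. psi' (y p \<omega>) * D \<omega> \<partial>M) = 0"
    by (rule fwd.ito_orthogonal[OF pq(1) T(2) D _ Ps(1)]) (use y_meas(1)[OF pT(1)] in simp)
  also have "(\<integral>\<omega>. psi'' (y q \<omega>) / 2 * (G \<omega>)\<^sup>2 \<partial>M) = dint p q (\<lambda>x. psi'' (y q (fst x)) / 2 * (norm (\<Gamma> x))\<^sup>2)"
    unfolding bwd.ito_weighted_norm[OF G psi''_y_bdd(2)[OF pT(2)] mS] by (rule dint_norm)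
  also have "(\<integral>\<omega>. psi'' (y p \<omega>) / 2 * (D \<omega>)\<^sup>2 \<partial>M) = dint p q (\<lambda>x. psi'' (y p (fst x)) / 2 * (norm (z x))\<^sup>2)"
    unfolding fwd.ito_weighted_norm[OF D psi''_y_bdd(1)[OF pT(1)] pq(1) pT(5) T(2)] by (rule dint_norm)
  also have "(\<integral>\<omega>. (G \<omega>)\<^sup>2 \<partial>M) = dint p q (\<lambda>x. (norm (\<Gamma> x))\<^sup>2)"
    unfolding bwd.ito_norm[OF mS(1,3) G] using dint_norm[of "\<lambda>_. 1" p q \<Gamma>] by simp
  also have "(\<integral>\<omega>. (D \<omega> - w \<omega>)\<^sup>2 \<partial>M) = dint p q (\<lambda>x. (norm (z x - L x))\<^sup>2)"
  proof -
    have "(\<integral>\<omega>. (D \<omega> - w \<omega>)\<^sup>2 \<partial>M) = (\<integral>x. (norm (indicator {p..<q} (snd x) *\<^sub>R z x - fwd.win p q x *\<^sub>R \<eta> (fst x)))\<^sup>2 \<partial>NT)"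
      unfolding w_def by (rule fwd.ito_residual[OF D \<eta>(1) pq(1) pT(3) pq(3) T(2)])
    also have "\<dots> = (\<integral>x. (norm (indicator {p..<q} (snd x) *\<^sub>R (z x - L x)))\<^sup>2 \<partial>NT)"
    proof (rule integral_cong_AE)
      show "(\<lambda>x. (norm (indicator {p..<q} (snd x) *\<^sub>R (z x - L x)))\<^sup>2) \<in> borel_measurable NT"
        using sq_int_measurable[OF sq_int_window[OF sq_int_diff[OF z L(2)]]] by measurable
      have "(\<lambda>x. indicator {p..<q} (snd x) *\<^sub>R z x - fwd.win p q x *\<^sub>R \<eta> (fst x)) \<in> borel_measurable NT"
        using sq_int_measurable[OF sq_int_window[OF z]] fwd.bdd_rv_measurable[OF pq(1) pT(6) \<eta>(1)] by measurable
      then show "(\<lambda>x. (norm (indicator {p..<q} (snd x) *\<^sub>R z x - fwd.win p q x *\<^sub>R \<eta> (fst x)))\<^sup>2) \<in> borel_measurable NT"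
        by measurable
      \<comment> \<open>Three conventions meet: the half-open \<open>{p..<q}\<close>, the forward
        window \<open>{p<..q}\<close>, and the open interval on which \<open>L\<close> is known.
        They differ at the two end points only.\<close>
      have "AE x in NT. snd x \<noteq> p" "AE x in NT. snd x \<noteq> q"
        by (rule fwd.MT.AE_snd, rule AE_lborel_singleton)+
      then show "AE x in NT. (norm (indicator {p..<q} (snd x) *\<^sub>R z x - fwd.win p q x *\<^sub>R \<eta> (fst x)))\<^sup>2
          = (norm (indicator {p..<q} (snd x) *\<^sub>R (z x - L x)))\<^sup>2"
        using AE_space
      proof eventually_elim
        case (elim x)
        then show ?case using L(1)[rule_format, of x] by (auto simp: indicator_def space_pair_measure)
      qed
    qed
    also have "\<dots> = dint p q (\<lambda>x. (norm (z x - L x))\<^sup>2)" using dint_norm[of "\<lambda>_. 1" p q "\<lambda>x. z x - L x"] by simp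
    finally show ?thesis .
  qed
  also have "(\<integral>\<omega>. (G \<omega> - w' \<omega>)\<^sup>2 \<partial>M) = dint p q (\<lambda>x. (norm (\<Gamma> x - L' x))\<^sup>2)"
  proof -
    have "(\<integral>\<omega>. (G \<omega> - w' \<omega>)\<^sup>2 \<partial>M) = (\<integral>x. (norm (indicator {p..<q} (snd x) *\<^sub>R \<Gamma> x - bwd.win (- q) (- p) x *\<^sub>R \<gamma> (fst x)))\<^sup>2 \<partial>NT)"
      unfolding w'_def by (rule bwd.ito_residual[OF G \<gamma>(1) mS(1,2) order_refl mS(3)])
    also have "\<dots> = (\<integral>x. (norm (indicator {p..<q} (snd x) *\<^sub>R (\<Gamma> x - L' x)))\<^sup>2 \<partial>NT)"
    proof (rule integral_cong_AE)
      show "(\<lambda>x. (norm (indicator {p..<q} (snd x) *\<^sub>R (\<Gamma> x - L' x)))\<^sup>2) \<in> borel_measurable NT"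
        using sq_int_measurable[OF sq_int_window[OF sq_int_diff[OF \<Gamma> L'(2)]]] by measurable
      have "- q \<le> 0" using mS by linarith
      then have "(\<lambda>x. indicator {p..<q} (snd x) *\<^sub>R \<Gamma> x - bwd.win (- q) (- p) x *\<^sub>R \<gamma> (fst x)) \<in> borel_measurable NT"
        using sq_int_measurable[OF sq_int_window[OF \<Gamma>]] bwd.bdd_rv_measurable[OF mS(1) _ \<gamma>(1)] by measurable
      then show "(\<lambda>x. (norm (indicator {p..<q} (snd x) *\<^sub>R \<Gamma> x - bwd.win (- q) (- p) x *\<^sub>R \<gamma> (fst x)))\<^sup>2) \<in> borel_measurable NT"
        by measurable
      \<comment> \<open>The backward window is \<open>{p..<q}\<close> in original time, so here only
        the left end has to be discarded.\<close>
      have "AE x in NT. snd x \<noteq> p"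
        by (rule fwd.MT.AE_snd, rule AE_lborel_singleton)
      then show "AE x in NT. (norm (indicator {p..<q} (snd x) *\<^sub>R \<Gamma> x - bwd.win (- q) (- p) x *\<^sub>R \<gamma> (fst x)))\<^sup>2
          = (norm (indicator {p..<q} (snd x) *\<^sub>R (\<Gamma> x - L' x)))\<^sup>2"
        using AE_space
      proof eventually_elim
        case (elim x)
        then show ?case using L'(1)[rule_format, of x] by (auto simp: indicator_def space_pair_measure)
      qed
    qed
    also have "\<dots> = dint p q (\<lambda>x. (norm (\<Gamma> x - L' x))\<^sup>2)" using dint_norm[of "\<lambda>_. 1" p q "\<lambda>x. \<Gamma> x - L' x"] by simp
    finally show ?thesis .
  qed
  finally have main: "u p - u q \<le> dint p q (\<lambda>x. psi' (y q (fst x)) * F x) + 0 - 0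
    + dint p q (\<lambda>x. psi'' (y q (fst x)) / 2 * (norm (\<Gamma> x))\<^sup>2) - dint p q (\<lambda>x. psi'' (y p (fst x)) / 2 * (norm (z x))\<^sup>2)
    + (9 + 1 / l) * (\<integral>\<omega>. (A p q \<omega>)\<^sup>2 \<partial>M) + l * dint p q (\<lambda>x. (norm (\<Gamma> x))\<^sup>2)
    + 12 * l * ((\<integral>\<omega>. (w \<omega>)\<^sup>2 \<partial>M) + (\<integral>\<omega>. (w' \<omega>)\<^sup>2 \<partial>M))
    + 12 / l * ((\<integral>\<omega>. (w \<omega>) ^ 4 \<partial>M) + (\<integral>\<omega>. (w' \<omega>) ^ 4 \<partial>M))
    + 4 * dint p q (\<lambda>x. (norm (z x - L x))\<^sup>2) + 8 * dint p q (\<lambda>x. (norm (\<Gamma> x - L' x))\<^sup>2)" .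
  have b1: "(9 + 1 / l) * (\<integral>\<omega>. (A p q \<omega>)\<^sup>2 \<partial>M) \<le> (9 + 1 / l) * ((q - p) * dint p q (\<lambda>x. (F x)\<^sup>2))"
    by (rule mult_left_mono[OF A(2)]) (use l in simp)
  have b2: "12 * l * ((\<integral>\<omega>. (w \<omega>)\<^sup>2 \<partial>M) + (\<integral>\<omega>. (w' \<omega>)\<^sup>2 \<partial>M)) \<le> 12 * l * (K\<^sup>2 * (N1 * (q - p)) + K\<^sup>2 * (N2 * (q - p)))"
    by (rule mult_left_mono[OF add_mono[OF wm(1)]]) (use l w'm(1) in simp_all)
  have b3: "12 / l * ((\<integral>\<omega>. (w \<omega>) ^ 4 \<partial>M) + (\<integral>\<omega>. (w' \<omega>) ^ 4 \<partial>M)) 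
    \<le> 12 / l * (K ^ 4 * (3 * N1\<^sup>2 * (q - p)\<^sup>2) + K ^ 4 * (3 * N2\<^sup>2 * (q - p)\<^sup>2))"
    by (rule mult_left_mono[OF add_mono[OF wm(3)]]) (use l w'm(3) in simp_all)
  show ?thesis using main b1 b2 b3 by linarith
qed

end

section \<open>Refining the partition\<close>

context bdsde_difference
begin

text \<open>Integration variables and grid points range over the whole real line, while
  \<open>y\<close> is controlled on \<open>[0, T]\<close> only; clamping makes sampled values
  jointly measurable everywhere.\<close>

definition clamp_time :: "real \<Rightarrow> real" where "clamp_time t = max 0 (min T t)"

definition yv :: "(real \<Rightarrow> real) \<Rightarrow> 'w \<times> real \<Rightarrow> real" where
  "yv \<theta> x = y (clamp_time (\<theta> (snd x))) (fst x)"

lemma clamp_time: "clamp_time t \<in> {0..T}" "t \<in> {0..T} \<Longrightarrow> clamp_time t = t"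
  using T by (auto simp: clamp_time_def)

lemma clamp_time_measurable [measurable]: "clamp_time \<in> borel_measurable borel"
  unfolding clamp_time_def[abs_def] by measurable

lemma yv_measurable [measurable]:
  assumes [measurable]: "\<theta> \<in> borel_measurable borel"
  shows "yv \<theta> \<in> borel_measurable NT"
  unfolding yv_def[abs_def]
  by (rule progressive_time_change[OF y_prog, of "\<lambda>t. clamp_time (\<theta> t)"]) (use clamp_time(1) in measurable)

lemma R_AE: "AE x in NT. \<forall>t\<in>{0..T}. (y t (fst x))\<^sup>2 \<le> R (fst x)"
  by (rule fwd.MT.AE_fst[OF R(2)])

lemma dint_add:
  assumes "integrable NT g" "a \<le> b" "b \<le> c"
  shows "dint a b g + dint b c g = dint a c g"
proof -
  have "dint a b g + dint b c g = (\<integral>x. indicator {a..<b} (snd x) * g x + indicator {b..<c} (snd x) * g x \<partial>NT)"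
    unfolding dint_def by (rule Bochner_Integration.integral_add[symmetric]; rule integrable_window[OF assms(1)])
  also have "\<dots> = dint a c g"
    unfolding dint_def by (intro Bochner_Integration.integral_cong refl) (use assms in \<open>auto simp: indicator_def\<close>)
  finally show ?thesis .
qed

lemma dint_linear:
  assumes "integrable NT g" "integrable NT g'"
  shows "dint p q (\<lambda>x. g x + g' x) = dint p q g + dint p q g'" "dint p q (\<lambda>x. g x - g' x) = dint p q g - dint p q g'"
  unfolding dint_def distrib_left right_diff_distrib
  by (intro Bochner_Integration.integral_add Bochner_Integration.integral_diff integrable_window assms)+

lemma dint_cmult: "dint p q (\<lambda>x. c * g x) = c * dint p q g"
  unfolding dint_def by (simp add: mult.left_commute)

text \<open>The Ito drift with two sampling times: right ends \<open>\<theta>\<close> for the terms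
  from the expansion at \<open>q\<close>, left ends \<open>\<theta>'\<close> for the forward one.
  The identity in both places gives the limit. The indicator is placed where the bound involves
  \<open>R\<close>, which is not integrable over unbounded time; the other two terms are dominated
  by square integrands.\<close>

definition drift :: "(real \<Rightarrow> real) \<Rightarrow> (real \<Rightarrow> real) \<Rightarrow> 'w \<times> real \<Rightarrow> real" where
  "drift \<theta> \<theta>' x = indicator {0..T} (snd x) * (psi' (yv \<theta> x) * F x) + psi'' (yv \<theta> x) / 2 * (norm (\<Gamma> x))\<^sup>2 
    - psi'' (yv \<theta>' x) / 2 * (norm (z x))\<^sup>2"

text \<open>Does not depend on the sampling times, hence dominates for all meshes at once.\<close>

definition drift_bound :: "'w \<times> real \<Rightarrow> real" where
  "drift_bound x = indicator {0..T} (snd x) * R (fst x) + (F x)\<^sup>2 + (norm (\<Gamma> x))\<^sup>2 + (norm (z x))\<^sup>2"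

lemma drift_bound_integrable: "integrable NT drift_bound"
proof -
  have "integrable NT (\<lambda>x. indicator {0..T} (snd x) * R (fst x))"
    by (rule fwd.integrable_time_product(1)[OF R(1) integrable_indicator_interval(2)])
  then show ?thesis unfolding drift_bound_def[abs_def]
    by (intro Bochner_Integration.integrable_add) (use F \<Gamma> z in \<open>auto simp: sq_int_def\<close>)
qed

lemma psi''_mult_le: "0 \<le> s \<Longrightarrow> \<bar>psi'' v / 2 * s\<bar> \<le> s"
  using mult_right_mono[OF psi''_bounds(2)[of v], of s] psi''_bounds(1)[of v] by (simp add: abs_mult)

lemma drift_pieces_bound:
  assumes "\<forall>t\<in>{0..T}. (y t (fst x))\<^sup>2 \<le> R (fst x)"
  shows "\<bar>indicator {0..T} (snd x) * (psi' (yv \<theta> x) * F x)\<bar> \<le> indicator {0..T} (snd x) * R (fst x) + (F x)\<^sup>2"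
proof -
  have "\<bar>psi' (yv \<theta> x) * F x\<bar> \<le> 2 * \<bar>yv \<theta> x\<bar> * \<bar>F x\<bar>"
    using mult_right_mono[OF psi_bounds(4)[of "yv \<theta> x"], of "\<bar>F x\<bar>"] psi_bounds(3)[of "yv \<theta> x"] by (simp add: abs_mult)
  also have "\<dots> \<le> (yv \<theta> x)\<^sup>2 + (F x)\<^sup>2"
    using sum_squares_bound[of "\<bar>yv \<theta> x\<bar>" "\<bar>F x\<bar>"] by simp
  also have "(yv \<theta> x)\<^sup>2 \<le> R (fst x)"
    unfolding yv_def using assms clamp_time(1) by blast
  finally show ?thesis by (auto simp: indicator_def)
qed

lemma drift_le_bound: "AE x in NT. \<bar>drift \<theta> \<theta>' x\<bar> \<le> drift_bound x"
  using R_AE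
proof eventually_elim
  case (elim x)
  have "\<bar>drift \<theta> \<theta>' x\<bar> \<le> \<bar>indicator {0..T} (snd x) * (psi' (yv \<theta> x) * F x)\<bar> 
      + \<bar>psi'' (yv \<theta> x) / 2 * (norm (\<Gamma> x))\<^sup>2\<bar> + \<bar>psi'' (yv \<theta>' x) / 2 * (norm (z x))\<^sup>2\<bar>"
    unfolding drift_def by linarith
  also have "\<dots> \<le> drift_bound x"
    unfolding drift_bound_def
    by (intro add_mono drift_pieces_bound[OF elim] psi''_mult_le) auto
  finally show ?case .
qed

lemma drift_measurable [measurable]:
  assumes "\<theta> \<in> borel_measurable borel" "\<theta>' \<in> borel_measurable borel"
  shows "drift \<theta> \<theta>' \<in> borel_measurable NT"
proof -
  have [measurable]: "yv \<theta> \<in> borel_measurable NT" "yv \<theta>' \<in> borel_measurable NT" "\<Gamma> \<in> borel_measurable NT" "z \<in> borel_measurable NT"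
    using assms yv_measurable sq_int_measurable[OF \<Gamma>] sq_int_measurable[OF z] by auto
  show ?thesis unfolding drift_def[abs_def] by measurable
qed

lemma drift_integrable:
  assumes "\<theta> \<in> borel_measurable borel" "\<theta>' \<in> borel_measurable borel"
  shows "integrable NT (drift \<theta> \<theta>')"
proof (rule Bochner_Integration.integrable_bound[OF drift_bound_integrable drift_measurable[OF assms]])
  show "AE x in NT. norm (drift \<theta> \<theta>' x) \<le> norm (drift_bound x)"
    using drift_le_bound[of \<theta> \<theta>'] by eventually_elim simp
qed

lemma drift_step:
  assumes pq: "0 \<le> p" "p \<le> q" "q \<le> T" and \<theta>: "\<And>t. t \<in> {p..<q} \<Longrightarrow> \<theta> t = q" "\<And>t. t \<in> {p..<q} \<Longrightarrow> \<theta>' t = p"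
  shows "dint p q (\<lambda>x. psi' (y q (fst x)) * F x) + dint p q (\<lambda>x. psi'' (y q (fst x)) / 2 * (norm (\<Gamma> x))\<^sup>2)
    - dint p q (\<lambda>x. psi'' (y p (fst x)) / 2 * (norm (z x))\<^sup>2) = dint p q (drift \<theta> \<theta>')"
proof -
  have T': "p \<in> {0..T}" "q \<in> {0..T}" using pq by auto
  let ?w = "\<lambda>x :: 'w \<times> real. indicator {p..<q} (snd x) :: real"
  have i1: "integrable NT (\<lambda>x. ?w x * (psi' (y q (fst x)) * F x))"
    by (rule A_pair(2)[OF psi'_y_sq_int[OF T'(2)]])
  have b: "integrable NT (\<lambda>x. ?w x * (psi'' (y r (fst x)) / 2 * (norm (G x))\<^sup>2))"
    if "r \<in> {0..T}" "sq_int NT G" for r and G :: "'w \<times> real \<Rightarrow> 'b::euclidean_space"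
  proof (rule integrable_window, rule Bochner_Integration.integrable_bound[OF sq_int_integrable[OF that(2)]])
    show "(\<lambda>x. psi'' (y r (fst x)) / 2 * (norm (G x))\<^sup>2) \<in> borel_measurable NT"
      using y_meas(3)[OF that(1)] sq_int_measurable[OF that(2)] by measurable
    show "AE x in NT. norm (psi'' (y r (fst x)) / 2 * (norm (G x))\<^sup>2) \<le> norm ((norm (G x))\<^sup>2)"
      using psi''_mult_le by (intro AE_I2) simp
  qed
  have "dint p q (drift \<theta> \<theta>') = (\<integral>x. ?w x * (psi' (y q (fst x)) * F x) + ?w x * (psi'' (y q (fst x)) / 2 * (norm (\<Gamma> x))\<^sup>2)
    - ?w x * (psi'' (y p (fst x)) / 2 * (norm (z x))\<^sup>2) \<partial>NT)"
    unfolding dint_def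
  proof (intro Bochner_Integration.integral_cong refl)
    fix x :: "'w \<times> real"
    show "?w x * drift \<theta> \<theta>' x = ?w x * (psi' (y q (fst x)) * F x) + ?w x * (psi'' (y q (fst x)) / 2 * (norm (\<Gamma> x))\<^sup>2)
      - ?w x * (psi'' (y p (fst x)) / 2 * (norm (z x))\<^sup>2)"
    proof (cases "snd x \<in> {p..<q}")
      case True
      then have "yv \<theta> x = y q (fst x)" "yv \<theta>' x = y p (fst x)" "snd x \<in> {0..T}"
        using \<theta> clamp_time(2) T' pq by (auto simp: yv_def)
      then show ?thesis by (simp add: drift_def algebra_simps)
    qed simp
  qed
  also have "\<dots> = dint p q (\<lambda>x. psi' (y q (fst x)) * F x) + dint p q (\<lambda>x. psi'' (y q (fst x)) / 2 * (norm (\<Gamma> x))\<^sup>2)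
    - dint p q (\<lambda>x. psi'' (y p (fst x)) / 2 * (norm (z x))\<^sup>2)"
    unfolding dint_def using i1 b[OF T'(2) \<Gamma>] b[OF T'(1) z] by simp
  finally show ?thesis by simp
qed

section \<open>Uniform grids on an interval without break points\<close>

context
  fixes a b K :: real and \<eta> :: "'w \<Rightarrow> real ^ 'd" and \<gamma> :: "'w \<Rightarrow> real ^ 'l"
    and L :: "'w \<times> real \<Rightarrow> real ^ 'd" and L' :: "'w \<times> real \<Rightarrow> real ^ 'l"
  assumes ab: "0 \<le> a" "a < b" "b \<le> T"
    and \<eta>: "fwd.bdd_rv a \<eta>" "\<forall>\<omega>\<in>space M. norm (\<eta> \<omega>) \<le> K"
    and \<gamma>: "bwd.bdd_rv (- b) \<gamma>" "\<forall>\<omega>\<in>space M. norm (\<gamma> \<omega>) \<le> K"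
    and L: "\<forall>x. fst x \<in> space M \<longrightarrow> snd x \<in> {a<..<b} \<longrightarrow> L x = \<eta> (fst x)" "sq_int NT L"
    and L': "\<forall>x. fst x \<in> space M \<longrightarrow> snd x \<in> {a<..<b} \<longrightarrow> L' x = \<gamma> (fst x)" "sq_int NT L'"
begin

definition mesh :: "nat \<Rightarrow> real" where "mesh n = (b - a) / Suc n"

definition grid_lo :: "nat \<Rightarrow> real \<Rightarrow> real" where "grid_lo n t = a + mesh n * \<lfloor>(t - a) / mesh n\<rfloor>"

definition grid_hi :: "nat \<Rightarrow> real \<Rightarrow> real" where "grid_hi n t = grid_lo n t + mesh n"

text \<open>The price of replacing the integrands by approximants, with the coefficients 4 and 8 of
  \<open>psi_step\<close>. As a density it adds up over the cells and does not see the mesh.\<close>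

definition defect :: "'w \<times> real \<Rightarrow> real" where
  "defect x = 4 * (norm (z x - L x))\<^sup>2 + 8 * (norm (\<Gamma> x - L' x))\<^sup>2"

lemma mesh_pos: "0 < mesh n" using ab by (simp add: mesh_def)

lemma defect_integrable: "integrable NT defect"
  unfolding defect_def[abs_def]
  by (intro Bochner_Integration.integrable_add integrable_mult_right sq_int_integrable sq_int_diff z \<Gamma> L(2) L'(2))

lemma grid_measurable [measurable]: "grid_lo n \<in> borel_measurable borel" "grid_hi n \<in> borel_measurable borel"
  unfolding grid_hi_def[abs_def] grid_lo_def[abs_def] by measurable

lemma grid_close: "grid_lo n t \<le> t" "t \<le> grid_hi n t" "t - mesh n \<le> grid_lo n t" "grid_hi n t \<le> t + mesh n"
proof -
  have "mesh n * \<lfloor>(t - a) / mesh n\<rfloor> \<le> mesh n * ((t - a) / mesh n)"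
    using mesh_pos[of n] by (intro mult_left_mono) auto
  then show 1: "grid_lo n t \<le> t" using mesh_pos[of n] by (simp add: grid_lo_def)
  have "mesh n * ((t - a) / mesh n) \<le> mesh n * (\<lfloor>(t - a) / mesh n\<rfloor> + 1)"
    using mesh_pos[of n] real_of_int_floor_add_one_ge by (intro mult_left_mono) auto
  then show 2: "t \<le> grid_hi n t" using mesh_pos[of n] by (simp add: grid_hi_def grid_lo_def distrib_left)
  show "t - mesh n \<le> grid_lo n t" "grid_hi n t \<le> t + mesh n" using 1 2 by (simp_all add: grid_hi_def)
qed

lemma grid_value:
  assumes "t \<in> {a + i * mesh n..<a + Suc i * mesh n}"
  shows "grid_lo n t = a + i * mesh n" "grid_hi n t = a + Suc i * mesh n"
proof -
  have "\<lfloor>(t - a) / mesh n\<rfloor> = int i"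
    using assms mesh_pos[of n] by (intro floor_unique) (auto simp: field_simps)
  then show "grid_lo n t = a + i * mesh n" by (simp add: grid_lo_def)
  then show "grid_hi n t = a + Suc i * mesh n" by (simp add: grid_hi_def algebra_simps)
qed

text \<open>The free weight is now chosen as \<open>l = sqrt (mesh n)\<close>. It balances
  \<open>l\<close> against \<open>mesh n / l\<close>, so both this error and \<open>err_K\<close>
  below are of order \<open>sqrt (mesh n)\<close>.\<close>

definition err_F :: "nat \<Rightarrow> real" where "err_F n = (9 + 1 / sqrt (mesh n)) * mesh n"

definition err_K :: "nat \<Rightarrow> real" where
  "err_K n = 12 * sqrt (mesh n) * (K\<^sup>2 * CARD('d) + K\<^sup>2 * CARD('l))
    + 12 / sqrt (mesh n) * (mesh n * (K ^ 4 * (3 * (real CARD('d))\<^sup>2) + K ^ 4 * (3 * (real CARD('l))\<^sup>2)))"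

text \<open>Collects the part of the step bound that is an integral over the cell, so that summation
  is additivity of \<open>dint\<close>. The rest is \<open>err_K\<close> times the cell
  length.\<close>

definition total :: "nat \<Rightarrow> 'w \<times> real \<Rightarrow> real" where
  "total n x = drift (grid_hi n) (grid_lo n) x + err_F n * (F x)\<^sup>2 + sqrt (mesh n) * (norm (\<Gamma> x))\<^sup>2 + defect x"

lemma squares_integrable: "integrable NT (\<lambda>x. (F x)\<^sup>2)" "integrable NT (\<lambda>x. (norm (\<Gamma> x))\<^sup>2)"
  using F \<Gamma> by (auto simp: sq_int_def)

lemma total_integrable: "integrable NT (total n)"
  unfolding total_def[abs_def]
  by (intro Bochner_Integration.integrable_add integrable_mult_right squares_integrable defect_integrable
      drift_integrable grid_measurable)

lemma dint_total:
  "dint p q (total n) = dint p q (drift (grid_hi n) (grid_lo n)) + err_F n * dint p q (\<lambda>x. (F x)\<^sup>2)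
    + sqrt (mesh n) * dint p q (\<lambda>x. (norm (\<Gamma> x))\<^sup>2) + dint p q defect"
  unfolding total_def[abs_def]
  using drift_integrable[OF grid_measurable(2,1), of n n] squares_integrable defect_integrable
  by (simp add: dint_linear dint_cmult)

lemma dint_defect:
  "dint p q defect = 4 * dint p q (\<lambda>x. (norm (z x - L x))\<^sup>2) + 8 * dint p q (\<lambda>x. (norm (\<Gamma> x - L' x))\<^sup>2)"
  unfolding defect_def[abs_def]
  by (simp add: dint_linear dint_cmult sq_int_integrable sq_int_diff z \<Gamma> L(2) L'(2))

lemma grid_step:
  assumes i: "i < Suc n"
  shows "u (a + i * mesh n) - u (a + Suc i * mesh n)
    \<le> dint (a + i * mesh n) (a + Suc i * mesh n) (total n) + err_K n * mesh n"
proof -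
  define p q where "p = a + i * mesh n" and "q = a + Suc i * mesh n"
  have h: "q - p = mesh n" by (simp add: p_def q_def algebra_simps)
  have "Suc i * mesh n \<le> Suc n * mesh n" using i mesh_pos[of n] by (intro mult_right_mono) auto
  then have qb: "q \<le> b" by (simp add: q_def mesh_def)
  have ap: "a \<le> p" using mesh_pos[of n] by (simp add: p_def)
  have pq: "0 \<le> p" "p < q" "q \<le> T" using ap qb ab h mesh_pos[of n] by linarith+
  have S': "p \<le> S" "- S \<le> - b" "- b \<le> - q" "- q \<le> 0" using pq qb ab T by linarith+
  have g: "grid_hi n t = q" "grid_lo n t = p" if "t \<in> {p..<q}" for t
    using grid_value[of t i n] that by (auto simp: p_def q_def)
  have l: "0 < sqrt (mesh n)" using mesh_pos by simp
  have L1: "\<forall>x. fst x \<in> space M \<longrightarrow> snd x \<in> {p<..<q} \<longrightarrow> L x = \<eta> (fst x)"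
    "\<forall>x. fst x \<in> space M \<longrightarrow> snd x \<in> {p<..<q} \<longrightarrow> L' x = \<gamma> (fst x)"
    using L(1) L'(1) ap qb by auto
  \<comment> \<open>One pair of coefficients serves all cells: \<open>\<eta>\<close> is known at
    \<open>a\<close> and so at every later \<open>p\<close>, and \<open>\<gamma>\<close> is known
    backward at \<open>b\<close> and so at every earlier \<open>q\<close>.\<close>
  note step = one_step[OF pq l fwd.bdd_rv_mono[OF ab(1) ap S'(1) \<eta>(1)] \<eta>(2)
      bwd.bdd_rv_mono[OF S'(2,3,4) \<gamma>(1)] \<gamma>(2) L1(1) L(2) L1(2) L'(2)]
  have k: "12 * sqrt (mesh n) * (K\<^sup>2 * (real CARD('d) * mesh n) + K\<^sup>2 * (real CARD('l) * mesh n))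
    + 12 / sqrt (mesh n) * (K ^ 4 * (3 * (real CARD('d))\<^sup>2 * (mesh n)\<^sup>2) + K ^ 4 * (3 * (real CARD('l))\<^sup>2 * (mesh n)\<^sup>2)) = err_K n * mesh n"
    unfolding err_K_def power2_eq_square[of "mesh n"] by (simp add: algebra_simps)
  have f: "(9 + 1 / sqrt (mesh n)) * (mesh n * X) = err_F n * X" for X by (simp add: err_F_def)
  note ds = drift_step[OF pq(1) less_imp_le[OF pq(2)] pq(3), of "grid_hi n" "grid_lo n", OF g]
  show ?thesis
    using step[unfolded h f] ds
    unfolding p_def[symmetric] q_def[symmetric] dint_total dint_defect k[symmetric] by linarith
qed

lemma grid_sum:
  "i \<le> Suc n \<Longrightarrow> u a - u (a + i * mesh n) \<le> dint a (a + i * mesh n) (total n) + err_K n * (i * mesh n)"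
proof (induction i)
  case 0
  then show ?case by (simp add: dint_def)
next
  case (Suc i)
  have "u a - u (a + i * mesh n) \<le> dint a (a + i * mesh n) (total n) + err_K n * (i * mesh n)"
    using Suc by simp
  moreover note grid_step[of i n]
  moreover have "dint a (a + i * mesh n) (total n) + dint (a + i * mesh n) (a + Suc i * mesh n) (total n) = dint a (a + Suc i * mesh n) (total n)"
    by (rule dint_add[OF total_integrable]) (use mesh_pos[of n] in \<open>auto simp: algebra_simps\<close>)
  moreover have "err_K n * (Suc i * mesh n) = err_K n * (i * mesh n) + err_K n * mesh n"
    by (simp add: algebra_simps)
  ultimately show ?case using Suc.prems by linarith
qed

lemma mesh_tendsto: "mesh \<longlonglongrightarrow> 0"
proof -
  have "(\<lambda>n. (b - a) * inverse (real (Suc n))) \<longlonglongrightarrow> (b - a) * 0"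
    by (intro tendsto_mult tendsto_const LIMSEQ_inverse_real_of_nat)
  then show ?thesis by (simp add: mesh_def[abs_def] divide_inverse)
qed

lemma errors_tendsto: "err_F \<longlonglongrightarrow> 0" "err_K \<longlonglongrightarrow> 0" "(\<lambda>n. sqrt (mesh n)) \<longlonglongrightarrow> 0"
proof -
  have s: "(\<lambda>n. sqrt (mesh n)) \<longlonglongrightarrow> 0" using tendsto_real_sqrt[OF mesh_tendsto] by simp
  have e: "1 / sqrt (mesh n) * (mesh n * X) = sqrt (mesh n) * X" for n X
    using mesh_pos[of n] real_sqrt_mult_self[of "mesh n"] by (simp add: field_simps)
  have "err_F n = 9 * mesh n + sqrt (mesh n)" for n
    using e[of n 1] by (simp add: err_F_def distrib_right)
  then have "err_F = (\<lambda>n. 9 * mesh n + sqrt (mesh n))" by (rule ext)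
  moreover have "(\<lambda>n. 9 * mesh n + sqrt (mesh n)) \<longlonglongrightarrow> 9 * 0 + 0" by (intro tendsto_intros mesh_tendsto s)
  ultimately show "err_F \<longlonglongrightarrow> 0" by simp
  let ?c1 = "K\<^sup>2 * CARD('d) + K\<^sup>2 * CARD('l)"
  let ?c2 = "K ^ 4 * (3 * (real CARD('d))\<^sup>2) + K ^ 4 * (3 * (real CARD('l))\<^sup>2)"
  have "err_K n = 12 * sqrt (mesh n) * ?c1 + 12 * (sqrt (mesh n) * ?c2)" for n
    unfolding err_K_def e[symmetric] by simp
  then have "err_K = (\<lambda>n. 12 * sqrt (mesh n) * ?c1 + 12 * (sqrt (mesh n) * ?c2))" by (rule ext)
  moreover have "(\<lambda>n. 12 * sqrt (mesh n) * ?c1 + 12 * (sqrt (mesh n) * ?c2)) \<longlonglongrightarrow> 12 * 0 * ?c1 + 12 * (0 * ?c2)"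
    by (intro tendsto_intros s)
  ultimately show "err_K \<longlonglongrightarrow> 0" by simp
  show "(\<lambda>n. sqrt (mesh n)) \<longlonglongrightarrow> 0" by (rule s)
qed

lemma yv_tendsto:
  assumes cont: "continuous_on {0..T} (\<lambda>t. y t (fst x))" and \<theta>: "(\<lambda>n. \<theta> n (snd x)) \<longlonglongrightarrow> snd x"
  shows "(\<lambda>n. yv (\<theta> n) x) \<longlonglongrightarrow> yv (\<lambda>t. t) x"
proof -
  have "(\<lambda>n. clamp_time (\<theta> n (snd x))) \<longlonglongrightarrow> clamp_time (snd x)"
    unfolding clamp_time_def by (intro tendsto_intros \<theta>)
  then show ?thesis unfolding yv_def
    by (intro continuous_on_tendsto_compose[OF cont]) (use clamp_time(1) in auto)
qed

lemma grid_tendsto: "(\<lambda>n. grid_lo n t) \<longlonglongrightarrow> t" "(\<lambda>n. grid_hi n t) \<longlonglongrightarrow> t"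
proof -
  have 1: "(\<lambda>n. t - mesh n) \<longlonglongrightarrow> t - 0" "(\<lambda>n. t + mesh n) \<longlonglongrightarrow> t + 0" by (intro tendsto_intros mesh_tendsto)+
  show "(\<lambda>n. grid_lo n t) \<longlonglongrightarrow> t"
    by (rule tendsto_sandwich[OF _ _ 1(1)[simplified] tendsto_const]) (use grid_close in auto)
  show "(\<lambda>n. grid_hi n t) \<longlonglongrightarrow> t"
    by (rule tendsto_sandwich[OF _ _ tendsto_const 1(2)[simplified]]) (use grid_close in auto)
qed

text \<open>Dominated convergence: along a continuous path the samples at both ends of the cell
  containing \<open>t\<close> converge to the value at \<open>t\<close>, so the discrepancy between
  left and right ends disappears.\<close>

lemma drift_tendsto: "(\<lambda>n. dint a b (drift (grid_hi n) (grid_lo n))) \<longlonglongrightarrow> dint a b (drift (\<lambda>t. t) (\<lambda>t. t))"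
  unfolding dint_def
proof (rule integral_dominated_convergence)
  show "integrable NT (\<lambda>x. indicator {a..<b} (snd x) * drift_bound x)" by (rule integrable_window[OF drift_bound_integrable])
  show "(\<lambda>x. indicator {a..<b} (snd x) * drift (\<lambda>t. t) (\<lambda>t. t) x) \<in> borel_measurable NT" by measurable
  show "(\<lambda>x. indicator {a..<b} (snd x) * drift (grid_hi n) (grid_lo n) x) \<in> borel_measurable NT" for n by measurable
  show "AE x in NT. norm (indicator {a..<b} (snd x) * drift (grid_hi n) (grid_lo n) x) \<le> indicator {a..<b} (snd x) * drift_bound x" for n
    using drift_le_bound[of "grid_hi n" "grid_lo n"] by eventually_elim (simp add: indicator_def)
  show "AE x in NT. (\<lambda>n. indicator {a..<b} (snd x) * drift (grid_hi n) (grid_lo n) x)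
     \<longlonglongrightarrow> indicator {a..<b} (snd x) * drift (\<lambda>t. t) (\<lambda>t. t) x"
    using fwd.MT.AE_fst[OF y_cont]
  proof eventually_elim
    case (elim x)
    note t = yv_tendsto[where \<theta>=grid_lo, OF elim grid_tendsto(1)] yv_tendsto[where \<theta>=grid_hi, OF elim grid_tendsto(2)]
    show ?case unfolding drift_def
      by (intro tendsto_intros isCont_tendsto_compose[OF psi_continuous(2)] isCont_tendsto_compose[OF psi_continuous(3)] t) simp_all
  qed
qed

text \<open>The telescoped step bounds with the mesh sent to zero; the approximants stay fixed, and
  hence the defect survives.\<close>

lemma interval_estimate: "u a - u b \<le> dint a b (\<lambda>x. drift (\<lambda>t. t) (\<lambda>t. t) x + defect x)"
proof -
  have le: "u a - u b \<le> dint a b (drift (grid_hi n) (grid_lo n)) + err_F n * dint a b (\<lambda>x. (F x)\<^sup>2)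
    + sqrt (mesh n) * dint a b (\<lambda>x. (norm (\<Gamma> x))\<^sup>2) + dint a b defect + err_K n * (b - a)" for n
  proof -
    have "Suc n * mesh n = b - a" by (simp add: mesh_def)
    then show ?thesis using grid_sum[of "Suc n" n] by (simp add: dint_total)
  qed
  have "(\<lambda>n. dint a b (drift (grid_hi n) (grid_lo n)) + err_F n * dint a b (\<lambda>x. (F x)\<^sup>2)
    + sqrt (mesh n) * dint a b (\<lambda>x. (norm (\<Gamma> x))\<^sup>2) + dint a b defect + err_K n * (b - a))
    \<longlonglongrightarrow> dint a b (drift (\<lambda>t. t) (\<lambda>t. t)) + 0 * dint a b (\<lambda>x. (F x)\<^sup>2)
    + 0 * dint a b (\<lambda>x. (norm (\<Gamma> x))\<^sup>2) + dint a b defect + 0 * (b - a)"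
    by (intro tendsto_intros drift_tendsto errors_tendsto)
  from LIMSEQ_le_const[OF this] le
  have "u a - u b \<le> dint a b (drift (\<lambda>t. t) (\<lambda>t. t)) + dint a b defect" by auto
  also have "\<dots> = dint a b (\<lambda>x. drift (\<lambda>t. t) (\<lambda>t. t) x + defect x)"
    using drift_integrable[of "\<lambda>t. t" "\<lambda>t. t"] defect_integrable by (simp add: dint_linear)
  finally show ?thesis .
qed

end

text \<open>Induction on the number of break points inside \<open>(a, b)\<close>: both sides are
  additive when the interval is cut at one of them. Break points of \<open>L'\<close> are recorded
  in reversed time, hence the \<open>uminus\<close>.\<close>

lemma approx_estimate:
  fixes L :: "'w \<times> real \<Rightarrow> real ^ 'd" and L' :: "'w \<times> real \<Rightarrow> real ^ 'l"
  assumes L: "finite Q" "fwd.locally_const Q K L" "sq_int NT L"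
    and L': "finite Q'" "bwd.locally_const Q' K' L'" "sq_int NT L'"
    and ab: "0 \<le> a" "a \<le> b" "b \<le> T"
  shows "u a - u b \<le> dint a b (\<lambda>x. drift (\<lambda>t. t) (\<lambda>t. t) x + (4 * (norm (z x - L x))\<^sup>2 + 8 * (norm (\<Gamma> x - L' x))\<^sup>2))"
    (is "_ \<le> dint a b ?g")
  using ab
proof (induction "card ((Q \<union> uminus ` Q') \<inter> {a<..<b})" arbitrary: a b rule: less_induct)
  case less
  let ?Q = "Q \<union> uminus ` Q'"
  have fin: "finite (?Q \<inter> X)" for X using L(1) L'(1) by auto
  have int: "integrable NT ?g"
    by (intro Bochner_Integration.integrable_add integrable_mult_right sq_int_integrable sq_int_diff z \<Gamma> L(3) L'(3) drift_integrable) simp_all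
  consider "a = b" | "a < b" "?Q \<inter> {a<..<b} = {}" | c where "c \<in> ?Q" "a < c" "c < b" using less.prems by force
  then show ?case
  proof cases
    case 1
    then show ?thesis by (simp add: dint_def)
  next
    case 2
    have "b \<le> S" "- S \<le> - b" "- b < - a" "- a \<le> 0" using 2 less.prems T by linarith+
    have "{a<..<b} \<inter> Q = {}" using 2(2) by blast
    then obtain \<eta> where \<eta>: "fwd.bdd_rv a \<eta>" "\<forall>\<omega>\<in>space M. norm (\<eta> \<omega>) \<le> K"
      "\<forall>x. fst x \<in> space M \<longrightarrow> 1 * snd x \<in> {a<..<b} \<longrightarrow> L x = \<eta> (fst x)"
      using L(2)[unfolded fwd.locally_const_def] less.prems(1) 2(1) \<open>b \<le> S\<close> by blast
    have "{- b<..<- a} \<inter> Q' = {}"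
    proof -
      have False if "s \<in> {- b<..<- a}" "s \<in> Q'" for s
      proof -
        have "- s \<in> ?Q \<inter> {a<..<b}" using that by auto
        then show False using 2(2) by blast
      qed
      then show ?thesis by blast
    qed
    then obtain \<gamma> where \<gamma>: "bwd.bdd_rv (- b) \<gamma>" "\<forall>\<omega>\<in>space M. norm (\<gamma> \<omega>) \<le> K'"
      "\<forall>x. fst x \<in> space M \<longrightarrow> - 1 * snd x \<in> {- b<..<- a} \<longrightarrow> L' x = \<gamma> (fst x)"
      using L'(2)[unfolded bwd.locally_const_def] \<open>- S \<le> - b\<close> \<open>- b < - a\<close> \<open>- a \<le> 0\<close> by blast
    have b1: "\<forall>\<omega>\<in>space M. norm (\<eta> \<omega>) \<le> max K K'" "\<forall>\<omega>\<in>space M. norm (\<gamma> \<omega>) \<le> max K K'"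
      using \<eta>(2) \<gamma>(2) by (auto simp: le_max_iff_disj)
    have e: "\<forall>x. fst x \<in> space M \<longrightarrow> snd x \<in> {a<..<b} \<longrightarrow> L x = \<eta> (fst x)"
      "\<forall>x. fst x \<in> space M \<longrightarrow> snd x \<in> {a<..<b} \<longrightarrow> L' x = \<gamma> (fst x)"
      using \<eta>(3) \<gamma>(3) by auto
    from interval_estimate[OF less.prems(1) 2(1) less.prems(3) \<eta>(1) b1(1) \<gamma>(1) b1(2) e(1) L(3) e(2) L'(3)]
    show ?thesis
      by (simp only: defect_def[OF less.prems(1) 2(1) less.prems(3) \<eta>(1) b1(1) \<gamma>(1) b1(2) e(1) L(3) e(2) L'(3)])
  next
    case (3 c)
    have "card (?Q \<inter> {a<..<c}) < card (?Q \<inter> {a<..<b})"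
      by (rule psubset_card_mono[OF fin]) (use 3 in auto)
    from less.hyps[OF this] have 1: "u a - u c \<le> dint a c ?g" using 3 less.prems by simp
    have "card (?Q \<inter> {c<..<b}) < card (?Q \<inter> {a<..<b})"
      by (rule psubset_card_mono[OF fin]) (use 3 in auto)
    from less.hyps[OF this] have 2: "u c - u b \<le> dint c b ?g" using 3 less.prems by simp
    show ?thesis using dint_add[OF int, of a c b] 1 2 3 by simp
  qed
qed

text \<open>The inequality half of the Ito formula for \<open>E \<psi>(y)\<close>.\<close>

lemma main_estimate:
  assumes ab: "0 \<le> a" "a \<le> b" "b \<le> T"
  shows "u a - u b \<le> dint a b (drift (\<lambda>t. t) (\<lambda>t. t))"
proof (rule field_le_epsilon)
  fix e :: real assume "0 < e"
  \<comment> \<open>The weights 4 and 8 of the two approximation errors add up to 12.\<close>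
  then have e: "0 < e / 12" by simp
  have "0 \<in> {0..T}" using T by simp
  \<comment> \<open>The equation at time 0 supplies approximability: it exhibits
    \<open>\<Gamma>\<close> and \<open>z\<close> on all of \<open>[0, T]\<close> as integrands of
    stochastic integrals.\<close>
  from eq[OF this] obtain I J where I: "bwd.ito (- T) (- 0) (\<lambda>x. indicator {0..T} (snd x) *\<^sub>R \<Gamma> x) I"
    and J: "fwd.ito 0 T (\<lambda>x. indicator {0..T} (snd x) *\<^sub>R z x) J" by (elim exE conjE)
  obtain Q K L where L: "finite Q" "fwd.locally_const Q K L" "sq_int NT L"
    "(\<integral>x. (norm (indicator {0..T} (snd x) *\<^sub>R z x - L x))\<^sup>2 \<partial>NT) < e / 12"
    using fwd.ito_locally_const[OF order_refl T(2) J e] by (elim exE conjE)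
  have "- S \<le> - T" "- 0 \<le> (0::real)" using T by auto
  from bwd.ito_locally_const[OF this I e]
  obtain Q' K' L' where L': "finite Q'" "bwd.locally_const Q' K' L'" "sq_int NT L'"
    "(\<integral>x. (norm (indicator {0..T} (snd x) *\<^sub>R \<Gamma> x - L' x))\<^sup>2 \<partial>NT) < e / 12" by (elim exE conjE)
  have le: "dint a b (\<lambda>x. (norm (g x - N x))\<^sup>2) \<le> (\<integral>x. (norm (indicator {0..T} (snd x) *\<^sub>R g x - N x))\<^sup>2 \<partial>NT)"
    if "sq_int NT g" "sq_int NT N" for g N :: "'w \<times> real \<Rightarrow> 'b::euclidean_space"
    unfolding dint_def
  proof (rule integral_mono)
    have "integrable NT (\<lambda>x. (norm (g x - N x))\<^sup>2)" by (intro sq_int_integrable sq_int_diff that)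
    then show "integrable NT (\<lambda>x. indicator {a..<b} (snd x) * (norm (g x - N x))\<^sup>2)" by (rule integrable_window)
    have "sq_int NT (\<lambda>x. indicator {0..T} (snd x) *\<^sub>R g x)"
      by (rule sq_int_scaleR_bounded[OF that(1), where C=1]) (auto simp: indicator_def)
    then show "integrable NT (\<lambda>x. (norm (indicator {0..T} (snd x) *\<^sub>R g x - N x))\<^sup>2)" by (intro sq_int_integrable sq_int_diff that)
    show "indicator {a..<b} (snd x) * (norm (g x - N x))\<^sup>2 \<le> (norm (indicator {0..T} (snd x) *\<^sub>R g x - N x))\<^sup>2" for x
      using ab by (auto simp: indicator_def)
  qed
  have i: "integrable NT (\<lambda>x. (norm (z x - L x))\<^sup>2)" "integrable NT (\<lambda>x. (norm (\<Gamma> x - L' x))\<^sup>2)"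
    by (intro sq_int_integrable sq_int_diff z \<Gamma> L(3) L'(3))+
  have "u a - u b \<le> dint a b (\<lambda>x. drift (\<lambda>t. t) (\<lambda>t. t) x + (4 * (norm (z x - L x))\<^sup>2 + 8 * (norm (\<Gamma> x - L' x))\<^sup>2))"
    by (rule approx_estimate[OF L(1-3) L'(1-3) ab])
  also have "\<dots> = dint a b (drift (\<lambda>t. t) (\<lambda>t. t)) + (4 * dint a b (\<lambda>x. (norm (z x - L x))\<^sup>2) + 8 * dint a b (\<lambda>x. (norm (\<Gamma> x - L' x))\<^sup>2))"
    using i drift_integrable[of "\<lambda>t. t" "\<lambda>t. t"] by (simp add: dint_linear dint_cmult)
  also have "\<dots> \<le> dint a b (drift (\<lambda>t. t) (\<lambda>t. t)) + e"
    using le[OF z L(3)] le[OF \<Gamma> L'(3)] L(4) L'(4) by linarith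
  finally show "u a - u b \<le> dint a b (drift (\<lambda>t. t) (\<lambda>t. t)) + e" .
qed

end

section \<open>Gronwall's argument\<close>

context bdsde_difference
begin

lemma ito_vanishes:
  "bwd.ito (- T) (- T) (\<lambda>x. indicator {T..T} (snd x) *\<^sub>R \<Gamma> x) I \<Longrightarrow> AE \<omega> in M. I \<omega> = 0"
  "fwd.ito T T (\<lambda>x. indicator {T..T} (snd x) *\<^sub>R z x) J \<Longrightarrow> AE \<omega> in M. J \<omega> = 0"
proof -
  have AE: "AE x in NT. snd x \<noteq> T" by (rule fwd.MT.AE_snd, rule AE_lborel_singleton)
  have 0: "(\<integral>x. (norm (indicator {T..T} (snd x) *\<^sub>R g x))\<^sup>2 \<partial>NT) = 0" for g :: "'w \<times> real \<Rightarrow> 'b::euclidean_space"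
    by (rule integral_eq_zero_AE) (use AE in eventually_elim, simp)
  have z: "AE \<omega> in M. X \<omega> = 0" if "sq_int M X" "(\<integral>\<omega>. (X \<omega>)\<^sup>2 \<partial>M) = 0" for X :: "'w \<Rightarrow> real"
    using integral_nonneg_eq_0_iff_AE[of M "\<lambda>\<omega>. (X \<omega>)\<^sup>2"] that by (simp add: sq_int_def)
  have b: "- S \<le> - T" "- T \<le> 0" "0 \<le> T" using T by auto
  show "AE \<omega> in M. I \<omega> = 0" if I: "bwd.ito (- T) (- T) (\<lambda>x. indicator {T..T} (snd x) *\<^sub>R \<Gamma> x) I"
    by (rule z[OF bwd.ito_sq_int(2)[OF b(1,2) I]]) (simp only: bwd.ito_norm[OF b(1,2) I] 0)
  show "AE \<omega> in M. J \<omega> = 0" if J: "fwd.ito T T (\<lambda>x. indicator {T..T} (snd x) *\<^sub>R z x) J"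
    by (rule z[OF fwd.ito_sq_int(2)[OF b(3) T(2) J]]) (simp only: fwd.ito_norm[OF b(3) T(2) J] 0)
qed

text \<open>The terminal condition is implicit in the equation at \<open>T\<close>, where all three
  integrals run over a single point; the stochastic ones vanish by the isometry.\<close>

lemma terminal_value: "AE \<omega> in M. y T \<omega> = \<xi> \<omega>"
proof -
  have "T \<in> {0..T}" using T by simp
  from eq[OF this] obtain I J where I: "bwd.ito (- T) (- T) (\<lambda>x. indicator {T..T} (snd x) *\<^sub>R \<Gamma> x) I"
    and J: "fwd.ito T T (\<lambda>x. indicator {T..T} (snd x) *\<^sub>R z x) J"
    and y: "AE \<omega> in M. y T \<omega> = \<xi> \<omega> + (\<integral>t. indicator {T..T} t * F (\<omega>, t) \<partial>lborel) + I \<omega> - J \<omega>"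
    by (elim exE conjE)
  have A: "AE t in lborel. t \<noteq> T" by (rule AE_lborel_singleton)
  have "(\<integral>t. indicator {T..T} t * F (\<omega>, t) \<partial>lborel) = 0" for \<omega>
    by (rule integral_eq_zero_AE) (use A in eventually_elim, simp)
  with y ito_vanishes(1)[OF I] ito_vanishes(2)[OF J] show ?thesis by (auto elim: AE_mp)
qed

lemma psi_yv_integrable: "integrable NT (\<lambda>x. indicator {a..<b::real} (snd x) * psi (yv (\<lambda>t. t) x))"
proof (rule Bochner_Integration.integrable_bound)
  show "integrable NT (\<lambda>x. indicator {a..<b} (snd x) * R (fst x))"
    by (rule fwd.integrable_time_product(1)[OF R(1) integrable_indicator_interval(1)])
  show "(\<lambda>x. indicator {a..<b} (snd x) * psi (yv (\<lambda>t. t) x)) \<in> borel_measurable NT" by measurable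
  show "AE x in NT. norm (indicator {a..<b} (snd x) * psi (yv (\<lambda>t. t) x)) \<le> norm (indicator {a..<b} (snd x) * R (fst x))"
    using R_AE
  proof eventually_elim
    case (elim x)
    have "psi (yv (\<lambda>t. t) x) \<le> (yv (\<lambda>t. t) x)\<^sup>2" by (rule psi_bounds)
    also have "\<dots> \<le> R (fst x)" unfolding yv_def using elim clamp_time(1) by blast
    finally show ?case using psi_bounds(1)[of "yv (\<lambda>t. t) x"] by (auto simp: indicator_def)
  qed
qed

lemma dint_psi:
  assumes "a \<in> {0..T}"
  shows "integrable lborel (\<lambda>t. indicator {a..<T} t * u (clamp_time t))"
    "dint a T (\<lambda>x. psi (yv (\<lambda>t. t) x)) = (\<integral>t. indicator {a..<T} t * u (clamp_time t) \<partial>lborel)"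
proof -
  have i: "integrable NT (case_prod (\<lambda>\<omega> t. indicator {a..<T} t * psi (y (clamp_time t) \<omega>)))"
    using psi_yv_integrable[of a T] by (simp add: yv_def case_prod_beta')
  have e: "(\<integral>\<omega>. indicator {a..<T} t * psi (y (clamp_time t) \<omega>) \<partial>M) = indicator {a..<T} t * u (clamp_time t)" for t
    by (simp add: u_def)
  show "integrable lborel (\<lambda>t. indicator {a..<T} t * u (clamp_time t))"
    using fwd.MT.integrable_snd[OF i] by (simp only: e)
  show "dint a T (\<lambda>x. psi (yv (\<lambda>t. t) x)) = (\<integral>t. indicator {a..<T} t * u (clamp_time t) \<partial>lborel)"
    using fwd.MT.integral_snd[OF i] by (simp only: e dint_def) (simp add: yv_def case_prod_beta')
qed

text \<open>Gronwall by iteration: substituting a bound \<open>D * exp (- \<beta> * a)\<close> into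
  the integral inequality at least halves it. Only integrability of \<open>u\<close> in time is
  used, which Fubini supplies.\<close>

lemma comparison:
  assumes C: "0 \<le> C"
    and drift: "AE x in NT. snd x \<in> {0..T} \<longrightarrow> drift (\<lambda>t. t) (\<lambda>t. t) x \<le> C * psi (yv (\<lambda>t. t) x)"
    and terminal: "AE \<omega> in M. \<xi> \<omega> \<le> 0" and t: "t \<in> {0..T}"
  shows "AE \<omega> in M. y t \<omega> \<le> 0"
proof -
  have uT: "u T = 0"
  proof -
    have "AE \<omega> in M. psi (y T \<omega>) = 0"
      using terminal terminal_value by eventually_elim (simp add: psi_zero)
    then show ?thesis unfolding u_def by (rule integral_eq_zero_AE)
  qed
  have Gronwall: "u a \<le> C * (\<integral>t. indicator {a..<T} t * u (clamp_time t) \<partial>lborel)" if a: "a \<in> {0..T}" for a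
  proof -
    have "u a - u T \<le> dint a T (drift (\<lambda>t. t) (\<lambda>t. t))" using main_estimate[of a T] a by simp
    also have "\<dots> \<le> dint a T (\<lambda>x. C * psi (yv (\<lambda>t. t) x))"
      unfolding dint_def
    proof (rule integral_mono_AE)
      show "integrable NT (\<lambda>x. indicator {a..<T} (snd x) * drift (\<lambda>t. t) (\<lambda>t. t) x)"
        by (intro integrable_window drift_integrable) simp_all
      show "integrable NT (\<lambda>x. indicator {a..<T} (snd x) * (C * psi (yv (\<lambda>t. t) x)))"
        using integrable_mult_right[OF psi_yv_integrable[of a T], of C] by (simp add: mult.left_commute)
      show "AE x in NT. indicator {a..<T} (snd x) * drift (\<lambda>t. t) (\<lambda>t. t) x \<le> indicator {a..<T} (snd x) * (C * psi (yv (\<lambda>t. t) x))"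
        using drift by eventually_elim (use a in \<open>auto simp: indicator_def\<close>)
    qed
    also have "\<dots> = C * (\<integral>t. indicator {a..<T} t * u (clamp_time t) \<partial>lborel)"
      unfolding dint_cmult dint_psi(2)[OF a] ..
    finally show ?thesis using uT by simp
  qed
  \<comment> \<open>Integrating \<open>exp (- \<beta> * t)\<close> from \<open>a\<close> on gains
    \<open>1 / \<beta>\<close>, and \<open>\<beta>\<close> is taken so large that
    \<open>C / \<beta>\<close> is at most one half.\<close>
  define \<beta> where "\<beta> = 2 * C + 1"
  have \<beta>: "0 < \<beta>" "C / \<beta> \<le> 1 / 2" using C by (auto simp: \<beta>_def field_simps)
  \<comment> \<open>The factor \<open>exp (\<beta> * T)\<close> compensates the decay of the weight
    on \<open>[0, T]\<close>, so that the crude bound by the expectation of \<open>R\<close> starts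
    the iteration.\<close>
  define D where "D = (\<integral>\<omega>. R \<omega> \<partial>M) * exp (\<beta> * T)"
  have uR: "u a \<le> (\<integral>\<omega>. R \<omega> \<partial>M)" if a: "a \<in> {0..T}" for a
    unfolding u_def
  proof (rule integral_mono_AE[OF psi_y_integrable[OF a] R(1)])
    show "AE \<omega> in M. psi (y a \<omega>) \<le> R \<omega>"
      using R(2) by eventually_elim (rule order_trans[OF psi_bounds(2)], use a in blast)
  qed
  have u0: "0 \<le> u a" for a unfolding u_def by (intro integral_nonneg_AE AE_I2 psi_bounds(1))
  have D0: "0 \<le> D" using uR[OF t] u0[of t] by (simp add: D_def)
  have iter: "\<forall>a\<in>{0..T}. u a \<le> D * (1 / 2) ^ n * exp (- \<beta> * a)" for n
  proof (induction n)
    case 0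
    show ?case
    proof
      fix a assume a: "a \<in> {0..T}"
      have "1 \<le> exp (\<beta> * T) * exp (- \<beta> * a)"
        using a \<beta> by (simp add: mult_left_mono flip: exp_add)
      then have "(\<integral>\<omega>. R \<omega> \<partial>M) * 1 \<le> (\<integral>\<omega>. R \<omega> \<partial>M) * (exp (\<beta> * T) * exp (- \<beta> * a))"
        using uR[OF a] u0[of a] by (intro mult_left_mono) auto
      then show "u a \<le> D * (1 / 2) ^ 0 * exp (- \<beta> * a)" using uR[OF a] by (simp add: D_def mult.assoc)
    qed
  next
    case (Suc n)
    show ?case
    proof
      fix a assume a: "a \<in> {0..T}"
      let ?E = "D * (1 / 2) ^ n"
      have FTC: "has_bochner_integral lborel (\<lambda>t. (?E * exp (- \<beta> * t)) * indicator {a..T} t)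
         ((- ?E / \<beta> * exp (- \<beta> * T)) - (- ?E / \<beta> * exp (- \<beta> * a)))"
      proof (rule has_bochner_integral_FTC_Icc_nonneg)
        show "((\<lambda>t. - ?E / \<beta> * exp (- \<beta> * t)) has_real_derivative ?E * exp (- \<beta> * t)) (at t)" for t
          using \<beta> by (auto intro!: derivative_eq_intros)
      qed (use a D0 in auto)
      have "u a \<le> C * (\<integral>t. indicator {a..<T} t * u (clamp_time t) \<partial>lborel)" by (rule Gronwall[OF a])
      also have "\<dots> \<le> C * (\<integral>t. (?E * exp (- \<beta> * t)) * indicator {a..T} t \<partial>lborel)"
      proof (intro mult_left_mono C integral_mono)
        show "integrable lborel (\<lambda>t. indicator {a..<T} t * u (clamp_time t))" by (rule dint_psi(1)[OF a])
        show "integrable lborel (\<lambda>t. (?E * exp (- \<beta> * t)) * indicator {a..T} t)" using FTC by (rule integrable.intros)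
        show "indicator {a..<T} t * u (clamp_time t) \<le> (?E * exp (- \<beta> * t)) * indicator {a..T} t" for t
          using Suc a D0 clamp_time(2)[of t] by (auto simp: indicator_def)
      qed
      also have "(\<integral>t. (?E * exp (- \<beta> * t)) * indicator {a..T} t \<partial>lborel) = ?E / \<beta> * exp (- \<beta> * a) - ?E / \<beta> * exp (- \<beta> * T)"
        using has_bochner_integral_integral_eq[OF FTC] by simp
      also have "C * \<dots> \<le> C * (?E / \<beta> * exp (- \<beta> * a))"
        using C D0 \<beta> by (intro mult_left_mono) auto
      also have "\<dots> = (C / \<beta>) * (?E * exp (- \<beta> * a))" by simp
      also have "\<dots> \<le> (1 / 2) * (?E * exp (- \<beta> * a))" using D0 by (intro mult_right_mono \<beta>(2)) auto
      finally show "u a \<le> D * (1 / 2) ^ Suc n * exp (- \<beta> * a)" by simp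
    qed
  qed
  have "(\<lambda>n. D * (1 / 2) ^ n * exp (- \<beta> * t)) \<longlonglongrightarrow> D * 0 * exp (- \<beta> * t)"
    by (intro tendsto_intros LIMSEQ_power_zero) simp
  then have "u t \<le> D * 0 * exp (- \<beta> * t)"
    by (rule LIMSEQ_le_const) (use iter t in blast)
  then have "u t = 0" using u0[of t] by simp
  then have "AE \<omega> in M. psi (y t \<omega>) = 0"
    unfolding u_def using integral_nonneg_eq_0_iff_AE[OF psi_y_integrable[OF t]] psi_bounds(1) by simp
  then show ?thesis by eventually_elim (rule psi_bounds(5))
qed

end

section \<open>From the hypotheses of the theorem to the abstract equation\<close>

lemma S2_process_bound:
  fixes Y :: "real \<Rightarrow> 'w \<Rightarrow> real"
  assumes Y: "S2_process M H 0 T Y" and T: "0 < T" and m: "\<And>t. t \<in> {0..T} \<Longrightarrow> Y t \<in> borel_measurable M"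
  shows "\<exists>R. integrable M R \<and> (AE \<omega> in M. \<forall>t\<in>{0..T}. (Y t \<omega>)\<^sup>2 \<le> R \<omega>)"
proof -
  \<comment> \<open>A supremum over all times need not be measurable. Rational times give a
    measurable one, dominated by the finite supremum norm, and path continuity extends the bound to
    \<open>[0, T]\<close>.\<close>
  define D where "D = {0<..<T} \<inter> \<rat>"
  have D: "countable D" "D \<subseteq> {0..T}" by (auto simp: D_def countable_rat)
  have clD: "closure D = {0..T}"
    unfolding D_def using T by (subst closure_open_Int_superset) (auto simp: Rats_closure_real)
  define r where "r \<omega> = (SUP t\<in>D. ennreal ((Y t \<omega>)\<^sup>2))" for \<omega>
  have rm[measurable]: "r \<in> borel_measurable M"
    unfolding r_def[abs_def]
  proof (rule borel_measurable_SUP[OF D(1)])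
    fix t assume "t \<in> D"
    then have [measurable]: "Y t \<in> borel_measurable M" using m D(2) by auto
    show "(\<lambda>\<omega>. ennreal ((Y t \<omega>)\<^sup>2)) \<in> borel_measurable M" by measurable
  qed
  have "(\<integral>\<^sup>+\<omega>. r \<omega> \<partial>M) \<le> (\<integral>\<^sup>+ \<omega>. (SUP t\<in>{0..T}. ennreal ((norm (Y t \<omega>))\<^sup>2)) \<partial>M)"
    unfolding r_def using D(2) by (intro nn_integral_mono) (auto intro!: SUP_subset_mono)
  also have "\<dots> < \<infinity>" using Y by (simp add: S2_process_def)
  finally have fin: "(\<integral>\<^sup>+\<omega>. r \<omega> \<partial>M) < \<infinity>" .
  then have ae: "AE \<omega> in M. r \<omega> \<noteq> \<infinity>" by (intro nn_integral_noteq_infinite rm) auto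
  define R where "R \<omega> = enn2real (r \<omega>)" for \<omega>
  have Ri: "integrable M R"
  proof (rule integrableI_bounded)
    show "R \<in> borel_measurable M" unfolding R_def[abs_def] by measurable
    have "(\<integral>\<^sup>+\<omega>. ennreal (norm (R \<omega>)) \<partial>M) \<le> (\<integral>\<^sup>+\<omega>. r \<omega> \<partial>M)"
      by (intro nn_integral_mono) (auto simp: R_def ennreal_enn2real_if)
    then show "(\<integral>\<^sup>+\<omega>. ennreal (norm (R \<omega>)) \<partial>M) < \<infinity>" using fin by (rule le_less_trans)
  qed
  have "AE \<omega> in M. continuous_on {0..T} (\<lambda>t. Y t \<omega>)" using Y by (simp add: S2_process_def)
  then have "AE \<omega> in M. \<forall>t\<in>{0..T}. (Y t \<omega>)\<^sup>2 \<le> R \<omega>"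
    using ae
  proof eventually_elim
    case (elim \<omega>)
    show ?case
    proof
      fix t assume t: "t \<in> {0..T}"
      show "(Y t \<omega>)\<^sup>2 \<le> R \<omega>"
      proof (rule continuous_le_on_closure[where S=D and f="\<lambda>t. (Y t \<omega>)\<^sup>2"])
        show "continuous_on (closure D) (\<lambda>t. (Y t \<omega>)\<^sup>2)" unfolding clD by (intro continuous_intros elim(1))
        show "t \<in> closure D" unfolding clD by (rule t)
        fix q assume "q \<in> D"
        then have "ennreal ((Y q \<omega>)\<^sup>2) \<le> r \<omega>" unfolding r_def by (rule SUP_upper)
        also have "r \<omega> = ennreal (R \<omega>)" using elim(2) by (simp add: R_def less_top)
        finally show "(Y q \<omega>)\<^sup>2 \<le> R \<omega>" by (simp add: R_def)
      qed
    qed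
  qed
  with Ri show ?thesis by blast
qed

lemma progressive_diff:
  fixes \<phi> \<phi>' :: "real \<Rightarrow> 'w \<Rightarrow> 'a::euclidean_space"
  assumes "progressive M H a b \<phi>" "progressive M H a b \<phi>'"
  shows "progressive M H a b (\<lambda>t \<omega>. \<phi> t \<omega> - \<phi>' t \<omega>)"
proof -
  have "(\<lambda>x. (case x of (\<omega>, t) \<Rightarrow> \<phi> t \<omega>) - (case x of (\<omega>, t) \<Rightarrow> \<phi>' t \<omega>)) \<in> borel_measurable (M \<Otimes>\<^sub>M restrict_space borel {a..b})"
    using assms by (intro borel_measurable_diff) (auto simp: progressive_def)
  moreover have "(\<lambda>\<omega>. \<phi> t \<omega> - \<phi>' t \<omega>) \<in> borel_measurable (H t)" if "t \<in> {a..b}" for t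
    using assms that by (intro borel_measurable_diff) (auto simp: progressive_def)
  ultimately show ?thesis by (simp add: progressive_def case_prod_beta')
qed

lemma cutoff_diff: "cutoff a b (\<lambda>t \<omega>. \<phi> t \<omega> - \<phi>' t \<omega>) x = cutoff a b \<phi> x - cutoff a b \<phi>' x"
  by (simp add: cutoff_def scaleR_diff_right)

text \<open>The continuity feeds the density argument for the comparison of generators; the linear
  bound is the form in which \<open>psi_drift\<close> takes the Lipschitz condition.\<close>

lemma Lipschitz_pair:
  fixes h :: "real \<Rightarrow> 'a::euclidean_space \<Rightarrow> real"
  assumes "0 < c" and lip: "\<forall>y y' z z'. \<bar>h y z - h y' z'\<bar>\<^sup>2 \<le> c * (\<bar>y - y'\<bar>\<^sup>2 + (norm (z - z'))\<^sup>2)"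
  shows "continuous_on UNIV (\<lambda>p. h (fst p) (snd p))"
    "\<bar>h y z - h y' z'\<bar> \<le> sqrt c * (\<bar>y - y'\<bar> + norm (z - z'))"
proof -
  have le: "\<bar>h y z - h y' z'\<bar> \<le> sqrt c * sqrt (\<bar>y - y'\<bar>\<^sup>2 + (norm (z - z'))\<^sup>2)" for y y' z z'
  proof -
    have "\<bar>h y z - h y' z'\<bar>\<^sup>2 \<le> c * (\<bar>y - y'\<bar>\<^sup>2 + (norm (z - z'))\<^sup>2)" using lip by blast
    from real_le_rsqrt[OF this] show ?thesis by (simp only: real_sqrt_mult)
  qed
  show "\<bar>h y z - h y' z'\<bar> \<le> sqrt c * (\<bar>y - y'\<bar> + norm (z - z'))"
    using assms(1) by (intro order_trans[OF le] mult_left_mono sqrt_sum_squares_le_sum) auto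
  have "(sqrt c)-lipschitz_on UNIV (\<lambda>p. h (fst p) (snd p))"
  proof (rule lipschitz_onI)
    fix p p' :: "real \<times> 'a"
    show "dist (h (fst p) (snd p)) (h (fst p') (snd p')) \<le> sqrt c * dist p p'"
      using le[of "fst p" "snd p" "fst p'" "snd p'"] by (simp add: dist_prod_def dist_norm)
  qed (use assms(1) in simp)
  then show "continuous_on UNIV (\<lambda>p. h (fst p) (snd p))" by (rule lipschitz_on_continuous_on)
qed

text \<open>The exceptional null set of the hypothesis depends on \<open>(y, z)\<close>, whereas the
  random values of a solution are to be inserted. A countable dense set and continuity produce one
  null set for all arguments.\<close>

lemma AE_le_all:
  fixes h h' :: "real \<Rightarrow> 'a::euclidean_space \<Rightarrow> 'w \<Rightarrow> real"
  assumes le: "\<And>y z. AE \<omega> in M. h y z \<omega> \<le> h' y z \<omega>"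
    and cont: "AE \<omega> in M. continuous_on UNIV (\<lambda>p. h (fst p) (snd p) \<omega>)" "AE \<omega> in M. continuous_on UNIV (\<lambda>p. h' (fst p) (snd p) \<omega>)"
  shows "AE \<omega> in M. \<forall>y z. h y z \<omega> \<le> h' y z \<omega>"
proof -
  obtain D :: "(real \<times> 'a) set" where D: "countable D" "\<And>X. open X \<Longrightarrow> X \<noteq> {} \<Longrightarrow> \<exists>d\<in>D. d \<in> X"
    using countable_dense_exists by blast
  have "AE \<omega> in M. \<forall>d\<in>D. h (fst d) (snd d) \<omega> \<le> h' (fst d) (snd d) \<omega>"
    using le by (simp add: AE_ball_countable[OF D(1)])
  then show ?thesis using cont
  proof eventually_elim
    case (elim \<omega>)
    have "open {p. h' (fst p) (snd p) \<omega> < h (fst p) (snd p) \<omega>}"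
      by (rule open_Collect_less[OF elim(3,2)])
    then have "{p. h' (fst p) (snd p) \<omega> < h (fst p) (snd p) \<omega>} = {}"
      using D(2) elim(1) by (metis (mono_tags, lifting) mem_Collect_eq not_less)
    then show ?case by (auto simp: set_eq_iff not_less)
  qed
qed

text \<open>The coefficient conditions hold almost surely at each fixed time; for a measurable
  property Fubini turns this into an almost everywhere statement on the product.\<close>

lemma (in pair_sigma_finite) AE_pair_measure_slices:
  assumes "{x\<in>space (M1 \<Otimes>\<^sub>M M2). P x} \<in> sets (M1 \<Otimes>\<^sub>M M2)" and "AE y in M2. AE x in M1. P (x, y)"
  shows "AE p in M1 \<Otimes>\<^sub>M M2. P p"
proof (rule AE_pair_measure[OF assms(1)])
  show "AE x in M1. AE y in M2. P (x, y)"
    using AE_commute[of "\<lambda>x y. P (x, y)"] assms by simp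
qed

text \<open>A solution comes only with pathwise integrability of its generator. Square integrability
  follows by comparing with the generator at \<open>(0, 0)\<close> through the Lipschitz
  condition.\<close>

lemma generator_sq_int:
  fixes M :: "'w measure" and f :: "real \<Rightarrow> real \<Rightarrow> real ^ 'd \<Rightarrow> 'w \<Rightarrow> real" and Y :: "real \<Rightarrow> 'w \<Rightarrow> real" and Z :: "real \<Rightarrow> 'w \<Rightarrow> real ^ 'd"
  defines "\<F> \<equiv> \<lambda>s \<omega>. f s (Y s \<omega>) (Z s \<omega>) \<omega>" and "NT \<equiv> M \<Otimes>\<^sub>M (lborel :: real measure)"
  assumes "prob_space M" and T: "0 < T"
    and f0: "progressive M H 0 T (\<lambda>t. f t 0 0)" "mean_sq M 0 T (\<lambda>t. f t 0 0) < \<infinity>"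
    and Y: "sq_int NT (cutoff 0 T Y)" and Z: "sq_int NT (cutoff 0 T Z)" and \<F>: "progressive M H 0 T \<F>"
    and lip: "\<And>t. t \<in> {0..T} \<Longrightarrow> AE \<omega> in M. \<forall>y y' z z'.
          \<bar>f t y z \<omega> - f t y' z' \<omega>\<bar>\<^sup>2 \<le> c * (\<bar>y - y'\<bar>\<^sup>2 + (norm (z - z'))\<^sup>2)"
  shows "sq_int NT (cutoff 0 T \<F>)"
proof -
  interpret prob_space M by fact
  interpret P: pair_sigma_finite M "lborel :: real measure" ..
  have s0: "sq_int NT (cutoff 0 T (\<lambda>t. f t 0 0))"
    unfolding NT_def by (rule L2_process_sq_int[of M H]) (use f0 T in \<open>auto simp: L2_process_def\<close>)
  have \<F>m: "cutoff 0 T \<F> \<in> borel_measurable NT"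
    unfolding NT_def by (rule cutoff_measurable[OF \<F>]) (use T in simp)
  let ?b = "\<lambda>x. 2 * (norm (cutoff 0 T (\<lambda>t. f t 0 0) x))\<^sup>2 + 2 * (c * ((norm (cutoff 0 T Y x))\<^sup>2 + (norm (cutoff 0 T Z x))\<^sup>2))"
  show ?thesis
  proof (rule sq_int_bound[OF \<F>m])
    show "integrable NT ?b"
      using s0 Y Z by (intro Bochner_Integration.integrable_add integrable_mult_right sq_int_integrable)
    show "AE x in NT. (norm (cutoff 0 T \<F> x))\<^sup>2 \<le> ?b x"
      unfolding NT_def
    proof (rule P.AE_pair_measure_slices)
      note [measurable] = \<F>m sq_int_measurable[OF s0] sq_int_measurable[OF Y] sq_int_measurable[OF Z]
      show "{x \<in> space (M \<Otimes>\<^sub>M lborel). (norm (cutoff 0 T \<F> x))\<^sup>2 \<le> ?b x} \<in> sets (M \<Otimes>\<^sub>M lborel)"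
        unfolding NT_def[symmetric] by measurable
      show "AE t in lborel. AE \<omega> in M. (norm (cutoff 0 T \<F> (\<omega>, t)))\<^sup>2 \<le> ?b (\<omega>, t)"
      proof (rule AE_I2)
        fix t :: real
        show "AE \<omega> in M. (norm (cutoff 0 T \<F> (\<omega>, t)))\<^sup>2 \<le> ?b (\<omega>, t)"
        proof (cases "t \<in> {0..T}")
          case True
          from lip[OF True] show ?thesis
          proof eventually_elim
            case (elim \<omega>)
            have "\<bar>\<F> t \<omega> - f t 0 0 \<omega>\<bar>\<^sup>2 \<le> c * (\<bar>Y t \<omega> - 0\<bar>\<^sup>2 + (norm (Z t \<omega> - 0))\<^sup>2)"
              unfolding \<F>_def using elim by blast
            moreover have "(\<F> t \<omega>)\<^sup>2 \<le> 2 * (f t 0 0 \<omega>)\<^sup>2 + 2 * (\<F> t \<omega> - f t 0 0 \<omega>)\<^sup>2"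
              using power2_norm_add_le[of "f t 0 0 \<omega>" "\<F> t \<omega> - f t 0 0 \<omega>"] by simp
            ultimately show ?case using True by (simp add: cutoff_def)
          qed
        qed (simp add: cutoff_def)
      qed
    qed
  qed
qed

lemma S2_process_sq_int:
  fixes Y :: "real \<Rightarrow> 'w \<Rightarrow> real"
  assumes "prob_space M" and T: "0 < T" and Y: "progressive M H 0 T Y"
    and R: "integrable M R" "AE \<omega> in M. \<forall>t\<in>{0..T}. (Y t \<omega>)\<^sup>2 \<le> R \<omega>"
  shows "sq_int (M \<Otimes>\<^sub>M lborel) (cutoff 0 T Y)"
proof -
  interpret prob_space M by fact
  interpret P: pair_sigma_finite M "lborel :: real measure" ..
  have m: "cutoff 0 T Y \<in> borel_measurable (M \<Otimes>\<^sub>M lborel)"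
    by (rule cutoff_measurable[OF Y]) (use T in simp)
  have Rm[measurable]: "R \<in> borel_measurable M" using R(1) by auto
  have w[measurable]: "{0..T} \<in> sets borel" by simp
  have "integrable (M \<Otimes>\<^sub>M lborel) (\<lambda>x. indicator {0..T} (snd x) * R (fst x))"
  proof (rule P.Fubini_integrable)
    show "(\<lambda>x. indicator {0..T} (snd x) * R (fst x)) \<in> borel_measurable (M \<Otimes>\<^sub>M lborel)" by measurable
  qed (use R(1) T in \<open>auto simp: abs_mult intro!: integrable_real_indicator\<close>)
  then show ?thesis
  proof (rule sq_int_bound[OF m])
    show "AE x in M \<Otimes>\<^sub>M lborel. (norm (cutoff 0 T Y x))\<^sup>2 \<le> indicator {0..T} (snd x) * R (fst x)"
      using P.AE_fst[OF R(2)] by eventually_elim (auto simp: cutoff_def indicator_def)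
  qed
qed

theorem theorem4p1:
  fixes M :: "'w measure" and T K c \<alpha>\<^sub>1 :: real
    and W :: "real \<Rightarrow> 'w \<Rightarrow> real ^ 'd" and B :: "real \<Rightarrow> 'w \<Rightarrow> real ^ 'l"
    and f :: "nat \<Rightarrow> real \<Rightarrow> real \<Rightarrow> real ^ 'd \<Rightarrow> 'w \<Rightarrow> real"
    and g :: "real \<Rightarrow> real \<Rightarrow> real ^ 'd \<Rightarrow> 'w \<Rightarrow> real ^ 'l"
    and \<xi> :: "nat \<Rightarrow> 'w \<Rightarrow> real"
    and Y :: "nat \<Rightarrow> real \<Rightarrow> 'w \<Rightarrow> real" and Z :: "nat \<Rightarrow> real \<Rightarrow> 'w \<Rightarrow> real ^ 'd"
  defines "\<G> \<equiv> bd_sigma M (T + K) W B"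
  assumes "prob_space M" and "T > 0" and "K \<ge> 0"
    and "brownian_motion M (T + K) W" and "brownian_motion M (T + K) B"
    and "indep_processes M (T + K) W B"
    and "c > 0" and "0 < \<alpha>\<^sub>1" and "\<alpha>\<^sub>1 < 1"
    and f_L2: "\<And>j t y z. j \<in> {1, 2} \<Longrightarrow> t \<in> {0..T} \<Longrightarrow> L2_rv M (\<G> t) (f j t y z)"
    and f_prog: "\<And>j y z. j \<in> {1, 2} \<Longrightarrow> progressive M \<G> 0 T (\<lambda>t. f j t y z)"
    and f_lip: "\<And>j t. j \<in> {1, 2} \<Longrightarrow> t \<in> {0..T} \<Longrightarrow> AE \<omega> in M. \<forall>y y' z z'.
          \<bar>f j t y z \<omega> - f j t y' z' \<omega>\<bar>\<^sup>2 \<le> c * (\<bar>y - y'\<bar>\<^sup>2 + (norm (z - z'))\<^sup>2)"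
    and f_int: "\<And>j. j \<in> {1, 2} \<Longrightarrow> mean_sq M 0 T (\<lambda>t. f j t 0 0) < \<infinity>"
    and g_L2: "\<And>t y z. t \<in> {0..T} \<Longrightarrow> L2_rv M (\<G> t) (g t y z)"
    and g_prog: "\<And>y z. progressive M \<G> 0 T (\<lambda>t. g t y z)"
    and g_lip: "\<And>t. t \<in> {0..T} \<Longrightarrow> AE \<omega> in M. \<forall>y y' z z'.
          (norm (g t y z \<omega> - g t y' z' \<omega>))\<^sup>2 \<le> c * \<bar>y - y'\<bar>\<^sup>2 + \<alpha>\<^sub>1 * (norm (z - z'))\<^sup>2"
    and g_int: "\<And>y z. mean_sq M 0 T (\<lambda>t. g t y z) < \<infinity>"
    and xi_L2: "\<And>j. j \<in> {1, 2} \<Longrightarrow> L2_rv M (\<G> T) (\<xi> j)"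
    and sol: "\<And>j. j \<in> {1, 2} \<Longrightarrow> bdsde_solution M T K W B (f j) g (\<xi> j) (Y j) (Z j)"
    and xi_ge: "AE \<omega> in M. \<xi> 1 \<omega> \<ge> \<xi> 2 \<omega>"
    and f_ge: "\<And>t y z. t \<in> {0..T} \<Longrightarrow> AE \<omega> in M. f 1 t y z \<omega> \<ge> f 2 t y z \<omega>"
  shows "\<forall>t\<in>{0..T}. AE \<omega> in M. Y 1 t \<omega> \<ge> Y 2 t \<omega>"
proof -
  note T = \<open>0 < T\<close> and K = \<open>0 \<le> K\<close>
  have M: "prob_space M" by fact
  interpret prob_space M by fact
  interpret brownian_pair M "T + K" W B
    by unfold_locales (use T K \<open>brownian_motion M (T + K) W\<close> \<open>brownian_motion M (T + K) B\<close> \<open>indep_processes M (T + K) W B\<close> in auto)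
  let ?N = "M \<Otimes>\<^sub>M (lborel :: real measure)"
  define \<F> where "\<F> j s \<omega> = f j s (Y j s \<omega>) (Z j s \<omega>) \<omega>" for j s \<omega>
  define G where "G j s \<omega> = g s (Y j s \<omega>) (Z j s \<omega>) \<omega>" for j s \<omega>
  have s: "S2_process M \<G> 0 T (Y j)" "L2_process M \<G> 0 T (Z j)" "progressive M \<G> 0 T (\<F> j)"
      "AE \<omega> in M. set_integrable lborel {0..T} (\<lambda>s. \<F> j s \<omega>)" "L2_process M \<G> 0 T (G j)"
      "\<forall>t\<in>{0..T}. \<exists>I J. has_backward_ito_integral M HB B t T (G j) I \<and> has_ito_integral M HF W t T (Z j) J \<and>
            (AE \<omega> in M. Y j t \<omega> = \<xi> j \<omega> + (LINT s:{t..T}|lborel. \<F> j s \<omega>) + I \<omega> - J \<omega>)"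
    if "j \<in> {1, 2}" for j
    using sol[OF that] unfolding bdsde_solution_def Let_def \<F>_def[abs_def] G_def[abs_def] \<G>_def by simp_all
  have j: "1 \<in> {1, 2::nat}" "2 \<in> {1, 2::nat}" by auto
  have TS: "0 \<le> T" "T \<le> T + K" using T K by auto
  have Yp: "progressive M \<G> 0 T (Y j)" if "j \<in> {1, 2}" for j using s(1)[OF that] by (simp add: S2_process_def)
  have Ym: "Y j t \<in> borel_measurable M" if "j \<in> {1, 2}" "t \<in> {0..T}" for j t
  proof -
    have "Y j t \<in> borel_measurable (\<G> t)" using Yp[OF that(1)] that(2) by (simp add: progressive_def)
    then have "Y j t \<in> borel_measurable (HF t)" unfolding \<G>_def
      by (rule measurable_mono_sigma) (use that TS bd_subset[of t] in \<open>auto simp: space_filtrations\<close>)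
    then show ?thesis by (rule fwd.H_measurable[rotated 2]) (use that TS in auto)
  qed
  obtain R1 where R1: "integrable M R1" "AE \<omega> in M. \<forall>t\<in>{0..T}. (Y 1 t \<omega>)\<^sup>2 \<le> R1 \<omega>"
    using S2_process_bound[OF s(1)[OF j(1)] T Ym[OF j(1)]] by blast
  obtain R2 where R2: "integrable M R2" "AE \<omega> in M. \<forall>t\<in>{0..T}. (Y 2 t \<omega>)\<^sup>2 \<le> R2 \<omega>"
    using S2_process_bound[OF s(1)[OF j(2)] T Ym[OF j(2)]] by blast
  have Ysq: "sq_int ?N (cutoff 0 T (Y 1))" "sq_int ?N (cutoff 0 T (Y 2))"
    by (rule S2_process_sq_int[OF M T Yp R1], simp) (rule S2_process_sq_int[OF M T Yp R2], simp)
  have Zsq: "sq_int ?N (cutoff 0 T (Z j))" and Gsq: "sq_int ?N (cutoff 0 T (G j))" if "j \<in> {1, 2}" for j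
    by (rule L2_process_sq_int[OF s(2)[OF that] TS(1)], rule L2_process_sq_int[OF s(5)[OF that] TS(1)])
  have Fsq: "sq_int ?N (cutoff 0 T (\<F> j))" if "j \<in> {1, 2}" for j
    unfolding \<F>_def[abs_def]
    by (rule generator_sq_int[OF M T f_prog[OF that] f_int[OF that] _ Zsq[OF that] _ f_lip[OF that]])
      (use that Ysq s(3)[OF that] in \<open>auto simp: \<F>_def[abs_def]\<close>)
  define y where "y t \<omega> = Y 2 t \<omega> - Y 1 t \<omega>" for t \<omega>
  define F where "F = cutoff 0 T (\<lambda>t \<omega>. \<F> 2 t \<omega> - \<F> 1 t \<omega>)"
  define \<Gamma> where "\<Gamma> = cutoff 0 T (\<lambda>t \<omega>. G 2 t \<omega> - G 1 t \<omega>)"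
  define z where "z = cutoff 0 T (\<lambda>t \<omega>. Z 2 t \<omega> - Z 1 t \<omega>)"
  have cut: "F (\<omega>, t) = \<F> 2 t \<omega> - \<F> 1 t \<omega>" "\<Gamma> (\<omega>, t) = G 2 t \<omega> - G 1 t \<omega>" "z (\<omega>, t) = Z 2 t \<omega> - Z 1 t \<omega>"
    if "t \<in> {0..T}" for t \<omega>
    using that by (simp_all add: F_def \<Gamma>_def z_def cutoff_def)
  interpret D: bdsde_difference M "T + K" W B T y F \<Gamma> z "\<lambda>\<omega>. 2 * R1 \<omega> + 2 * R2 \<omega>" "\<lambda>\<omega>. \<xi> 2 \<omega> - \<xi> 1 \<omega>"
  proof
    show "progressive M (bd_sigma M (T + K) W B) 0 T y"
      unfolding y_def[abs_def] \<G>_def[symmetric] by (intro progressive_diff Yp j)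
    have "AE \<omega> in M. continuous_on {0..T} (\<lambda>t. Y 1 t \<omega>)" "AE \<omega> in M. continuous_on {0..T} (\<lambda>t. Y 2 t \<omega>)"
      using s(1)[OF j(1)] s(1)[OF j(2)] by (simp_all add: S2_process_def)
    then show "AE \<omega> in M. continuous_on {0..T} (\<lambda>t. y t \<omega>)"
      unfolding y_def by eventually_elim (intro continuous_intros)
    show "integrable M (\<lambda>\<omega>. 2 * R1 \<omega> + 2 * R2 \<omega>)" using R1(1) R2(1) by simp
    show "AE \<omega> in M. \<forall>t\<in>{0..T}. (y t \<omega>)\<^sup>2 \<le> 2 * R1 \<omega> + 2 * R2 \<omega>"
      using R1(2) R2(2)
    proof eventually_elim
      case (elim \<omega>)
      show ?case
      proof
        fix t assume "t \<in> {0..T}"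
        then have "(Y 1 t \<omega>)\<^sup>2 \<le> R1 \<omega>" "(Y 2 t \<omega>)\<^sup>2 \<le> R2 \<omega>" using elim by auto
        then show "(y t \<omega>)\<^sup>2 \<le> 2 * R1 \<omega> + 2 * R2 \<omega>"
          using power2_norm_add_le[of "Y 2 t \<omega>" "- Y 1 t \<omega>"] by (simp add: y_def)
      qed
    qed
    show "sq_int ?N F" "sq_int ?N \<Gamma>" "sq_int ?N z"
      unfolding F_def \<Gamma>_def z_def cutoff_diff[abs_def] by (intro sq_int_diff Fsq Gsq Zsq j)+
    fix p assume p: "p \<in> {0..T}"
    obtain I1 J1 where 1: "has_backward_ito_integral M HB B p T (G 1) I1" "has_ito_integral M HF W p T (Z 1) J1"
      "AE \<omega> in M. Y 1 p \<omega> = \<xi> 1 \<omega> + (LINT s:{p..T}|lborel. \<F> 1 s \<omega>) + I1 \<omega> - J1 \<omega>"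
      using bspec[OF s(6)[OF j(1)] p] by (elim exE conjE)
    obtain I2 J2 where 2: "has_backward_ito_integral M HB B p T (G 2) I2" "has_ito_integral M HF W p T (Z 2) J2"
      "AE \<omega> in M. Y 2 p \<omega> = \<xi> 2 \<omega> + (LINT s:{p..T}|lborel. \<F> 2 s \<omega>) + I2 \<omega> - J2 \<omega>"
      using bspec[OF s(6)[OF j(2)] p] by (elim exE conjE)
    have pT: "0 \<le> p" "p \<le> T" "- (T + K) \<le> - T" "- p \<le> 0" "- T \<le> - p" using p K by auto
    \<comment> \<open>The integrands of the equation at \<open>p\<close> are cut off to
      \<open>[p, T]\<close>, whereas \<open>\<Gamma>\<close> is fixed once and for all on
      \<open>[0, T]\<close>; the indicator reconciles the two.\<close>
    have eG: "(\<lambda>x. cutoff p T (G 2) x - cutoff p T (G 1) x) = (\<lambda>x. indicator {p..T} (snd x) *\<^sub>R \<Gamma> x)"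
      using pT by (auto simp: fun_eq_iff cutoff_def \<Gamma>_def indicator_def)
    have eZ: "(\<lambda>x. cutoff p T (Z 2) x - cutoff p T (Z 1) x) = (\<lambda>x. indicator {p..T} (snd x) *\<^sub>R z x)"
      using pT by (auto simp: fun_eq_iff cutoff_def z_def indicator_def)
    have i1: "bwd.ito (- T) (- p) (\<lambda>x. indicator {p..T} (snd x) *\<^sub>R \<Gamma> x) (\<lambda>\<omega>. I2 \<omega> - I1 \<omega>)"
      unfolding eG[symmetric]
      by (rule bwd.ito_diff[OF pT(3,4,5)]; rule has_backward_ito_integral_ito[OF _ pT(1,2) TS(2)]; fact)
    have i2: "fwd.ito p T (\<lambda>x. indicator {p..T} (snd x) *\<^sub>R z x) (\<lambda>\<omega>. J2 \<omega> - J1 \<omega>)"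
      unfolding eZ[symmetric]
      by (rule fwd.ito_diff[OF pT(1) TS(2) pT(2)]; rule has_ito_integral_ito[OF _ pT(1,2) TS(2)]; fact)
    have i3: "AE \<omega> in M. y p \<omega> = (\<xi> 2 \<omega> - \<xi> 1 \<omega>) + (\<integral>t. indicator {p..T} t * F (\<omega>, t) \<partial>lborel) + (I2 \<omega> - I1 \<omega>) - (J2 \<omega> - J1 \<omega>)"
      using 1(3) 2(3) s(4)[OF j(1)] s(4)[OF j(2)]
    proof eventually_elim
      case (elim \<omega>)
      have i: "set_integrable lborel {p..T} (\<lambda>s. \<F> 1 s \<omega>)" "set_integrable lborel {p..T} (\<lambda>s. \<F> 2 s \<omega>)"
        by (rule set_integrable_subset[OF elim(3)], use pT in auto) (rule set_integrable_subset[OF elim(4)], use pT in auto)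
      have "(LINT s:{p..T}|lborel. \<F> 2 s \<omega>) - (LINT s:{p..T}|lborel. \<F> 1 s \<omega>) = (LINT s:{p..T}|lborel. \<F> 2 s \<omega> - \<F> 1 s \<omega>)"
        by (rule set_integral_diff(2)[OF i(2,1), symmetric])
      also have "\<dots> = (\<integral>t. indicator {p..T} t * F (\<omega>, t) \<partial>lborel)"
        unfolding set_lebesgue_integral_def
        by (intro Bochner_Integration.integral_cong refl) (use pT cut in \<open>auto simp: indicator_def\<close>)
      finally show ?case using elim(1,2) by (simp add: y_def)
    qed
    show "\<exists>I J. bwd.ito (- T) (- p) (\<lambda>x. indicator {p..T} (snd x) *\<^sub>R \<Gamma> x) I \<and>
      fwd.ito p T (\<lambda>x. indicator {p..T} (snd x) *\<^sub>R z x) J \<and>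
      (AE \<omega> in M. y p \<omega> = \<xi> 2 \<omega> - \<xi> 1 \<omega> + (\<integral>t. indicator {p..T} t * F (\<omega>, t) \<partial>lborel) + I \<omega> - J \<omega>)"
      by (intro exI conjI; fact)
  qed (use T K in auto)
  let ?C = "3 * sqrt c + c / (1 - \<alpha>\<^sub>1) + 3 * c"
  have C: "0 \<le> ?C" using \<open>0 < c\<close> \<open>\<alpha>\<^sub>1 < 1\<close> by simp
  have slices: "AE \<omega> in M. F (\<omega>, t) \<le> sqrt c * (\<bar>y t \<omega>\<bar> + norm (z (\<omega>, t))) \<and>
      (norm (\<Gamma> (\<omega>, t)))\<^sup>2 \<le> c * (y t \<omega>)\<^sup>2 + \<alpha>\<^sub>1 * (norm (z (\<omega>, t)))\<^sup>2" if t: "t \<in> {0..T}" for t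
  proof -
    note lip1 = f_lip[OF j(1) t] and lip2 = f_lip[OF j(2) t]
    have c1: "AE \<omega> in M. continuous_on UNIV (\<lambda>p. f 1 t (fst p) (snd p) \<omega>)"
      using lip1 by eventually_elim (rule Lipschitz_pair(1)[OF \<open>0 < c\<close>])
    have c2: "AE \<omega> in M. continuous_on UNIV (\<lambda>p. f 2 t (fst p) (snd p) \<omega>)"
      using lip2 by eventually_elim (rule Lipschitz_pair(1)[OF \<open>0 < c\<close>])
    have "AE \<omega> in M. \<forall>y z. f 2 t y z \<omega> \<le> f 1 t y z \<omega>"
      by (rule AE_le_all[OF f_ge[OF t] c2 c1])
    then show ?thesis using lip2 g_lip[OF t]
    proof eventually_elim
      case (elim \<omega>)
      \<comment> \<open>The generators are compared at the arguments of the first solution, so that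
        only the Lipschitz condition of the second generator remains to be used.\<close>
      have "\<F> 2 t \<omega> - \<F> 1 t \<omega> \<le> f 2 t (Y 2 t \<omega>) (Z 2 t \<omega>) \<omega> - f 2 t (Y 1 t \<omega>) (Z 1 t \<omega>) \<omega>"
        using elim(1) by (simp add: \<F>_def)
      also have "\<dots> \<le> \<bar>f 2 t (Y 2 t \<omega>) (Z 2 t \<omega>) \<omega> - f 2 t (Y 1 t \<omega>) (Z 1 t \<omega>) \<omega>\<bar>" by (rule abs_ge_self)
      also have "\<dots> \<le> sqrt c * (\<bar>Y 2 t \<omega> - Y 1 t \<omega>\<bar> + norm (Z 2 t \<omega> - Z 1 t \<omega>))"
        by (rule Lipschitz_pair(2)[OF \<open>0 < c\<close> elim(2)])
      finally have "F (\<omega>, t) \<le> sqrt c * (\<bar>y t \<omega>\<bar> + norm (z (\<omega>, t)))" using cut[OF t] by (simp add: y_def)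
      moreover have "(norm (G 2 t \<omega> - G 1 t \<omega>))\<^sup>2 \<le> c * \<bar>Y 2 t \<omega> - Y 1 t \<omega>\<bar>\<^sup>2 + \<alpha>\<^sub>1 * (norm (Z 2 t \<omega> - Z 1 t \<omega>))\<^sup>2"
        unfolding G_def using elim(3) by blast
      ultimately show ?case using cut[OF t] by (simp add: y_def)
    qed
  qed
  let ?y = "D.yv (\<lambda>t. t)"
  have "AE x in ?N. snd x \<in> {0..T} \<longrightarrow> F x \<le> sqrt c * (\<bar>?y x\<bar> + norm (z x)) \<and>
      (norm (\<Gamma> x))\<^sup>2 \<le> c * (?y x)\<^sup>2 + \<alpha>\<^sub>1 * (norm (z x))\<^sup>2"
  proof (rule fwd.MT.AE_pair_measure_slices)
    have [measurable]: "?y \<in> borel_measurable ?N" "F \<in> borel_measurable ?N" "\<Gamma> \<in> borel_measurable ?N" "z \<in> borel_measurable ?N"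
      using D.yv_measurable D.F D.\<Gamma> D.z by (simp_all add: sq_int_def)
    show "{x \<in> space ?N. snd x \<in> {0..T} \<longrightarrow> F x \<le> sqrt c * (\<bar>?y x\<bar> + norm (z x)) \<and>
      (norm (\<Gamma> x))\<^sup>2 \<le> c * (?y x)\<^sup>2 + \<alpha>\<^sub>1 * (norm (z x))\<^sup>2} \<in> sets ?N" by measurable
    show "AE t in lborel. AE \<omega> in M. snd (\<omega>, t) \<in> {0..T} \<longrightarrow> F (\<omega>, t) \<le> sqrt c * (\<bar>?y (\<omega>, t)\<bar> + norm (z (\<omega>, t))) \<and>
      (norm (\<Gamma> (\<omega>, t)))\<^sup>2 \<le> c * (?y (\<omega>, t))\<^sup>2 + \<alpha>\<^sub>1 * (norm (z (\<omega>, t)))\<^sup>2"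
    proof (rule AE_I2)
      fix t :: real
      show "AE \<omega> in M. snd (\<omega>, t) \<in> {0..T} \<longrightarrow> F (\<omega>, t) \<le> sqrt c * (\<bar>?y (\<omega>, t)\<bar> + norm (z (\<omega>, t))) \<and>
        (norm (\<Gamma> (\<omega>, t)))\<^sup>2 \<le> c * (?y (\<omega>, t))\<^sup>2 + \<alpha>\<^sub>1 * (norm (z (\<omega>, t)))\<^sup>2"
        using slices[of t] D.clamp_time(2)[of t] by (cases "t \<in> {0..T}") (simp_all add: D.yv_def)
    qed
  qed
  then have drift: "AE x in ?N. snd x \<in> {0..T} \<longrightarrow> D.drift (\<lambda>t. t) (\<lambda>t. t) x \<le> ?C * psi (?y x)"
  proof eventually_elim
    case (elim x)
    show ?case
    proof
      assume x: "snd x \<in> {0..T}"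
      with elim have "psi' (?y x) * F x + psi'' (?y x) / 2 * ((norm (\<Gamma> x))\<^sup>2 - (norm (z x))\<^sup>2) \<le> ?C * psi (?y x)"
        by (intro psi_drift) (use \<open>0 < c\<close> \<open>\<alpha>\<^sub>1 < 1\<close> in auto)
      then show "D.drift (\<lambda>t. t) (\<lambda>t. t) x \<le> ?C * psi (?y x)"
        using x by (simp add: D.drift_def right_diff_distrib)
    qed
  qed
  have terminal: "AE \<omega> in M. \<xi> 2 \<omega> - \<xi> 1 \<omega> \<le> 0" using xi_ge by eventually_elim simp
  show ?thesis
  proof
    fix t assume t: "t \<in> {0..T}"
    from D.comparison[OF C drift terminal t] show "AE \<omega> in M. Y 2 t \<omega> \<le> Y 1 t \<omega>"
      by eventually_elim (simp add: y_def)
  qed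
qed

end
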